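(* Let $p\in[1,\infty)$, let $0\le\rho\in\mathcal{M}_{\mathrm{loc},\mathrm{unif}}(\mathbb{R})$, $\rho\ne 0$, be periodic, and let $(a,\mu)\in\mathcal{AM}(\mathbb{R})$. Let $C>0$ and suppose that $(a,\mu)$ satisfies the weak Gordon condition with weight $C$ with a period sequence $(p_m)_{m\in\mathbb{N}}$ in $\mathrm{Per}(\rho)$; that is, there is a sequence $(p_m)$ in $\mathrm{Per}(\rho)\cap(0,\infty)$ with $p_m\to\infty$ and $$\lim_{m\to\infty} e^{Cp_m}\Bigl(\|a-a(\cdot+p_m)\|_{L_1(-p_m,p_m)}+\|\mu-\mu(\cdot+p_m)\|_{[-p_m,p_m]}\Bigr)=0.$$ Then the operator $H=H_{p,\rho,a,\mu}$ in $L_p(\mathbb{R},\rho)$ does not have any eigenvalues with modulus less than $$\frac{1}{\|\rho\|_{\mathrm{unif}}}\Bigl(\bigl\|\tfrac1a\bigr\|_\infty^{-1}C^2-\|\mu\|_{\mathrm{unif}}\Bigr).$$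
   Context: Let $\mathbb{K}\in\{\mathbb{R},\mathbb{C}\}$. A local measure is a map $\mu$ from the bounded Borel subsets of $\mathbb{R}$ to $\mathbb{K}$ such that $\mu(\cdot\cap K)$ is a finite $\mathbb{K}$-valued Radon measure for every compact $K\subseteq\mathbb{R}$; $|\mu|$ is its total variation. $\mathcal{M}_{\mathrm{loc},\mathrm{unif}}(\mathbb{R})$ is the set of local measures with $\|\mu\|_{\mathrm{unif}}:=\sup_{t\in\mathbb{R}}|\mu|((t,t+1])<\infty$. Convention: $\int_s^t\dots d\mu:=\int_{(s,t]}\dots d\mu$ if $t\ge s$ and $:=-\int_{(t,s]}\dots d\mu$ if $t<s$. A function $f$ is locally absolutely continuous with respect to $\mu$ if there is $h\in L_{1,\mathrm{loc}}(\mathbb{R},|\mu|)$ with $f(t)=f(c)+\int_c^t h\,d\mu$ for all $t\in\mathbb{R}$ (some $c\in\mathbb{R}$); then $\partial_\mu f:=h$. For a measure $\mu$ and $q\in\mathbb{R}$, $\mu(\cdot+q)$ is the measure $B\mapsto\mu(B+q)$. $\mathrm{Per}(\rho):=\{q\in\mathbb{R}\setminus\{0\}:\rho(\cdot+q)=\rho\}$; $\rho$ is periodic if $\mathrm{Per}(\rho)\neq\varnothing$. $\mathcal{AM}(\mathbb{R})$ is the set of pairs $(a,\mu)$ with $a:\mathbb{R}\to[0,\infty)$ measurable, $a,\frac1a\in L_\infty(\mathbb{R})$, $\mu\in\mathcal{M}_{\mathrm{loc},\mathrm{unif}}(\mathbb{R})$ real and $\mathrm{spt}\,\mu\subseteq\mathrm{spt}\,\rho$.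 For $u\in W^1_{1,\mathrm{loc}}(\mathbb{R})$ (with its continuous representative) set $A_{a,\mu}u(t):=-(au')(t)+\int_0^t u\,d\mu$ for a.a. $t$. $D:=D_{\rho,a,\mu}(\mathbb{R})$ is the set of $u\in W^1_{1,\mathrm{loc}}(\mathbb{R})$ such that $A_{a,\mu}u$ is (has a representative that is) locally absolutely continuous with respect to $\rho$. The operator $H=H_{p,\rho,a,\mu}$ in $L_p(\mathbb{R},\rho)$ has domain $D(H)=\{u\in L_p(\mathbb{R},\rho): u\in D,\ \partial_\rho A_{a,\mu}u\in L_p(\mathbb{R},\rho)\}$ and $Hu:=\partial_\rho A_{a,\mu}u$. For $\mu\in\mathcal{M}_{\mathrm{loc},\mathrm{unif}}(\mathbb{R})$ and $I\subseteq\mathbb{R}$: $\|\mu\|_I:=\sup\{|\int u\,d\mu| : u\in W^1_{1,\mathrm{loc}}(\mathbb{R}),\ \mathrm{spt}\,u\subseteq I,\ \mathrm{diam}\,\mathrm{spt}\,u\le 2,\ \|u'\|_\infty\le 1\}$. *)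

theory Defs
  imports "HOL-Analysis.Analysis" "HOL-Probability.Essential_Supremum"
begin

section \<open>Local measures\<close>

text \<open>
  All local measures below are real (\<open>\<rho> \<ge> 0\<close> and \<open>\<mu>\<close> real); only functions take
  values in the scalar field, which is a type variable \<open>'k\<close> of class
  \<^class>\<open>real_normed_field\<close>.  By the Gelfand--Mazur theorem the models of this class are exactly
  the real and the complex numbers.

  A local measure is a set function whose values matter on bounded Borel sets only.  Finite Borel
  measures on the line are automatically Radon.
\<close>

definition bounded_borel :: "real set set" where
  "bounded_borel = {B \<in> sets borel. bounded B}"

definition local_measure :: "(real set \<Rightarrow> real) \<Rightarrow> bool" where
  "local_measure \<mu> \<longleftrightarrow>
     (\<forall>K. compact K \<longrightarrow>
        \<mu> ({} \<inter> K) = 0 \<and>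
        (\<forall>A :: nat \<Rightarrow> real set. range A \<subseteq> sets borel \<longrightarrow> disjoint_family A \<longrightarrow>
           (\<lambda>n. \<mu> (A n \<inter> K)) sums \<mu> ((\<Union>n. A n) \<inter> K)))"

text \<open>
  Using finite families of disjoint bounded Borel subsets, the total variation is
  defined on unbounded Borel sets, too.
\<close>

definition variation :: "(real set \<Rightarrow> real) \<Rightarrow> real set \<Rightarrow> ennreal" where
  "variation \<mu> B =
     (SUP P \<in> {P. finite P \<and> disjoint P \<and> P \<subseteq> {E \<in> bounded_borel. E \<subseteq> B}}.
        \<Sum>E\<in>P. ennreal \<bar>\<mu> E\<bar>)"

definition variation_measure :: "(real set \<Rightarrow> real) \<Rightarrow> real measure" where
  "variation_measure \<mu> = measure_of UNIV (sets borel) (variation \<mu>)"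

definition unif_norm :: "(real set \<Rightarrow> real) \<Rightarrow> ennreal" where
  "unif_norm \<mu> = (SUP t. variation \<mu> {t<..t + 1})"

definition M_loc_unif :: "(real set \<Rightarrow> real) set" where
  "M_loc_unif = {\<mu>. local_measure \<mu> \<and> unif_norm \<mu> < \<infinity>}"

definition spt_measure :: "(real set \<Rightarrow> real) \<Rightarrow> real set" where
  "spt_measure \<mu> = {x. \<forall>U. open U \<longrightarrow> x \<in> U \<longrightarrow> variation \<mu> U \<noteq> 0}"

definition shift_measure :: "real \<Rightarrow> (real set \<Rightarrow> real) \<Rightarrow> real set \<Rightarrow> real" where
  "shift_measure q \<mu> B = \<mu> ((\<lambda>x. x + q) ` B)"

definition Per :: "(real set \<Rightarrow> real) \<Rightarrow> real set" where
  "Per \<rho> = {q. q \<noteq> 0 \<and> (\<forall>B\<in>bounded_borel. shift_measure q \<rho> B = \<rho> B)}"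

definition periodic_measure :: "(real set \<Rightarrow> real) \<Rightarrow> bool" where
  "periodic_measure \<rho> \<longleftrightarrow> Per \<rho> \<noteq> {}"


section \<open>Integration with respect to a local measure\<close>

text \<open>
  The positive part of the Jordan decomposition; \<open>ennreal\<close> maps negative values to \<open>0\<close>.  The
  negative part of \<open>\<mu>\<close> is the positive part of \<open>-\<mu>\<close>.
\<close>

definition pos_part_measure :: "(real set \<Rightarrow> real) \<Rightarrow> real measure" where
  "pos_part_measure \<mu> =
     measure_of UNIV (sets borel) (\<lambda>B. SUP E \<in> {E \<in> bounded_borel. E \<subseteq> B}. ennreal (\<mu> E))"

definition neg_part_measure :: "(real set \<Rightarrow> real) \<Rightarrow> real measure" where
  "neg_part_measure \<mu> = pos_part_measure (\<lambda>B. - \<mu> B)"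

definition integral_lm ::
    "(real set \<Rightarrow> real) \<Rightarrow> real set \<Rightarrow> (real \<Rightarrow> 'k::{real_normed_field, banach, second_countable_topology}) \<Rightarrow> 'k" where
  "integral_lm \<mu> S f =
     set_lebesgue_integral (pos_part_measure \<mu>) S f - set_lebesgue_integral (neg_part_measure \<mu>) S f"

definition interval_integral_lm ::
    "(real set \<Rightarrow> real) \<Rightarrow> real \<Rightarrow> real \<Rightarrow> (real \<Rightarrow> 'k::{real_normed_field, banach, second_countable_topology}) \<Rightarrow> 'k" where
  "interval_integral_lm \<mu> s t f =
     (if s \<le> t then integral_lm \<mu> {s<..t} f else - integral_lm \<mu> {t<..s} f)"


section \<open>Function spaces\<close>

definition locally_integrable :: "real measure \<Rightarrow> (real \<Rightarrow> 'k::{banach, second_countable_topology}) \<Rightarrow> bool" where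
  "locally_integrable M f \<longleftrightarrow> (\<forall>K. compact K \<longrightarrow> set_integrable M K f)"

text \<open>
  Elements of \<open>L\<^sub>p\<close> are represented by functions, to be identified if they
  agree almost everywhere.
\<close>

definition Lp_fun :: "real \<Rightarrow> real measure \<Rightarrow> (real \<Rightarrow> 'k::{real_normed_field, banach, second_countable_topology}) set" where
  "Lp_fun p M = {f \<in> borel_measurable M. integrable M (\<lambda>x. norm (f x) powr p)}"

definition spt_fun :: "(real \<Rightarrow> 'k::real_normed_field) \<Rightarrow> real set" where
  "spt_fun f = closure {x. f x \<noteq> 0}"

text \<open>Test functions are the compactly supported \<open>C\<^sup>1\<close> functions, as usual in dimension one.\<close>

definition weak_deriv ::
    "(real \<Rightarrow> 'k::{real_normed_field, banach, second_countable_topology}) \<Rightarrow> (real \<Rightarrow> 'k) \<Rightarrow> bool" where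
  "weak_deriv u v \<longleftrightarrow>
     (\<forall>\<phi> \<phi>' :: real \<Rightarrow> real.
        (\<forall>x. (\<phi> has_real_derivative \<phi>' x) (at x)) \<longrightarrow> continuous_on UNIV \<phi>' \<longrightarrow>
        compact (spt_fun \<phi>) \<longrightarrow>
        (LINT x|lebesgue. \<phi>' x *\<^sub>R u x) = - (LINT x|lebesgue. \<phi> x *\<^sub>R v x))"

text \<open>\<open>W11loc u v\<close>: \<open>u\<close> is the continuous representative of an element of \<open>W\<^sup>1\<^sub>1\<^sub>,\<^sub>l\<^sub>o\<^sub>c\<close>,
  and \<open>v\<close> is a representative of \<open>u'\<close>.\<close>

definition W11loc ::
    "(real \<Rightarrow> 'k::{real_normed_field, banach, second_countable_topology}) \<Rightarrow> (real \<Rightarrow> 'k) \<Rightarrow> bool" where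
  "W11loc u v \<longleftrightarrow>
     continuous_on UNIV u \<and> locally_integrable lebesgue u \<and> locally_integrable lebesgue v \<and> weak_deriv u v"

text \<open>\<open>has_lm_deriv \<nu> f h\<close>: \<open>f\<close> is locally absolutely continuous with respect to \<open>\<nu>\<close>
  and \<open>h\<close> is a representative of \<open>\<partial>\<^sub>\<nu> f\<close>.\<close>

definition has_lm_deriv ::
    "(real set \<Rightarrow> real) \<Rightarrow> (real \<Rightarrow> 'k::{real_normed_field, banach, second_countable_topology}) \<Rightarrow> (real \<Rightarrow> 'k) \<Rightarrow> bool" where
  "has_lm_deriv \<nu> f h \<longleftrightarrow>
     locally_integrable (variation_measure \<nu>) h \<and>
     (\<exists>c. \<forall>t. f t = f c + interval_integral_lm \<nu> c t h)"


section \<open>The operator\<close>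

text \<open>The reciprocal is taken in \<^typ>\<open>ennreal\<close>, where \<open>inverse 0 = \<infinity>\<close>: in \<^typ>\<open>real\<close>,
  where \<open>1 / 0 = 0\<close>, the function \<open>a\<close> could vanish on a set of positive measure.\<close>

definition Linf_norm_coeff :: "(real \<Rightarrow> real) \<Rightarrow> ennreal" where
  "Linf_norm_coeff a = esssup lebesgue (\<lambda>x. ennreal (a x))"

definition Linf_norm_recip :: "(real \<Rightarrow> real) \<Rightarrow> ennreal" where
  "Linf_norm_recip a = esssup lebesgue (\<lambda>x. inverse (ennreal (a x)))"

definition AM :: "(real set \<Rightarrow> real) \<Rightarrow> ((real \<Rightarrow> real) \<times> (real set \<Rightarrow> real)) set" where
  "AM \<rho> = {(a, \<mu>). a \<in> borel_measurable lebesgue \<and> (\<forall>x. 0 \<le> a x) \<and>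
     Linf_norm_coeff a < \<infinity> \<and> Linf_norm_recip a < \<infinity> \<and>
     \<mu> \<in> M_loc_unif \<and> spt_measure \<mu> \<subseteq> spt_measure \<rho>}"

text \<open>\<open>is_A a \<mu> u g\<close>: \<open>g\<close> is a representative of the almost everywhere defined function
  \<open>A\<^sub>a\<^sub>,\<^sub>\<mu> u\<close>.\<close>

definition is_A ::
    "(real \<Rightarrow> real) \<Rightarrow> (real set \<Rightarrow> real) \<Rightarrow>
     (real \<Rightarrow> 'k::{real_normed_field, banach, second_countable_topology}) \<Rightarrow> (real \<Rightarrow> 'k) \<Rightarrow> bool" where
  "is_A a \<mu> u g \<longleftrightarrow>
     (\<exists>v. W11loc u v \<and>
        (AE t in lebesgue. g t = - (a t *\<^sub>R v t) + interval_integral_lm \<mu> 0 t u))"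

text \<open>\<open>is_deriv_A \<rho> a \<mu> u h\<close>: \<open>u\<close> belongs to \<open>D\<^bsub>\<rho>,a,\<mu>\<^esub>\<close>
  and \<open>h\<close> is a representative of \<open>\<partial>\<^sub>\<rho> A\<^sub>a\<^sub>,\<^sub>\<mu> u\<close>.\<close>

definition is_deriv_A ::
    "(real set \<Rightarrow> real) \<Rightarrow> (real \<Rightarrow> real) \<Rightarrow> (real set \<Rightarrow> real) \<Rightarrow>
     (real \<Rightarrow> 'k::{real_normed_field, banach, second_countable_topology}) \<Rightarrow> (real \<Rightarrow> 'k) \<Rightarrow> bool" where
  "is_deriv_A \<rho> a \<mu> u h \<longleftrightarrow> (\<exists>g. is_A a \<mu> u g \<and> has_lm_deriv \<rho> g h)"

text \<open>The graph of the operator, on the level of representatives; note \<open>\<bar>\<rho>\<bar> = \<rho>\<close> for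
  \<open>\<rho> \<ge> 0\<close>.  The function \<open>u\<close> is the continuous representative of \<open>f \<in> L\<^sub>p\<close>.\<close>

definition H_graph ::
    "real \<Rightarrow> (real set \<Rightarrow> real) \<Rightarrow> (real \<Rightarrow> real) \<Rightarrow> (real set \<Rightarrow> real) \<Rightarrow>
     ((real \<Rightarrow> 'k::{real_normed_field, banach, second_countable_topology}) \<times> (real \<Rightarrow> 'k)) set" where
  "H_graph p \<rho> a \<mu> =
     {(f, h). f \<in> Lp_fun p (variation_measure \<rho>) \<and> h \<in> Lp_fun p (variation_measure \<rho>) \<and>
        (\<exists>u. (AE t in variation_measure \<rho>. f t = u t) \<and> is_deriv_A \<rho> a \<mu> u h)}"

definition eigenvalue ::
    "real measure \<Rightarrow> ((real \<Rightarrow> 'k::{real_normed_field, banach, second_countable_topology}) \<times> (real \<Rightarrow> 'k)) set \<Rightarrow> 'k \<Rightarrow> bool" where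
  "eigenvalue M T z \<longleftrightarrow>
     (\<exists>(f, h)\<in>T. \<not> (AE t in M. f t = 0) \<and> (AE t in M. h t = z * f t))"


section \<open>The weak Gordon condition\<close>

text \<open>
  The type argument is the range of the functions \<open>u\<close> in the supremum.
  Boundedness of the support is explicit because the library's
  \<open>diameter\<close> is only meaningful for bounded sets.
\<close>

definition local_norm ::
    "'k::{real_normed_field, banach, second_countable_topology} itself \<Rightarrow> real set \<Rightarrow> (real set \<Rightarrow> real) \<Rightarrow> ennreal" where
  "local_norm TYPE('k) I \<mu> =
     (SUP u \<in> {u :: real \<Rightarrow> 'k. spt_fun u \<subseteq> I \<and> bounded (spt_fun u) \<and> diameter (spt_fun u) \<le> 2 \<and>
                 (\<exists>v. W11loc u v \<and> (AE x in lebesgue. norm (v x) \<le> 1))}.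
        ennreal (norm (integral_lm \<mu> UNIV u)))"

definition weak_gordon ::
    "'k::{real_normed_field, banach, second_countable_topology} itself \<Rightarrow>
     real \<Rightarrow> (real \<Rightarrow> real) \<Rightarrow> (real set \<Rightarrow> real) \<Rightarrow> (nat \<Rightarrow> real) \<Rightarrow> bool" where
  "weak_gordon TYPE('k) C a \<mu> P \<longleftrightarrow>
     (\<forall>m. 0 < P m) \<and> filterlim P at_top sequentially \<and>
     (\<lambda>m. ennreal (exp (C * P m)) *
        ((\<integral>\<^sup>+x\<in>{- P m<..<P m}. ennreal \<bar>a x - a (x + P m)\<bar> \<partial>lebesgue) +
         local_norm TYPE('k) {- P m..P m} (\<lambda>B. \<mu> B - shift_measure (P m) \<mu> B)))
       \<longlonglongrightarrow> 0"

end

theory Submission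
  imports Defs "HOL-Real_Asymp.Real_Asymp"
begin

text \<open>
  Let \<open>u\<close> be an eigenfunction for \<open>z\<close>.  With \<open>b = 1 / a\<close> and \<open>\<nu> = \<mu> - z \<rho>\<close> it has a quasi-derivative
  \<open>y\<close> (a representative of \<open>a u'\<close>) such that \<open>u' = b y\<close> and \<open>dy = u d\<nu>\<close>.  If \<open>a\<close> and \<open>\<nu>\<close> had
  period \<open>p\<close>, translation by \<open>p\<close> would act on the two-dimensional space of solutions with
  determinant \<open>1\<close>, and the Cayley--Hamilton theorem would give Gordon's relation
  \<open>u (t + p) + u (t - p) = D u t\<close> with \<open>D\<close> the trace of the monodromy.  If \<open>\<bar>D\<bar> \<ge> 1\<close>, it bounds
  \<open>u t\<close> by \<open>u (t + p)\<close> and \<open>u (t - p)\<close>; if \<open>\<bar>D\<bar> \<le> 1\<close>, it bounds \<open>u (t - p)\<close> by \<open>u t\<close> and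
  \<open>u (t + p)\<close>.  Since \<open>u\<close> decays at infinity, using arbitrarily large \<open>p\<close> forces \<open>u\<close> to vanish on
  an interval, and then everywhere.

  Here the coefficients are only almost periodic, and the proof consists in showing that Gordon's
  relation holds up to an error that tends to \<open>0\<close> (lemma \<open>gordon_relation\<close>).  Four facts carry it.

  \<^item> Decay (\<open>quasi_sol_decay\<close>): both \<open>u\<close> and \<open>y\<close> tend to \<open>0\<close> at infinity.  Far out, \<open>u\<close> is small in
    \<open>L\<^sub>p(\<rho>)\<close>, hence, being Lipschitz relative to its own size, small on the support of \<open>\<rho>\<close>, which
    contains that of \<open>\<mu>\<close>.  So \<open>y\<close> is almost constant on a window, and since \<open>u\<close> is small at two
    points of the support a period apart, that constant is small.  In particular \<open>u\<close> and \<open>y\<close> are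
    bounded, so that in the variation of constants formula for the translates of \<open>u\<close> the small
    perturbation is multiplied by only one propagator over a distance at most about \<open>p\<close>.

  \<^item> Growth (\<open>solution_growth\<close>): solutions grow at most like \<open>exp (\<omega> t)\<close> with
    \<open>\<omega>\<^sup>2 = \<parallel>b\<parallel> (\<parallel>\<mu>\<parallel> + \<bar>z\<bar> \<parallel>\<rho>\<parallel>)\<close> whatever the shape of \<open>\<nu>\<close>; the hypothesis on \<open>z\<close> says precisely
    that this rate is below \<open>C\<close>.  The sharp rate comes from the Riccati equation
    \<open>r' = \<parallel>b\<parallel> \<nu> - r\<^sup>2\<close> of the logarithmic derivative \<open>r\<close> and the inequality
    \<open>2 \<omega> r \<le> r\<^sup>2 + \<omega>\<^sup>2\<close>.

  \<^item> Regularisation (\<open>quasi_sol\<close>, \<open>wronskian\<close>): with \<open>\<Phi>\<close> the distribution function of \<open>\<nu>\<close>, integration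
    by parts shows that \<open>y - \<Phi> u\<close> is locally Lipschitz and that \<open>(u, y - \<Phi> u)\<close> solves a linear
    system with locally bounded coefficients.  In this form the measure enters only through \<open>\<Phi>\<close>,
    and adding a constant to \<open>\<Phi>\<close> does not change the equation.

  \<^item> The dual norm (\<open>local_norm_oscillation\<close>): the norm in the Gordon condition controls the
    distribution function of \<open>\<mu> - \<mu>(\<cdot> + p)\<close> in \<open>L\<^sub>1(-p, p)\<close> up to an additive constant and a
    polynomial factor in \<open>p\<close>.  The constant is harmless by the previous remark; it is normalised
    at a point \<open>s\<close> of \<open>[0, 1]\<close>, and the monodromy is formed from \<open>s\<close> to \<open>s + p\<close>.  The polynomial
    factor is absorbed by \<open>exp ((C - \<omega>) p)\<close>.
\<close>

section \<open>Jordan decomposition of a local measure\<close>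

lemma bounded_borel_Un [simp]: "A \<in> bounded_borel \<Longrightarrow> B \<in> bounded_borel \<Longrightarrow> A \<union> B \<in> bounded_borel"
  by (auto simp: bounded_borel_def)

lemma bounded_borel_Diff [simp]: "A \<in> bounded_borel \<Longrightarrow> B \<in> bounded_borel \<Longrightarrow> A - B \<in> bounded_borel"
  by (auto simp: bounded_borel_def intro: bounded_subset)

lemma bounded_borel_Int [simp]: "A \<in> bounded_borel \<Longrightarrow> B \<in> sets borel \<Longrightarrow> A \<inter> B \<in> bounded_borel"
  by (auto simp: bounded_borel_def intro: bounded_subset)

lemma bounded_borel_empty [simp]: "{} \<in> bounded_borel"
  by (auto simp: bounded_borel_def)

lemma bounded_borel_greaterThanAtMost [simp]: "{s<..t} \<in> bounded_borel"
  by (auto simp: bounded_borel_def)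

lemma local_measure_empty: "local_measure \<mu> \<Longrightarrow> \<mu> {} = 0"
  unfolding local_measure_def by (metis Int_empty_left compact_empty)

lemma local_measure_sums:
  assumes "local_measure \<mu>" "\<And>n. A n \<in> sets borel" "disjoint_family A" "bounded (\<Union>n::nat. A n)"
  shows "(\<lambda>n. \<mu> (A n)) sums \<mu> (\<Union>n. A n)"
proof -
  define K where "K = closure (\<Union>n. A n)"
  have K: "compact K" "(\<Union>n. A n) \<subseteq> K"
    using assms(4) closure_subset[of "\<Union>n. A n"] unfolding K_def by (simp_all add: compact_closure)
  have "A n \<inter> K = A n" for n using K by blast
  moreover have "(\<Union>n. A n) \<inter> K = (\<Union>n. A n)" using K by blast
  moreover have "(\<lambda>n. \<mu> (A n \<inter> K)) sums \<mu> ((\<Union>n. A n) \<inter> K)"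
    using assms K unfolding local_measure_def by blast
  ultimately show ?thesis by simp
qed

lemma local_measure_Un:
  assumes "local_measure \<mu>" "A \<in> bounded_borel" "B \<in> bounded_borel" "A \<inter> B = {}"
  shows "\<mu> (A \<union> B) = \<mu> A + \<mu> B"
proof -
  have "(\<lambda>n. \<mu> (binaryset A B n)) sums \<mu> (\<Union>n. binaryset A B n)"
    by (rule local_measure_sums[OF assms(1)])
       (use assms in \<open>auto simp: binaryset_def bounded_borel_def disjoint_family_on_def UN_binaryset_eq\<close>)
  moreover have "(\<lambda>n. \<mu> (binaryset A B n)) sums (\<Sum>n\<in>{0,1}. \<mu> (binaryset A B n))"
    by (rule sums_finite) (auto simp: binaryset_def local_measure_empty[OF assms(1)])
  ultimately show ?thesis
    by (simp add: UN_binaryset_eq sums_iff binaryset_def)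
qed

lemma local_measure_Diff:
  assumes "local_measure \<mu>" "A \<in> bounded_borel" "B \<in> bounded_borel"
  shows "\<mu> (A - B) = \<mu> A - \<mu> (A \<inter> B)"
proof -
  have "\<mu> ((A - B) \<union> (A \<inter> B)) = \<mu> (A - B) + \<mu> (A \<inter> B)"
    by (rule local_measure_Un) (use assms in \<open>auto simp: bounded_borel_def\<close>)
  then show ?thesis by (simp add: Un_Diff_Int)
qed

lemma local_measure_uminus: "local_measure \<mu> \<Longrightarrow> local_measure (\<lambda>B. - \<mu> B)"
  unfolding local_measure_def by (auto intro: sums_minus)

lemma ennreal_add_le: "ennreal (x + y) \<le> ennreal x + ennreal y"
  by (cases "x \<le> 0"; cases "y \<le> 0")
     (auto simp: ennreal_neg ennreal_leI add_increasing2 ennreal_plus[symmetric] simp del: ennreal_plus)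

lemma ennreal_sum_le: "ennreal (\<Sum>i<(n::nat). f i) \<le> (\<Sum>i<n. ennreal (f i))"
proof (induction n)
  case (Suc n)
  show ?case using order_trans[OF ennreal_add_le add_right_mono[OF Suc]] by simp
qed auto

lemma ennreal_sums_le: "f sums s \<Longrightarrow> ennreal s \<le> (\<Sum>n. ennreal (f n))"
proof (rule LIMSEQ_le_const2)
  assume "f sums s"
  then show "(\<lambda>n. ennreal (\<Sum>i<n. f i)) \<longlonglongrightarrow> ennreal s"
    by (intro tendsto_ennrealI) (simp add: sums_def)
  show "\<exists>N. \<forall>n\<ge>N. ennreal (sum f {..<n}) \<le> (\<Sum>n. ennreal (f n))"
    using order_trans[OF ennreal_sum_le sum_le_suminf[of "\<lambda>n. ennreal (f n)"]] by auto
qed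

lemma SUP_add_SUP_le_ennreal:
  fixes f :: "'a \<Rightarrow> ennreal" and g :: "'b \<Rightarrow> ennreal"
  assumes "I \<noteq> {}" "J \<noteq> {}" "\<And>i j. i \<in> I \<Longrightarrow> j \<in> J \<Longrightarrow> f i + g j \<le> c"
  shows "(SUP i\<in>I. f i) + (SUP j\<in>J. g j) \<le> c"
proof -
  have "(SUP i\<in>I. f i) + (SUP j\<in>J. g j) = (SUP i\<in>I. f i + (SUP j\<in>J. g j))"
    using assms(1) by (rule ennreal_SUP_add_left[symmetric])
  also have "\<dots> = (SUP i\<in>I. SUP j\<in>J. f i + g j)"
    using assms(2) by (simp add: ennreal_SUP_add_right)
  also have "\<dots> \<le> c" using assms(3) by (intro SUP_least)
  finally show ?thesis .
qed

text \<open>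
  The values of the positive part of the Jordan decomposition.  These suprema are countably additive
  because sets for the pieces of a disjoint union can be glued together, and a set for the union
  cut into pieces.
\<close>

definition pos_set :: "(real set \<Rightarrow> real) \<Rightarrow> real set \<Rightarrow> ennreal" where
  "pos_set \<mu> B = (SUP E \<in> {E \<in> bounded_borel. E \<subseteq> B}. ennreal (\<mu> E))"

lemma pos_set_upper: "E \<in> bounded_borel \<Longrightarrow> E \<subseteq> B \<Longrightarrow> ennreal (\<mu> E) \<le> pos_set \<mu> B"
  unfolding pos_set_def by (rule SUP_upper) auto

lemma subset_family_nonempty: "{E \<in> bounded_borel. E \<subseteq> B} \<noteq> {}"
  by (auto intro: exI[of _ "{}"])

text \<open>
  In the suprema only sets of nonnegative measure matter, since \<open>ennreal\<close> cuts off at \<open>0\<close> and the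
  empty set is always admissible.
\<close>

lemma nonneg_witness:
  assumes "local_measure \<mu>" "E \<in> bounded_borel"
  obtains E' where "E' \<in> bounded_borel" "E' \<subseteq> E" "0 \<le> \<mu> E'" "ennreal (\<mu> E) = ennreal (\<mu> E')"
proof (cases "0 \<le> \<mu> E")
  case True then show ?thesis using that assms by blast
next
  case False then show ?thesis
    using that[of "{}"] assms by (simp add: local_measure_empty ennreal_neg)
qed

lemma pos_set_superadditive:
  assumes "local_measure \<mu>" "A \<inter> B = {}"
  shows "pos_set \<mu> A + pos_set \<mu> B \<le> pos_set \<mu> (A \<union> B)"
  unfolding pos_set_def[of _ A] pos_set_def[of _ B]
proof (intro SUP_add_SUP_le_ennreal subset_family_nonempty)
  fix E F assume E: "E \<in> {E \<in> bounded_borel. E \<subseteq> A}" and F: "F \<in> {E \<in> bounded_borel. E \<subseteq> B}"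
  obtain E' where E': "E' \<in> bounded_borel" "E' \<subseteq> E" "0 \<le> \<mu> E'" "ennreal (\<mu> E) = ennreal (\<mu> E')"
    using nonneg_witness[OF assms(1)] E by blast
  obtain F' where F': "F' \<in> bounded_borel" "F' \<subseteq> F" "0 \<le> \<mu> F'" "ennreal (\<mu> F) = ennreal (\<mu> F')"
    using nonneg_witness[OF assms(1)] F by blast
  have "\<mu> (E' \<union> F') = \<mu> E' + \<mu> F'"
    using assms E F E' F' by (intro local_measure_Un) blast+
  then have "ennreal (\<mu> E) + ennreal (\<mu> F) = ennreal (\<mu> (E' \<union> F'))"
    using E' F' by (simp add: ennreal_plus)
  also have "\<dots> \<le> pos_set \<mu> (A \<union> B)" by (rule pos_set_upper) (use E F E'(1,2) F'(1,2) in \<open>simp, blast\<close>)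
  finally show "ennreal (\<mu> E) + ennreal (\<mu> F) \<le> pos_set \<mu> (A \<union> B)" .
qed

lemma pos_set_mono: "A \<subseteq> B \<Longrightarrow> pos_set \<mu> A \<le> pos_set \<mu> B"
  unfolding pos_set_def by (rule SUP_subset_mono) auto

lemma pos_set_empty: "local_measure \<mu> \<Longrightarrow> pos_set \<mu> {} = 0"
proof -
  assume "local_measure \<mu>"
  then have "pos_set \<mu> {} \<le> 0"
    unfolding pos_set_def by (intro SUP_least) (simp add: local_measure_empty)
  then show ?thesis by simp
qed

lemma countably_additive_pos_set:
  assumes "local_measure \<mu>"
  shows "countably_additive (sets borel) (pos_set \<mu>)"
proof (rule countably_additiveI)
  fix A :: "nat \<Rightarrow> real set"
  assume A: "range A \<subseteq> sets borel" "disjoint_family A"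
  have fin: "(\<Sum>i<n. pos_set \<mu> (A i)) \<le> pos_set \<mu> (\<Union>i<n. A i)" for n
  proof (induction n)
    case (Suc n)
    have "(\<Union>i<n. A i) \<inter> A n = {}"
    proof -
      have "A i \<inter> A n = {}" if "i < n" for i
        using disjoint_family_onD[OF A(2), of i n] that by simp
      then show ?thesis by blast
    qed
    then have "pos_set \<mu> (\<Union>i<n. A i) + pos_set \<mu> (A n) \<le> pos_set \<mu> ((\<Union>i<n. A i) \<union> A n)"
      by (rule pos_set_superadditive[OF assms])
    moreover have "(\<Union>i<n. A i) \<union> A n = (\<Union>i<Suc n. A i)" by (auto simp: lessThan_Suc)
    ultimately have "pos_set \<mu> (\<Union>i<n. A i) + pos_set \<mu> (A n) \<le> pos_set \<mu> (\<Union>i<Suc n. A i)" by simp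
    with add_right_mono[OF Suc, of "pos_set \<mu> (A n)"] show ?case
      unfolding sum.lessThan_Suc by (rule order_trans)
  qed (simp add: pos_set_empty assms)
  show "(\<Sum>n. pos_set \<mu> (A n)) = pos_set \<mu> (\<Union>n. A n)"
  proof (rule antisym)
    show "(\<Sum>n. pos_set \<mu> (A n)) \<le> pos_set \<mu> (\<Union>n. A n)"
    proof (rule suminf_le_const)
      show "sum (\<lambda>n. pos_set \<mu> (A n)) {..<n} \<le> pos_set \<mu> (\<Union>n. A n)" for n
        by (rule order_trans[OF fin]) (rule pos_set_mono, blast)
    qed simp
    show "pos_set \<mu> (\<Union>n. A n) \<le> (\<Sum>n. pos_set \<mu> (A n))"
      unfolding pos_set_def[of _ "\<Union>n. A n"]
    proof (rule SUP_least)
      fix E assume E: "E \<in> {E \<in> bounded_borel. E \<subseteq> (\<Union>n. A n)}"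
      have "(\<lambda>n. \<mu> (E \<inter> A n)) sums \<mu> (\<Union>n. E \<inter> A n)"
        by (rule local_measure_sums[OF assms])
           (use A E in \<open>auto simp: bounded_borel_def disjoint_family_on_def intro: bounded_subset\<close>)
      moreover have "(\<Union>n. E \<inter> A n) = E" using E by auto
      ultimately have "ennreal (\<mu> E) \<le> (\<Sum>n. ennreal (\<mu> (E \<inter> A n)))"
        using ennreal_sums_le by fastforce
      also have "\<dots> \<le> (\<Sum>n. pos_set \<mu> (A n))"
        by (intro suminf_le pos_set_upper) (use A E in auto)
      finally show "ennreal (\<mu> E) \<le> (\<Sum>n. pos_set \<mu> (A n))" .
    qed
  qed
qed

lemma sets_pos_part [simp, measurable_cong]: "sets (pos_part_measure \<mu>) = sets borel"
  using sets.sigma_sets_eq[of "borel :: real measure"] unfolding pos_part_measure_def by simp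

lemma space_pos_part [simp]: "space (pos_part_measure \<mu>) = UNIV"
  unfolding pos_part_measure_def by simp

lemma sets_neg_part [simp, measurable_cong]: "sets (neg_part_measure \<mu>) = sets borel"
  unfolding neg_part_measure_def by simp

lemma space_neg_part [simp]: "space (neg_part_measure \<mu>) = UNIV"
  unfolding neg_part_measure_def by simp

lemma emeasure_pos_part:
  assumes "local_measure \<mu>" "B \<in> sets borel"
  shows "emeasure (pos_part_measure \<mu>) B = pos_set \<mu> B"
  unfolding pos_part_measure_def pos_set_def[symmetric]
proof (rule emeasure_measure_of_sigma)
  show "sigma_algebra UNIV (sets (borel :: real measure))"
    using sets.sigma_algebra_axioms[of "borel :: real measure"] by simp
  show "positive (sets borel) (pos_set \<mu>)"
    using assms by (simp add: positive_def pos_set_empty)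
  show "countably_additive (sets borel) (pos_set \<mu>)" by (rule countably_additive_pos_set[OF assms(1)])
  show "B \<in> sets borel" by fact
qed

lemma emeasure_neg_part:
  assumes "local_measure \<mu>" "B \<in> sets borel"
  shows "emeasure (neg_part_measure \<mu>) B = pos_set (\<lambda>B. - \<mu> B) B"
  unfolding neg_part_measure_def by (rule emeasure_pos_part[OF local_measure_uminus[OF assms(1)] assms(2)])

lemma abs_le_pos_add_neg:
  assumes "E \<in> bounded_borel"
  shows "ennreal \<bar>\<mu> E\<bar> \<le> pos_set \<mu> E + pos_set (\<lambda>B. - \<mu> B) E"
proof -
  have "ennreal \<bar>\<mu> E\<bar> \<le> ennreal (\<mu> E) + ennreal (- \<mu> E)" by (auto simp: abs_if ennreal_neg)
  also have "\<dots> \<le> pos_set \<mu> E + pos_set (\<lambda>B. - \<mu> B) E"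
    by (intro add_mono pos_set_upper[of E E \<mu>] pos_set_upper[of E E "\<lambda>B. - \<mu> B"]) (use assms in auto)
  finally show ?thesis .
qed

lemma variation_upper2:
  assumes "local_measure \<mu>" "E \<in> bounded_borel" "F \<in> bounded_borel" "E \<inter> F = {}" "E \<subseteq> B" "F \<subseteq> B"
  shows "ennreal \<bar>\<mu> E\<bar> + ennreal \<bar>\<mu> F\<bar> \<le> variation \<mu> B"
proof -
  have *: "(\<Sum>E\<in>{E,F}. ennreal \<bar>\<mu> E\<bar>) \<le> variation \<mu> B"
    unfolding variation_def by (rule SUP_upper) (use assms in \<open>auto simp: disjoint_def\<close>)
  show ?thesis
  proof (cases "E = F")
    case True
    then show ?thesis using assms by (simp add: local_measure_empty)
  next
    case False
    then show ?thesis using * by simp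
  qed
qed

text \<open>
  For \<open>\<ge>\<close>, near-optimal sets \<open>E\<close> for the positive and \<open>F\<close> for the negative part may overlap, but
  \<open>\<mu> E - \<mu> F = \<mu> (E - F) - \<mu> (F - E)\<close>, and the two differences are disjoint.
\<close>

lemma variation_eq_pos_add_neg:
  assumes "local_measure \<mu>" "B \<in> sets borel"
  shows "variation \<mu> B = pos_set \<mu> B + pos_set (\<lambda>B. - \<mu> B) B"
proof (rule antisym)
  let ?p = "pos_part_measure \<mu>" and ?n = "neg_part_measure \<mu>"
  show "variation \<mu> B \<le> pos_set \<mu> B + pos_set (\<lambda>B. - \<mu> B) B"
    unfolding variation_def
  proof (rule SUP_least)
    fix P assume P: "P \<in> {P. finite P \<and> disjoint P \<and> P \<subseteq> {E \<in> bounded_borel. E \<subseteq> B}}"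
    have b: "E \<in> sets borel" if "E \<in> P" for E using P that by (auto simp: bounded_borel_def)
    have dj: "disjoint_family_on (\<lambda>x. x) P" using P by (auto simp: disjoint_family_on_def disjoint_def)
    have U: "\<Union>P \<subseteq> B" "\<Union>P \<in> sets borel" using P b by (auto intro!: sets.finite_Union)
    have "(\<Sum>E\<in>P. ennreal \<bar>\<mu> E\<bar>) \<le> (\<Sum>E\<in>P. pos_set \<mu> E + pos_set (\<lambda>B. - \<mu> B) E)"
      by (intro sum_mono abs_le_pos_add_neg) (use P in auto)
    also have "\<dots> = (\<Sum>E\<in>P. emeasure ?p E) + (\<Sum>E\<in>P. emeasure ?n E)"
      using b by (simp add: sum.distrib emeasure_pos_part emeasure_neg_part assms)
    also have "\<dots> = emeasure ?p (\<Union>P) + emeasure ?n (\<Union>P)"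
    proof -
      have "P \<subseteq> sets borel" "finite P" using P b by auto
      then show ?thesis
        using dj sum_emeasure[of "\<lambda>x. x" P ?p] sum_emeasure[of "\<lambda>x. x" P ?n] by simp
    qed
    also have "\<dots> \<le> emeasure ?p B + emeasure ?n B"
      by (intro add_mono emeasure_mono) (use U assms in auto)
    finally show "(\<Sum>E\<in>P. ennreal \<bar>\<mu> E\<bar>) \<le> pos_set \<mu> B + pos_set (\<lambda>B. - \<mu> B) B"
      by (simp add: emeasure_pos_part emeasure_neg_part assms)
  qed
  show "pos_set \<mu> B + pos_set (\<lambda>B. - \<mu> B) B \<le> variation \<mu> B"
    unfolding pos_set_def
  proof (intro SUP_add_SUP_le_ennreal subset_family_nonempty)
    fix E F assume E: "E \<in> {E \<in> bounded_borel. E \<subseteq> B}" and F: "F \<in> {E \<in> bounded_borel. E \<subseteq> B}"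
    obtain E' where E': "E' \<in> bounded_borel" "E' \<subseteq> E" "0 \<le> \<mu> E'" "ennreal (\<mu> E) = ennreal (\<mu> E')"
      using nonneg_witness[OF assms(1)] E by blast
    obtain F' where F': "F' \<in> bounded_borel" "F' \<subseteq> F" "0 \<le> - \<mu> F'" "ennreal (- \<mu> F) = ennreal (- \<mu> F')"
      using nonneg_witness[OF local_measure_uminus[OF assms(1)]] F by blast
    have "\<mu> (E' - F') = \<mu> E' - \<mu> (E' \<inter> F')" "\<mu> (F' - E') = \<mu> F' - \<mu> (F' \<inter> E')"
      using E' F' by (auto intro!: local_measure_Diff[OF assms(1)])
    then have "\<mu> E' - \<mu> F' \<le> \<bar>\<mu> (E' - F')\<bar> + \<bar>\<mu> (F' - E')\<bar>"
      by (simp add: Int_commute)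
    then have "ennreal (\<mu> E) + ennreal (- \<mu> F) \<le> ennreal \<bar>\<mu> (E' - F')\<bar> + ennreal \<bar>\<mu> (F' - E')\<bar>"
      using E' F' by (simp add: ennreal_plus[symmetric] del: ennreal_plus)
    also have "\<dots> \<le> variation \<mu> B"
      by (rule variation_upper2[OF assms(1)]) (use E F E'(1,2) F'(1,2) in \<open>simp_all, blast+\<close>)
    finally show "ennreal (\<mu> E) + ennreal (- \<mu> F) \<le> variation \<mu> B" .
  qed
qed

lemma sets_variation_measure [simp, measurable_cong]: "sets (variation_measure \<mu>) = sets borel"
  using sets.sigma_sets_eq[of "borel :: real measure"] unfolding variation_measure_def by simp

lemma space_variation_measure [simp]: "space (variation_measure \<mu>) = UNIV"
  unfolding variation_measure_def by simp

lemma emeasure_variation_measure: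
  assumes "local_measure \<mu>" "B \<in> sets borel"
  shows "emeasure (variation_measure \<mu>) B = variation \<mu> B"
  unfolding variation_measure_def
proof (rule emeasure_measure_of_sigma)
  show "sigma_algebra UNIV (sets (borel :: real measure))"
    using sets.sigma_algebra_axioms[of "borel :: real measure"] by simp
  show "positive (sets borel) (variation \<mu>)"
    using assms by (simp add: positive_def pos_set_empty local_measure_uminus variation_eq_pos_add_neg)
  show "countably_additive (sets borel) (variation \<mu>)"
  proof (rule countably_additiveI)
    fix A :: "nat \<Rightarrow> real set" assume A: "range A \<subseteq> sets borel" "disjoint_family A" "\<Union> (range A) \<in> sets borel"
    have 1: "(\<Sum>n. pos_set \<mu> (A n)) = pos_set \<mu> (\<Union>n. A n)"
      using countably_additive_pos_set[OF assms(1)] A unfolding countably_additive_def by blast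
    have 2: "(\<Sum>n. pos_set (\<lambda>B. - \<mu> B) (A n)) = pos_set (\<lambda>B. - \<mu> B) (\<Union>n. A n)"
      using countably_additive_pos_set[OF local_measure_uminus[OF assms(1)]] A
      unfolding countably_additive_def by blast
    have 3: "variation \<mu> (A n) = pos_set \<mu> (A n) + pos_set (\<lambda>B. - \<mu> B) (A n)" for n
      by (rule variation_eq_pos_add_neg[OF assms(1)]) (use A(1) in blast)
    have "(\<Sum>n. variation \<mu> (A n)) = (\<Sum>n. pos_set \<mu> (A n)) + (\<Sum>n. pos_set (\<lambda>B. - \<mu> B) (A n))"
      unfolding 3 by (rule suminf_add[symmetric]) simp_all
    also have "\<dots> = variation \<mu> (\<Union>n. A n)"
      unfolding 1 2 by (rule variation_eq_pos_add_neg[OF assms(1) A(3), symmetric])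
    finally show "(\<Sum>n. variation \<mu> (A n)) = variation \<mu> (\<Union>n. A n)" .
  qed
  show "B \<in> sets borel" by fact
qed

definition loc_finite :: "(real set \<Rightarrow> real) \<Rightarrow> bool" where
  "loc_finite \<mu> \<longleftrightarrow> local_measure \<mu> \<and> (\<forall>s t. variation \<mu> {s<..t} < \<infinity>)"

lemma loc_finiteD: "loc_finite \<mu> \<Longrightarrow> local_measure \<mu>" "loc_finite \<mu> \<Longrightarrow> variation \<mu> {s<..t} < \<infinity>"
  unfolding loc_finite_def by auto

lemma bounded_subset_greaterThanAtMost:
  assumes "bounded (B :: real set)"
  obtains s t where "B \<subseteq> {s<..t}"
proof -
  obtain R where "\<forall>x\<in>B. \<bar>x\<bar> \<le> R" using assms by (auto simp: bounded_iff)
  then have "B \<subseteq> {-R-1<..R}" by force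
  then show ?thesis using that by blast
qed

lemma variation_mono: "A \<subseteq> B \<Longrightarrow> variation \<mu> A \<le> variation \<mu> B"
  unfolding variation_def by (rule SUP_subset_mono) auto

lemma loc_finite_finite:
  assumes "loc_finite \<mu>" "B \<in> bounded_borel"
  shows "variation \<mu> B < \<infinity>" "pos_set \<mu> B < \<infinity>" "pos_set (\<lambda>B. - \<mu> B) B < \<infinity>"
proof -
  obtain s t where "B \<subseteq> {s<..t}" using assms bounded_subset_greaterThanAtMost by (auto simp: bounded_borel_def)
  from variation_mono[OF this] show *: "variation \<mu> B < \<infinity>"
    using loc_finiteD(2)[OF assms(1)] by (meson le_less_trans)
  have "variation \<mu> B = pos_set \<mu> B + pos_set (\<lambda>B. - \<mu> B) B"
    by (rule variation_eq_pos_add_neg) (use assms in \<open>auto simp: bounded_borel_def loc_finiteD\<close>)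
  then show "pos_set \<mu> B < \<infinity>" "pos_set (\<lambda>B. - \<mu> B) B < \<infinity>" using * by auto
qed

text \<open>
  The map \<open>E \<mapsto> B - E\<close> exchanges the suprema that define the positive and the negative part of
  \<open>B\<close> and changes the value by \<open>\<mu> B\<close>.
\<close>

lemma loc_finite_eq_diff:
  assumes "loc_finite \<mu>" "B \<in> bounded_borel"
  shows "\<mu> B = measure (pos_part_measure \<mu>) B - measure (neg_part_measure \<mu>) B"
proof -
  have lm: "local_measure \<mu>" and Bb: "B \<in> sets borel" using assms by (auto simp: loc_finiteD bounded_borel_def)
  define n where "n = measure (neg_part_measure \<mu>) B"
  define p where "p = measure (pos_part_measure \<mu>) B"
  have p: "pos_set \<mu> B = ennreal p" "0 \<le> p"
    unfolding p_def measure_def using loc_finite_finite(2)[OF assms] by (auto simp: emeasure_pos_part[OF lm Bb] less_top)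
  have n: "pos_set (\<lambda>B. - \<mu> B) B = ennreal n" "0 \<le> n"
    unfolding n_def measure_def using loc_finite_finite(3)[OF assms] by (auto simp: emeasure_neg_part[OF lm Bb] less_top)
  have upp: "\<mu> E \<le> p" if "E \<in> bounded_borel" "E \<subseteq> B" for E
    using pos_set_upper[of E B \<mu>] that p by simp
  have upn: "- \<mu> E \<le> n" if "E \<in> bounded_borel" "E \<subseteq> B" for E
    using pos_set_upper[of E B "\<lambda>B. - \<mu> B"] that n by simp
  have d: "\<mu> (B - E) = \<mu> B - \<mu> E" if "E \<in> bounded_borel" "E \<subseteq> B" for E
    using local_measure_Diff[OF lm assms(2) that(1)] that by (simp add: Int_absorb1)
  have b: "B - E \<in> bounded_borel" if "E \<in> bounded_borel" for E using assms that by simp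
  have "pos_set \<mu> B \<le> ennreal (\<mu> B + n)"
    unfolding pos_set_def
  proof (rule SUP_least)
    fix E assume E: "E \<in> {E \<in> bounded_borel. E \<subseteq> B}"
    then show "ennreal (\<mu> E) \<le> ennreal (\<mu> B + n)"
      using upn[of "B - E"] d[of E] b[of E] by (intro ennreal_leI) auto
  qed
  moreover have "0 \<le> \<mu> B + n" using upn[of B] assms by simp
  ultimately have 1: "p \<le> \<mu> B + n" using p by simp
  have "pos_set (\<lambda>B. - \<mu> B) B \<le> ennreal (p - \<mu> B)"
    unfolding pos_set_def
  proof (rule SUP_least)
    fix E assume E: "E \<in> {E \<in> bounded_borel. E \<subseteq> B}"
    then show "ennreal (- \<mu> E) \<le> ennreal (p - \<mu> B)"
      using upp[of "B - E"] d[of E] b[of E] by (intro ennreal_leI) auto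
  qed
  moreover have "0 \<le> p - \<mu> B" using upp[of B] assms by simp
  ultimately have 2: "n \<le> p - \<mu> B" using n by simp
  from 1 2 show ?thesis unfolding p_def n_def by simp
qed

lemma M_loc_unif_loc_finite:
  assumes "\<mu> \<in> M_loc_unif" shows "loc_finite \<mu>"
proof -
  have lm: "local_measure \<mu>" and u: "unif_norm \<mu> < \<infinity>" using assms by (auto simp: M_loc_unif_def)
  have 1: "variation \<mu> {t<..t+1} < \<infinity>" for t
  proof -
    have "variation \<mu> {t<..t+1} \<le> unif_norm \<mu>" unfolding unif_norm_def by (rule SUP_upper) simp
    then show ?thesis using u by simp
  qed
  have "variation \<mu> {s<..s + real n} < \<infinity>" for s n
  proof (induction n)
    case 0
    show ?case using variation_mono[of "{s<..s + real 0}" "{s<..s+1}" \<mu>] 1[of s] by simp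
  next
    case (Suc n)
    have e: "{s<..s + real (Suc n)} = {s<..s + real n} \<union> {s + real n<..s + real n + 1}" by auto
    have "emeasure (variation_measure \<mu>) {s<..s + real (Suc n)} \<le> 
       emeasure (variation_measure \<mu>) {s<..s + real n} + emeasure (variation_measure \<mu>) {s + real n<..s + real n + 1}"
      unfolding e by (rule emeasure_subadditive) auto
    then show ?case using Suc 1[of "s + real n"]
      by (simp add: emeasure_variation_measure[OF lm] le_less_trans ennreal_add_less_top)
  qed
  moreover have "{s<..t} \<subseteq> {s<..s + real (nat \<lceil>t - s\<rceil>)}" for s t
  proof
    fix x assume "x \<in> {s<..t}"
    then show "x \<in> {s<..s + real (nat \<lceil>t - s\<rceil>)}"
      using real_nat_ceiling_ge[of "t - s"] unfolding greaterThanAtMost_iff by linarith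
  qed
  ultimately have "variation \<mu> {s<..t} < \<infinity>" for s t
    using le_less_trans[OF variation_mono] by blast
  then show ?thesis using lm by (simp add: loc_finite_def)
qed

section \<open>Indefinite integrals of locally bounded functions\<close>

text \<open>
  The common setting for Lebesgue measure on the completed sigma-algebra and for the parts of a
  local measure on the Borel sets.  Integrals run over half-open intervals, which fit together
  without overlap even if the measure has atoms.
\<close>

definition locfin :: "real measure \<Rightarrow> bool" where
  "locfin M \<longleftrightarrow> sets borel \<subseteq> sets M \<and> space M = UNIV \<and> (\<forall>s t. emeasure M {s<..t} < \<infinity>)"

text \<open>
  Measurable and locally bounded functions are closed under products and integrable over bounded
  intervals for every measure of the kind above.
\<close>

definition loc_bdd :: "real measure \<Rightarrow> (real \<Rightarrow> 'b::real_normed_vector) \<Rightarrow> bool" where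
  "loc_bdd M f \<longleftrightarrow> f \<in> borel_measurable M \<and> (\<forall>s t. \<exists>B. \<forall>x\<in>{s..t}. norm (f x) \<le> B)"

abbreviation intI :: "real measure \<Rightarrow> real \<Rightarrow> real \<Rightarrow> (real \<Rightarrow> 'b::{banach, second_countable_topology}) \<Rightarrow> 'b" where
  "intI M s t f \<equiv> set_lebesgue_integral M {s<..t} f"

lemma locfin_sets: "locfin M \<Longrightarrow> A \<in> sets borel \<Longrightarrow> A \<in> sets M"
  unfolding locfin_def by blast

lemma locfin_Ioc: "locfin M \<Longrightarrow> {s<..t} \<in> sets M"
  by (rule locfin_sets) auto

lemma locfin_emeasure: "locfin M \<Longrightarrow> emeasure M {s<..t} < \<infinity>"
  unfolding locfin_def by blast

lemma locfin_measurable: "locfin M \<Longrightarrow> f \<in> borel_measurable borel \<Longrightarrow> f \<in> borel_measurable M"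
  unfolding locfin_def by (auto simp: measurable_def)

lemma locfin_lebesgue [simp]: "locfin lebesgue"
proof -
  have "emeasure lebesgue {s<..t::real} < \<infinity>" for s t
    by (cases "s \<le> t") (simp_all add: emeasure_lborel_Ioc)
  then show ?thesis unfolding locfin_def by auto
qed

lemma measure_lebesgue_Ioc: "s \<le> t \<Longrightarrow> measure lebesgue {s<..t::real} = t - s"
  by (simp add: measure_def)

lemma loc_bddD: "loc_bdd M f \<Longrightarrow> f \<in> borel_measurable M"
  unfolding loc_bdd_def by blast

lemma loc_bdd_bound:
  assumes "loc_bdd M f" obtains B where "0 \<le> B" "\<And>x. s \<le> x \<Longrightarrow> x \<le> t \<Longrightarrow> norm (f x) \<le> B"
proof -
  obtain B where B: "\<forall>x\<in>{s..t}. norm (f x) \<le> B" using assms unfolding loc_bdd_def by blast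
  show ?thesis by (rule that[of "max 0 B"]) (use B in \<open>force+\<close>)
qed

lemma loc_bdd_set_integrable:
  fixes f :: "real \<Rightarrow> 'b::{banach, second_countable_topology}"
  assumes "locfin M" "loc_bdd M f" shows "set_integrable M {s<..t} f"
proof -
  obtain B where B: "\<And>x. s \<le> x \<Longrightarrow> x \<le> t \<Longrightarrow> norm (f x) \<le> B" using loc_bdd_bound[OF assms(2)] by metis
  show ?thesis unfolding set_integrable_def
    by (rule integrableI_bounded_set_indicator[where B = B])
       (use assms B in \<open>auto simp: locfin_Ioc loc_bddD locfin_emeasure[unfolded infinity_ennreal_def]\<close>)
qed

lemma loc_bdd_const [simp]: "loc_bdd M (\<lambda>x. c)"
  unfolding loc_bdd_def by auto

lemma loc_bdd_add: 
  fixes f g :: "real \<Rightarrow> 'b::{banach, second_countable_topology}"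
  assumes "loc_bdd M f" "loc_bdd M g" shows "loc_bdd M (\<lambda>x. f x + g x)"
  unfolding loc_bdd_def
proof (intro conjI allI)
  show "(\<lambda>x. f x + g x) \<in> borel_measurable M" by (intro borel_measurable_add loc_bddD assms)
  fix s t
  obtain B where "\<And>x. s \<le> x \<Longrightarrow> x \<le> t \<Longrightarrow> norm (f x) \<le> B" using loc_bdd_bound[OF assms(1)] by metis
  moreover obtain C where "\<And>x. s \<le> x \<Longrightarrow> x \<le> t \<Longrightarrow> norm (g x) \<le> C" using loc_bdd_bound[OF assms(2)] by metis
  ultimately show "\<exists>B. \<forall>x\<in>{s..t}. norm (f x + g x) \<le> B"
    by (intro exI[of _ "B + C"]) (auto intro!: norm_triangle_le add_mono)
qed

lemma loc_bdd_scaleR: 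
  fixes g :: "real \<Rightarrow> 'b::{banach, second_countable_topology}"
  assumes "loc_bdd M f" "loc_bdd M g" shows "loc_bdd M (\<lambda>x. f x *\<^sub>R g x)"
  unfolding loc_bdd_def
proof (intro conjI allI)
  show "(\<lambda>x. f x *\<^sub>R g x) \<in> borel_measurable M" by (intro borel_measurable_scaleR loc_bddD assms)
  fix s t
  obtain B where "0 \<le> B" "\<And>x. s \<le> x \<Longrightarrow> x \<le> t \<Longrightarrow> norm (f x) \<le> B" using loc_bdd_bound[OF assms(1)] by metis
  moreover obtain C where "\<And>x. s \<le> x \<Longrightarrow> x \<le> t \<Longrightarrow> norm (g x) \<le> C" using loc_bdd_bound[OF assms(2)] by metis
  ultimately show "\<exists>B. \<forall>x\<in>{s..t}. norm (f x *\<^sub>R g x) \<le> B"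
    by (intro exI[of _ "B * C"]) (auto intro!: mult_mono)
qed

lemma loc_bdd_mult: 
  fixes f g :: "real \<Rightarrow> 'b::{real_normed_field, banach, second_countable_topology}"
  assumes "loc_bdd M f" "loc_bdd M g" shows "loc_bdd M (\<lambda>x. f x * g x)"
  unfolding loc_bdd_def
proof (intro conjI allI)
  show "(\<lambda>x. f x * g x) \<in> borel_measurable M" by (intro borel_measurable_times loc_bddD assms)
  fix s t
  obtain B where "0 \<le> B" "\<And>x. s \<le> x \<Longrightarrow> x \<le> t \<Longrightarrow> norm (f x) \<le> B" using loc_bdd_bound[OF assms(1)] by metis
  moreover obtain C where "\<And>x. s \<le> x \<Longrightarrow> x \<le> t \<Longrightarrow> norm (g x) \<le> C" using loc_bdd_bound[OF assms(2)] by metis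
  ultimately show "\<exists>B. \<forall>x\<in>{s..t}. norm (f x * g x) \<le> B"
    by (intro exI[of _ "B * C"]) (auto simp: norm_mult intro!: mult_mono)
qed

lemma loc_bdd_uminus:
  fixes f :: "real \<Rightarrow> 'b::{banach, second_countable_topology}"
  shows "loc_bdd M f \<Longrightarrow> loc_bdd M (\<lambda>x. - f x)"
  using loc_bdd_scaleR[OF loc_bdd_const[of M "-1"], of f] by simp

lemma loc_bdd_diff: 
  fixes f g :: "real \<Rightarrow> 'b::{banach, second_countable_topology}"
  shows "loc_bdd M f \<Longrightarrow> loc_bdd M g \<Longrightarrow> loc_bdd M (\<lambda>x. f x - g x)"
  using loc_bdd_add[of M f "\<lambda>x. - g x"] loc_bdd_uminus[of M g] by simp

lemma loc_bdd_of_real: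
  shows "loc_bdd M f \<Longrightarrow> loc_bdd M (\<lambda>x. of_real (f x) :: 'b::{real_normed_field, banach, second_countable_topology})"
  using loc_bdd_scaleR[OF _ loc_bdd_const[of M "1::'b"], of f] by (simp add: of_real_def)

lemma loc_bdd_norm:
  fixes f :: "real \<Rightarrow> 'b::{banach, second_countable_topology}"
  assumes "loc_bdd M f" shows "loc_bdd M (\<lambda>x. norm (f x))"
  using assms unfolding loc_bdd_def by auto

lemma loc_bdd_continuous:
  fixes f :: "real \<Rightarrow> 'b::{banach, second_countable_topology}"
  assumes "locfin M" "continuous_on UNIV f" shows "loc_bdd M f"
  unfolding loc_bdd_def
proof (intro conjI allI)
  show "f \<in> borel_measurable M"
    by (rule locfin_measurable[OF assms(1) borel_measurable_continuous_onI[OF assms(2)]])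
  fix s t
  have "compact (f ` {s..t})"
    by (intro compact_continuous_image continuous_on_subset[OF assms(2)]) auto
  then show "\<exists>B. \<forall>x\<in>{s..t}. norm (f x) \<le> B"
    by (auto dest!: compact_imp_bounded simp: bounded_iff)
qed

lemmas loc_bdd_intros = loc_bdd_add loc_bdd_diff loc_bdd_scaleR loc_bdd_mult loc_bdd_uminus loc_bdd_of_real loc_bdd_norm loc_bdd_const

lemma set_integral_empty [simp]: "set_lebesgue_integral M {} f = 0"
  by (simp add: set_lebesgue_integral_def)

lemma intI_empty: "t \<le> s \<Longrightarrow> intI M s t f = 0"
  by (simp add: set_lebesgue_integral_def)

lemma intI_combine:
  fixes f :: "real \<Rightarrow> 'b::{banach, second_countable_topology}"
  assumes "locfin M" "loc_bdd M f" "s \<le> r" "r \<le> t"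
  shows "intI M s r f + intI M r t f = intI M s t f"
proof -
  have "{s<..t} = {s<..r} \<union> {r<..t}" using assms by auto
  then show ?thesis
    by (simp add: set_integral_Un loc_bdd_set_integrable assms)
qed

lemma intI_norm_le:
  fixes f :: "real \<Rightarrow> 'b::{banach, second_countable_topology}"
  assumes "locfin M" "loc_bdd M f" "\<And>x. s < x \<Longrightarrow> x \<le> t \<Longrightarrow> norm (f x) \<le> g x" "loc_bdd M g"
  shows "norm (intI M s t f) \<le> intI M s t g"
  unfolding set_lebesgue_integral_def
  by (rule Bochner_Integration.integral_norm_bound_integral)
     (use loc_bdd_set_integrable[OF assms(1,2)] loc_bdd_set_integrable[OF assms(1,4)] assms(3) 
       in \<open>auto simp: set_integrable_def indicator_def\<close>)

lemma intI_const:
  assumes "locfin M"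
  shows "intI M s t (\<lambda>x. c) = measure M {s<..t} *\<^sub>R c"
  using assms set_integral_const[of "{s<..t}" M c] locfin_Ioc[of M s t] locfin_emeasure[of M s t] by (simp add: less_top)

lemma intI_bound:
  fixes f :: "real \<Rightarrow> 'b::{banach, second_countable_topology}"
  assumes "locfin M" "loc_bdd M f" "\<And>x. s < x \<Longrightarrow> x \<le> t \<Longrightarrow> norm (f x) \<le> B"
  shows "norm (intI M s t f) \<le> B * measure M {s<..t}"
  using intI_norm_le[OF assms(1,2), of s t "\<lambda>x. B"] assms by (simp add: intI_const mult.commute)

lemma intI_mono:
  fixes f :: "real \<Rightarrow> real"
  assumes "locfin M" "loc_bdd M f" "loc_bdd M g" "\<And>x. s < x \<Longrightarrow> x \<le> t \<Longrightarrow> f x \<le> g x"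
  shows "intI M s t f \<le> intI M s t g"
  by (rule set_integral_mono) (use assms loc_bdd_set_integrable in auto)

lemma intI_nonneg:
  fixes f :: "real \<Rightarrow> real"
  assumes "\<And>x. s < x \<Longrightarrow> x \<le> t \<Longrightarrow> 0 \<le> f x"
  shows "0 \<le> intI M s t f"
  unfolding set_lebesgue_integral_def by (rule integral_nonneg_AE) (use assms in \<open>auto simp: indicator_def\<close>)

lemma intI_cong:
  assumes "\<And>x. s < x \<Longrightarrow> x \<le> t \<Longrightarrow> f x = g x"
  shows "intI M s t f = intI M s t g"
  unfolding set_lebesgue_integral_def 
  by (rule Bochner_Integration.integral_cong) (use assms in \<open>auto simp: indicator_def\<close>)

lemma intI_add:
  fixes f :: "real \<Rightarrow> 'b::{banach, second_countable_topology}"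
  assumes "locfin M" "loc_bdd M f" "loc_bdd M g"
  shows "intI M s t (\<lambda>x. f x + g x) = intI M s t f + intI M s t g"
  using assms loc_bdd_set_integrable by (intro set_integral_add) auto

lemma intI_diff:
  fixes f :: "real \<Rightarrow> 'b::{banach, second_countable_topology}"
  assumes "locfin M" "loc_bdd M f" "loc_bdd M g"
  shows "intI M s t (\<lambda>x. f x - g x) = intI M s t f - intI M s t g"
  using assms loc_bdd_set_integrable by (intro set_integral_diff) auto

lemma intI_uminus: 
  fixes f :: "real \<Rightarrow> 'b::{banach, second_countable_topology}"
  shows "intI M s t (\<lambda>x. - f x) = - intI M s t f"
  unfolding set_lebesgue_integral_def by simp

lemma intI_scaleR_left:
  assumes "locfin M" "loc_bdd M f"
  shows "intI M s t (\<lambda>x. f x *\<^sub>R c) = intI M s t f *\<^sub>R c"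
  using loc_bdd_set_integrable[OF assms, of s t]
  by (simp add: set_lebesgue_integral_def set_integrable_def)

text \<open>
  On the partition into \<open>n\<close> equal steps the bounds telescope to \<open>(b - a) / n * (V b - V a)\<close>, which
  tends to \<open>0\<close>.  Product rule, integration by parts and the sharp growth estimate all come from this.
\<close>

lemma increment_le:
  fixes G V :: "real \<Rightarrow> real"
  assumes "a \<le> b" and step: "\<And>s t. a \<le> s \<Longrightarrow> s \<le> t \<Longrightarrow> t \<le> b \<Longrightarrow> G t - G s \<le> (t - s) * (V t - V s)"
  shows "G b \<le> G a"
proof -
  have "G b - G a \<le> (b - a) * (V b - V a) / real (Suc n)" for n
  proof -
    define N where "N = real (Suc n)"
    have N: "N > 0" by (simp add: N_def)
    define x where "x i = a + real i * (b - a) / N" for i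
    have ends: "x 0 = a" "x (Suc n) = b" using N by (auto simp: x_def N_def)
    have d: "x (Suc i) - x i = (b - a) / N" for i
      by (simp add: x_def add_divide_distrib diff_divide_distrib algebra_simps)
    have "G (x (Suc i)) - G (x i) \<le> (b - a) / N * (V (x (Suc i)) - V (x i))" if "i < Suc n" for i
    proof -
      have i: "real (Suc i) \<le> N" using that by (simp add: N_def)
      have "real i * (b - a) / N \<ge> 0" "(b - a) / N \<ge> 0"
        using N assms(1) by simp_all
      moreover have "real (Suc i) * (b - a) / N \<le> b - a"
        using N mult_right_mono[OF i, of "b - a"] assms(1) by (simp add: pos_divide_le_eq mult.commute)
      ultimately have "a \<le> x i" "x i \<le> x (Suc i)" "x (Suc i) \<le> b" using d[of i] by (auto simp: x_def)
      from step[OF this] show ?thesis using d by simp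
    qed
    then have "(\<Sum>i<Suc n. G (x (Suc i)) - G (x i)) \<le> (\<Sum>i<Suc n. (b - a) / N * (V (x (Suc i)) - V (x i)))"
      by (intro sum_mono) auto
    also have "\<dots> = (b - a) / N * (V b - V a)"
      unfolding sum_distrib_left[symmetric] sum_lessThan_telescope[of "\<lambda>i. V (x i)"] ends ..
    finally show ?thesis unfolding sum_lessThan_telescope[of "\<lambda>i. G (x i)"] ends by (simp add: N_def)
  qed
  moreover have "(\<lambda>n. (b - a) * (V b - V a) / real (Suc n)) \<longlonglongrightarrow> 0"
    by (rule LIMSEQ_Suc[OF lim_const_over_n])
  ultimately have "G b - G a \<le> 0" by (intro LIMSEQ_le_const) auto
  then show ?thesis by simp
qed

lemma increment_le_constant:
  fixes f :: "real \<Rightarrow> 'b::real_normed_vector" and V :: "real \<Rightarrow> real"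
  assumes "a \<le> b" and step: "\<And>s t. a \<le> s \<Longrightarrow> s \<le> t \<Longrightarrow> t \<le> b \<Longrightarrow> norm (f t - f s) \<le> (t - s) * (V t - V s)"
  shows "f b = f a"
proof -
  have "norm (f b - f a) \<le> norm (f a - f a)"
  proof (rule increment_le[OF assms(1), where V = V])
    fix s t assume "a \<le> s" "s \<le> t" "t \<le> b"
    then show "norm (f t - f a) - norm (f s - f a) \<le> (t - s) * (V t - V s)"
      using step[of s t] norm_triangle_ineq2[of "f t - f a" "f s - f a"] by simp
  qed
  then show ?thesis by simp
qed

text \<open>
  \<open>f\<close> is an indefinite integral of the locally bounded function \<open>F\<close>; in particular \<open>f\<close> is locally
  Lipschitz.
\<close>

definition prim_of :: "(real \<Rightarrow> 'b::{banach, second_countable_topology}) \<Rightarrow> (real \<Rightarrow> 'b) \<Rightarrow> bool" where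
  "prim_of f F \<longleftrightarrow> loc_bdd lebesgue F \<and> (\<forall>s t. s \<le> t \<longrightarrow> f t - f s = intI lebesgue s t F)"

lemma prim_ofD: "prim_of f F \<Longrightarrow> loc_bdd lebesgue F" "prim_of f F \<Longrightarrow> s \<le> t \<Longrightarrow> f t - f s = intI lebesgue s t F"
  unfolding prim_of_def by auto

lemma prim_of_lipschitz:
  assumes "prim_of f F" "s \<le> t" "\<And>x. s < x \<Longrightarrow> x \<le> t \<Longrightarrow> norm (F x) \<le> B"
  shows "norm (f t - f s) \<le> B * (t - s)"
proof -
  have "norm (intI lebesgue s t F) \<le> B * measure lebesgue {s<..t}"
    by (rule intI_bound[OF locfin_lebesgue prim_ofD(1)[OF assms(1)] assms(3)])
  then show ?thesis by (simp only: prim_ofD(2)[OF assms(1,2)] measure_lebesgue_Ioc[OF assms(2)])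
qed

lemma prim_of_continuous:
  assumes "prim_of f F" shows "continuous_on S f"
proof -
  have "continuous (at x) f" for x
  proof -
    obtain B where B: "0 \<le> B" "\<And>y. x - 1 \<le> y \<Longrightarrow> y \<le> x + 1 \<Longrightarrow> norm (F y) \<le> B"
      using loc_bdd_bound[OF prim_ofD(1)[OF assms]] by metis
    have L: "norm (f y - f x) \<le> B * \<bar>y - x\<bar>" if "\<bar>y - x\<bar> \<le> 1" for y
      using prim_of_lipschitz[OF assms, of x y B] prim_of_lipschitz[OF assms, of y x B] B that
      by (cases "x \<le> y") (auto simp: norm_minus_commute)
    have "((\<lambda>y. B * \<bar>y - x\<bar>) \<longlongrightarrow> B * \<bar>x - x\<bar>) (at x)" by (intro tendsto_intros)
    moreover have "\<forall>\<^sub>F y in at x. norm (f y - f x) \<le> B * \<bar>y - x\<bar>"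
      unfolding eventually_at by (intro exI[of _ 1]) (auto intro!: L simp: dist_real_def)
    ultimately have "((\<lambda>y. f y - f x) \<longlongrightarrow> 0) (at x)"
      by (intro Lim_null_comparison[of "\<lambda>y. f y - f x" "\<lambda>y. B * \<bar>y - x\<bar>"]) auto
    then show ?thesis by (simp add: continuous_at LIM_zero_iff)
  qed
  then show ?thesis by (simp add: continuous_at_imp_continuous_on)
qed

lemma prim_of_loc_bdd: "prim_of f F \<Longrightarrow> locfin M \<Longrightarrow> loc_bdd M f"
  by (rule loc_bdd_continuous[OF _ prim_of_continuous])

lemma prim_of_const: "prim_of (\<lambda>x. c) (\<lambda>x. 0)"
  unfolding prim_of_def by simp

lemma prim_of_add: "prim_of f F \<Longrightarrow> prim_of g G \<Longrightarrow> prim_of (\<lambda>x. f x + g x) (\<lambda>x. F x + G x)"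
  unfolding prim_of_def by (auto intro: loc_bdd_intros simp: intI_add algebra_simps)

lemma prim_of_diff: "prim_of f F \<Longrightarrow> prim_of g G \<Longrightarrow> prim_of (\<lambda>x. f x - g x) (\<lambda>x. F x - G x)"
  unfolding prim_of_def by (auto intro: loc_bdd_intros simp: intI_diff algebra_simps)

lemma prim_of_cong: "prim_of f F \<Longrightarrow> (\<And>x. f x = g x) \<Longrightarrow> (\<And>x. F x = G x) \<Longrightarrow> prim_of g G"
  by (metis ext)

text \<open>
  The difference of the two sides of the product rule has increments of order \<open>(t - s)\<^sup>2\<close>, so it is
  constant.
\<close>

lemma prim_of_mult:
  fixes f g :: "real \<Rightarrow> 'b::{real_normed_field, banach, second_countable_topology}"
  assumes f: "prim_of f F" and g: "prim_of g G"
  shows "prim_of (\<lambda>x. f x * g x) (\<lambda>x. F x * g x + f x * G x)"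
  unfolding prim_of_def
proof (intro conjI allI impI)
  note lf = prim_of_loc_bdd[OF f locfin_lebesgue] and lg = prim_of_loc_bdd[OF g locfin_lebesgue]
    and lF = prim_ofD(1)[OF f] and lG = prim_ofD(1)[OF g]
  show l: "loc_bdd lebesgue (\<lambda>x. F x * g x + f x * G x)" by (intro loc_bdd_intros lf lg lF lG)
  fix a b :: real assume ab: "a \<le> b"
  obtain A where A: "0 \<le> A" "\<And>x. a \<le> x \<Longrightarrow> x \<le> b \<Longrightarrow> norm (F x) \<le> A" using loc_bdd_bound[OF lF] by metis
  obtain B where B: "0 \<le> B" "\<And>x. a \<le> x \<Longrightarrow> x \<le> b \<Longrightarrow> norm (G x) \<le> B" using loc_bdd_bound[OF lG] by metis
  define H where "H t = f t * g t - intI lebesgue a t (\<lambda>x. F x * g x + f x * G x)" for t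
  have "H b = H a"
  proof (rule increment_le_constant[OF ab, where V = "\<lambda>t. 2 * A * B * t"])
    fix s t assume st: "a \<le> s" "s \<le> t" "t \<le> b"
    let ?I = "intI lebesgue s t"
    have F: "f t - f s = ?I F" and G: "g t - g s = ?I G" using prim_ofD(2)[OF f] prim_ofD(2)[OF g] st by auto
    have 1: "?I (\<lambda>x. F x * (g t - g x)) = ?I F * g t - ?I (\<lambda>x. F x * g x)"
      by (simp add: algebra_simps intI_diff loc_bdd_intros lF lg)
    have 2: "?I (\<lambda>x. (f s - f x) * G x) = f s * ?I G - ?I (\<lambda>x. f x * G x)"
      by (simp add: algebra_simps intI_diff loc_bdd_intros lf lG)
    have "H t - H s = f t * g t - f s * g s - ?I (\<lambda>x. F x * g x + f x * G x)"
      using intI_combine[OF locfin_lebesgue l st(1,2)] by (simp add: H_def algebra_simps)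
    also have "\<dots> = (f t - f s) * g t + f s * (g t - g s) - (?I (\<lambda>x. F x * g x) + ?I (\<lambda>x. f x * G x))"
      by (simp add: intI_add loc_bdd_intros lF lG lf lg algebra_simps)
    also have "\<dots> = ?I (\<lambda>x. F x * (g t - g x)) + ?I (\<lambda>x. (f s - f x) * G x)"
      unfolding 1 2 F G by (simp add: algebra_simps)
    finally have "norm (H t - H s) \<le> norm (?I (\<lambda>x. F x * (g t - g x))) + norm (?I (\<lambda>x. (f s - f x) * G x))"
      by (simp add: norm_triangle_ineq)
    also have "\<dots> \<le> (A * (B * (t - s))) * measure lebesgue {s<..t} + ((A * (t - s)) * B) * measure lebesgue {s<..t}"
    proof (intro add_mono intI_bound)
      fix x assume x: "s < x" "x \<le> t"
      have "norm (g t - g x) \<le> B * (t - x)" by (rule prim_of_lipschitz[OF g]) (use B st x in auto)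
      also have "\<dots> \<le> B * (t - s)" using B x by (intro mult_left_mono) auto
      finally show "norm (F x * (g t - g x)) \<le> A * (B * (t - s))"
        unfolding norm_mult using A st x by (intro mult_mono) auto
      have "norm (f x - f s) \<le> A * (x - s)" by (rule prim_of_lipschitz[OF f]) (use A st x in auto)
      also have "\<dots> \<le> A * (t - s)" using A x by (intro mult_left_mono) auto
      finally show "norm ((f s - f x) * G x) \<le> (A * (t - s)) * B"
        unfolding norm_mult using A B st x by (intro mult_mono) (auto simp: norm_minus_commute)
    qed (auto intro!: loc_bdd_intros lF lG lf lg)
    also have "\<dots> = (t - s) * (2 * A * B * t - 2 * A * B * s)"
      using st by (simp add: measure_lebesgue_Ioc algebra_simps)
    finally show "norm (H t - H s) \<le> (t - s) * (2 * A * B * t - 2 * A * B * s)" .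
  qed
  then show "f b * g b - f a * g a = intI lebesgue a b (\<lambda>x. F x * g x + f x * G x)"
    by (simp add: H_def intI_empty algebra_simps)
qed

lemma prim_of_cmult:
  fixes f :: "real \<Rightarrow> 'b::{real_normed_field, banach, second_countable_topology}"
  shows "prim_of f F \<Longrightarrow> prim_of (\<lambda>x. c * f x) (\<lambda>x. c * F x)"
  using prim_of_mult[OF prim_of_const[of c], of f F] by simp

lemma measure_Ioc_mono:
  assumes "locfin M" "s \<le> s'" "t' \<le> t"
  shows "measure M {s'<..t'} \<le> measure M {s<..t}"
  by (rule measure_mono_fmeasurable)
     (use assms locfin_Ioc[OF assms(1)] locfin_emeasure[OF assms(1), of s t] in \<open>auto simp: fmeasurable_def\<close>)

lemma measure_Ioc_add:
  assumes "locfin M" "s \<le> r" "r \<le> t"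
  shows "measure M {s<..t} = measure M {s<..r} + measure M {r<..t}"
proof -
  have "{s<..t} = {s<..r} \<union> {r<..t}" using assms by auto
  then show ?thesis using measure_Union[of M "{s<..r}" "{r<..t}"] locfin_emeasure[OF assms(1)]
    by (simp add: locfin_Ioc[OF assms(1)] less_top)
qed

lemma loc_bdd_measure_Ioc:
  assumes "locfin M" "locfin N" shows "loc_bdd N (\<lambda>t. measure M {a<..t})"
  unfolding loc_bdd_def
proof (intro conjI allI)
  have "mono (\<lambda>t. measure M {a<..t})" using measure_Ioc_mono[OF assms(1)] by (auto intro!: monoI)
  then show "(\<lambda>t. measure M {a<..t}) \<in> borel_measurable N"
    by (intro locfin_measurable[OF assms(2)] borel_measurable_mono)
  fix s t
  show "\<exists>B. \<forall>x\<in>{s..t}. norm (measure M {a<..x}) \<le> B"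
    by (intro exI[of _ "measure M {a<..t}"]) (auto intro!: measure_Ioc_mono assms)
qed

text \<open>
  Up to the sign, the increment over \<open>{s<..t}\<close> of the difference of the two sides is at most
  \<open>2 * B * (t - s)\<close> times the mass of \<open>{s<..t}\<close>, where \<open>B\<close> bounds \<open>F\<close>; so it is constant.
\<close>

lemma integral_by_parts_measure:
  fixes w :: "real \<Rightarrow> 'b::{banach, second_countable_topology}"
  assumes M: "locfin M" and w: "prim_of w F" and ab: "a \<le> b"
  shows "intI M a b w = measure M {a<..b} *\<^sub>R w b - intI lebesgue a b (\<lambda>x. measure M {a<..x} *\<^sub>R F x)"
proof -
  define m where "m t = measure M {a<..t}" for t
  note lw = prim_of_loc_bdd[OF w M] and lF = prim_ofD(1)[OF w]
  have lm: "loc_bdd lebesgue m" unfolding m_def by (rule loc_bdd_measure_Ioc[OF M locfin_lebesgue])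
  have lmF: "loc_bdd lebesgue (\<lambda>x. m x *\<^sub>R F x)" by (intro loc_bdd_intros lm lF)
  obtain B where B: "0 \<le> B" "\<And>x. a \<le> x \<Longrightarrow> x \<le> b \<Longrightarrow> norm (F x) \<le> B" using loc_bdd_bound[OF lF] by metis
  define H where "H t = intI M a t w - m t *\<^sub>R w t + intI lebesgue a t (\<lambda>x. m x *\<^sub>R F x)" for t
  have "H b = H a"
  proof (rule increment_le_constant[OF ab, where V = "\<lambda>t. 2 * B * m t"])
    fix s t assume st: "a \<le> s" "s \<le> t" "t \<le> b"
    have mst: "m t - m s = measure M {s<..t}" using measure_Ioc_add[OF M st(1,2)] by (simp add: m_def)
    have 1: "intI M s t (\<lambda>x. w x - w t) = intI M s t w - (m t - m s) *\<^sub>R w t"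
      by (simp add: intI_diff[OF M lw] intI_const M mst)
    have 2: "intI lebesgue s t (\<lambda>x. (m x - m s) *\<^sub>R F x) = intI lebesgue s t (\<lambda>x. m x *\<^sub>R F x) - m s *\<^sub>R (w t - w s)"
      using st by (simp add: scaleR_diff_left intI_diff lmF loc_bdd_intros lF prim_ofD(2)[OF w])
    have "H t - H s = intI M s t w - m t *\<^sub>R w t + m s *\<^sub>R w s + intI lebesgue s t (\<lambda>x. m x *\<^sub>R F x)"
      using intI_combine[OF M lw st(1,2)] intI_combine[OF locfin_lebesgue lmF st(1,2)]
      by (simp add: H_def algebra_simps)
    also have "\<dots> = intI M s t (\<lambda>x. w x - w t) + intI lebesgue s t (\<lambda>x. (m x - m s) *\<^sub>R F x)"
      unfolding 1 2 by (simp add: algebra_simps)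
    finally have "norm (H t - H s) \<le> norm (intI M s t (\<lambda>x. w x - w t)) + norm (intI lebesgue s t (\<lambda>x. (m x - m s) *\<^sub>R F x))"
      by (simp add: norm_triangle_ineq)
    also have "\<dots> \<le> (B * (t - s)) * measure M {s<..t} + ((m t - m s) * B) * measure lebesgue {s<..t}"
    proof (intro add_mono intI_bound)
      fix x assume x: "s < x" "x \<le> t"
      have "norm (w t - w x) \<le> B * (t - x)" by (rule prim_of_lipschitz[OF w]) (use B st x in auto)
      also have "\<dots> \<le> B * (t - s)" using B x by (intro mult_left_mono) auto
      finally show "norm (w x - w t) \<le> B * (t - s)" by (simp add: norm_minus_commute)
      have "0 \<le> m x - m s" "m x \<le> m t"
        using x st by (auto simp: m_def intro!: measure_Ioc_mono[OF M])
      then show "norm ((m x - m s) *\<^sub>R F x) \<le> (m t - m s) * B"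
        using B st x by (auto intro!: mult_mono)
    qed (auto intro!: loc_bdd_intros lF lm lw M)
    also have "\<dots> = (t - s) * (2 * B * m t - 2 * B * m s)"
      using st by (simp add: measure_lebesgue_Ioc algebra_simps flip: mst)
    finally show "norm (H t - H s) \<le> (t - s) * (2 * B * m t - 2 * B * m s)" .
  qed
  then show ?thesis by (simp add: H_def m_def intI_empty algebra_simps)
qed

section \<open>Weak derivatives\<close>

lemma distr_lebesgue_shift: "distr lebesgue lebesgue (\<lambda>x::real. x + c) = lebesgue"
proof -
  have "lebesgue = density (distr lebesgue lebesgue (\<lambda>x::real. c + 1 * x)) (\<lambda>_. ennreal \<bar>1\<bar>)"
    using lebesgue_real_affine[of 1 c] by simp
  then show ?thesis by (simp add: density_1 add.commute)
qed

lemma measurable_lebesgue_shift [measurable]: "(\<lambda>x::real. x + c) \<in> lebesgue \<rightarrow>\<^sub>M lebesgue"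
  using lebesgue_affine_measurable[where c="\<lambda>_::real. 1" and t = c] by (simp add: add.commute)

lemma lebesgue_integral_shift:
  fixes f :: "real \<Rightarrow> 'b::{banach, second_countable_topology}"
  assumes "f \<in> borel_measurable lebesgue"
  shows "(LINT x|lebesgue. f (x + c)) = (LINT x|lebesgue. f x)"
  using integral_distr[OF measurable_lebesgue_shift[of c] assms] by (simp add: distr_lebesgue_shift)

lemma intI_shift:
  fixes f :: "real \<Rightarrow> 'b::{banach, second_countable_topology}"
  assumes "f \<in> borel_measurable lebesgue"
  shows "intI lebesgue s t (\<lambda>x. f (x + c)) = intI lebesgue (s + c) (t + c) f"
proof -
  have "(\<lambda>x. indicator {s + c<..t + c} x *\<^sub>R f x) \<in> borel_measurable lebesgue"
    by (intro borel_measurable_scaleR borel_measurable_indicator assms) simp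
  from lebesgue_integral_shift[OF this, of c] show ?thesis
    by (simp add: set_lebesgue_integral_def indicator_def)
qed

lemma loc_bdd_shift:
  assumes "loc_bdd lebesgue f" shows "loc_bdd lebesgue (\<lambda>x. f (x + c))"
  unfolding loc_bdd_def
proof (intro conjI allI)
  show "(\<lambda>x. f (x + c)) \<in> borel_measurable lebesgue"
    using measurable_compose[OF measurable_lebesgue_shift loc_bddD[OF assms]] .
  fix s t
  obtain B where "\<And>x. s + c \<le> x \<Longrightarrow> x \<le> t + c \<Longrightarrow> norm (f x) \<le> B" using loc_bdd_bound[OF assms] by metis
  then show "\<exists>B. \<forall>x\<in>{s..t}. norm (f (x + c)) \<le> B" by (intro exI[of _ B]) auto
qed

lemma prim_of_shift: "prim_of f F \<Longrightarrow> prim_of (\<lambda>x. f (x + c)) (\<lambda>x. F (x + c))"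
  unfolding prim_of_def by (auto simp: loc_bdd_shift intI_shift loc_bddD)

text \<open>
  Integrals over empty intervals vanish, so this is the integral from \<open>0\<close> to \<open>t\<close> with the sign
  convention for \<open>t < 0\<close>.
\<close>

definition indef_int :: "(real \<Rightarrow> 'b::{banach, second_countable_topology}) \<Rightarrow> real \<Rightarrow> 'b" where
  "indef_int F t = intI lebesgue 0 t F - intI lebesgue t 0 F"

lemma prim_of_indef_int:
  assumes "loc_bdd lebesgue F" shows "prim_of (indef_int F) F"
  unfolding prim_of_def
proof (intro conjI allI impI)
  fix s t :: real assume st: "s \<le> t"
  note c = intI_combine[OF locfin_lebesgue assms]
  consider "0 \<le> s" | "s < 0" "0 \<le> t" | "t < 0" by linarith
  then show "indef_int F t - indef_int F s = intI lebesgue s t F"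
  proof cases
    case 1 then show ?thesis using c[of 0 s t] st by (auto simp: indef_int_def intI_empty algebra_simps)
  next
    case 2 then show ?thesis using c[of s 0 t] by (auto simp: indef_int_def intI_empty algebra_simps)
  next
    case 3 then show ?thesis using c[of s t 0] st by (auto simp: indef_int_def intI_empty algebra_simps)
  qed
qed fact

lemma prim_of_C1:
  fixes f F :: "real \<Rightarrow> real"
  assumes "\<And>x. (f has_real_derivative F x) (at x)" "continuous_on UNIV F"
  shows "prim_of f F"
  unfolding prim_of_def
proof (intro conjI allI impI)
  show l: "loc_bdd lebesgue F" by (rule loc_bdd_continuous[OF locfin_lebesgue assms(2)])
  fix s t :: real assume st: "s \<le> t"
  have Fm [measurable]: "F \<in> borel_measurable borel" by (rule borel_measurable_continuous_onI[OF assms(2)])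
  have "f t - f s = (LINT x|lborel. F x * indicator {s..t} x)"
    by (rule integral_FTC_Icc_real[symmetric, OF st])
       (use assms in \<open>auto simp: continuous_on_eq_continuous_at\<close>)
  also have "\<dots> = (LINT x|lborel. indicator {s<..t} x *\<^sub>R F x)"
  proof (rule integral_cong_AE)
    have "AE x in lborel. x \<noteq> s" by (rule AE_lborel_singleton)
    then show "AE x in lborel. F x * indicator {s..t} x = indicator {s<..t} x *\<^sub>R F x"
      by eventually_elim (auto simp: indicator_def)
  qed measurable
  also have "\<dots> = intI lebesgue s t F"
    unfolding set_lebesgue_integral_def by (rule integral_completion[symmetric]) measurable
  finally show "f t - f s = intI lebesgue s t F" .
qed

lemma prim_of_bounded_linear:
  assumes "bounded_linear T" "prim_of f F" shows "prim_of (\<lambda>x. T (f x)) (\<lambda>x. T (F x))"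
  unfolding prim_of_def
proof (intro conjI allI impI)
  interpret T: bounded_linear T by fact
  note lF = prim_ofD(1)[OF assms(2)]
  show "loc_bdd lebesgue (\<lambda>x. T (F x))"
    unfolding loc_bdd_def
  proof (intro conjI allI)
    show "(\<lambda>x. T (F x)) \<in> borel_measurable lebesgue"
      using measurable_compose[OF loc_bddD[OF lF] borel_measurable_continuous_onI[OF T.continuous_on[OF continuous_on_id]]] .
    fix s t
    obtain B where B: "\<And>x. s \<le> x \<Longrightarrow> x \<le> t \<Longrightarrow> norm (F x) \<le> B" using loc_bdd_bound[OF lF] by metis
    obtain K where K: "\<And>x. norm (T x) \<le> norm x * K" "K > 0" using T.pos_bounded by metis
    show "\<exists>B. \<forall>x\<in>{s..t}. norm (T (F x)) \<le> B"
      using B K(2) by (intro exI[of _ "B * K"] ballI order_trans[OF K(1)]) (auto intro!: mult_right_mono)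
  qed
  fix s t :: real assume "s \<le> t"
  have "T (f t) - T (f s) = T (intI lebesgue s t F)"
    using prim_ofD(2)[OF assms(2) \<open>s \<le> t\<close>] T.diff by metis
  also have "\<dots> = intI lebesgue s t (\<lambda>x. T (F x))"
    using integral_bounded_linear[OF assms(1), of lebesgue "\<lambda>x. indicator {s<..t} x *\<^sub>R F x"]
      loc_bdd_set_integrable[OF locfin_lebesgue lF, of s t]
    by (simp add: set_lebesgue_integral_def set_integrable_def T.scaleR)
  finally show "T (f t) - T (f s) = intI lebesgue s t (\<lambda>x. T (F x))" .
qed

lemma prim_of_has_derivative:
  fixes f F :: "real \<Rightarrow> real"
  assumes "prim_of f F" "isCont F x"
  shows "(f has_real_derivative F x) (at x)"
  unfolding has_field_derivative_iff LIM_eq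
proof (intro allI impI)
  fix e :: real assume "0 < e"
  then obtain d where d: "d > 0" "\<And>y. \<bar>y - x\<bar> < d \<Longrightarrow> \<bar>F y - F x\<bar> < e / 2"
    using assms(2)[unfolded continuous_at_eps_delta, rule_format, of "e/2"] by (auto simp: dist_real_def)
  have g: "prim_of (\<lambda>t. f t - t * F x) (\<lambda>t. F t - F x)"
  proof -
    have "prim_of (\<lambda>t. t * F x) (\<lambda>t. F x)"
      by (rule prim_of_C1) (auto intro!: derivative_eq_intros)
    from prim_of_diff[OF assms(1) this] show ?thesis .
  qed
  have "\<bar>(f y - f x) / (y - x) - F x\<bar> < e" if y: "y \<noteq> x" "\<bar>y - x\<bar> < d" for y
  proof -
    have "\<bar>(f y - y * F x) - (f x - x * F x)\<bar> \<le> e / 2 * \<bar>y - x\<bar>"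
    proof (cases "x \<le> y")
      case True
      have "norm ((f y - y * F x) - (f x - x * F x)) \<le> e / 2 * (y - x)"
        by (rule prim_of_lipschitz[OF g True]) (use d y True in \<open>force intro: less_imp_le\<close>)
      then show ?thesis using True by simp
    next
      case False
      have "norm ((f x - x * F x) - (f y - y * F x)) \<le> e / 2 * (x - y)"
        by (rule prim_of_lipschitz[OF g]) (use d y False in \<open>auto intro!: less_imp_le\<close>)
      then show ?thesis using False by (simp add: abs_minus_commute)
    qed
    also have "\<dots> < e * \<bar>y - x\<bar>" using y \<open>0 < e\<close> by simp
    finally have *: "\<bar>(f y - y * F x) - (f x - x * F x)\<bar> < e * \<bar>y - x\<bar>" .
    have "(f y - f x) / (y - x) - F x = ((f y - y * F x) - (f x - x * F x)) / (y - x)"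
      using y by (simp add: field_simps)
    then show ?thesis using * y by (simp add: abs_divide divide_less_eq)
  qed
  then show "\<exists>d>0. \<forall>y. y \<noteq> x \<and> norm (y - x) < d \<longrightarrow> norm ((f y - f x) / (y - x) - F x) < e"
    using d(1) by auto
qed

lemma integral_eq_intI:
  assumes "\<And>x. x \<notin> {s<..t} \<Longrightarrow> f x = 0"
  shows "(LINT x|M. f x) = intI M s t f"
  unfolding set_lebesgue_integral_def
  by (rule Bochner_Integration.integral_cong) (use assms in \<open>auto simp: indicator_def\<close>)

lemma compact_support_vanish:
  fixes f F :: "real \<Rightarrow> real"
  assumes d: "\<And>x. (f has_real_derivative F x) (at x)" and c: "compact (spt_fun f)"
  obtains R where "0 < R" "\<And>x. R \<le> \<bar>x\<bar> \<Longrightarrow> f x = 0" "\<And>x. R \<le> \<bar>x\<bar> \<Longrightarrow> F x = 0"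
proof -
  obtain r where r: "\<And>x. x \<in> spt_fun f \<Longrightarrow> \<bar>x\<bar> \<le> r"
    using compact_imp_bounded[OF c] by (auto simp: bounded_iff)
  have z: "f x = 0" if "r < \<bar>x\<bar>" for x
    using r[of x] that closure_subset[of "{x. f x \<noteq> 0}"] unfolding spt_fun_def by auto
  have z': "F x = 0" if "r < \<bar>x\<bar>" for x
  proof -
    have "((\<lambda>x. 0) has_real_derivative 0) (at x)" by simp
    moreover have "open {y. r < \<bar>y\<bar>}" by (intro open_Collect_less continuous_intros)
    then have "\<forall>\<^sub>F y in nhds x. f y = 0"
      using that z by (auto simp: eventually_nhds)
    then have "(f has_real_derivative F x) (at x) = ((\<lambda>x. 0) has_real_derivative F x) (at x)"
      by (intro DERIV_cong_ev) auto
    ultimately show ?thesis using d[of x] DERIV_unique by metis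
  qed
  show ?thesis by (rule that[of "\<bar>r\<bar> + 1"]) (auto intro!: z z')
qed

lemma prim_of_weak_deriv:
  fixes u v :: "real \<Rightarrow> 'k::{real_normed_field, banach, second_countable_topology}"
  assumes "prim_of u v" shows "weak_deriv u v"
  unfolding weak_deriv_def
proof (intro allI impI)
  fix \<phi> \<phi>' :: "real \<Rightarrow> real"
  assume d: "\<forall>x. (\<phi> has_real_derivative \<phi>' x) (at x)" and c: "continuous_on UNIV \<phi>'"
    and s: "compact (spt_fun \<phi>)"
  obtain R where R: "0 < R" "\<And>x. R \<le> \<bar>x\<bar> \<Longrightarrow> \<phi> x = 0" "\<And>x. R \<le> \<bar>x\<bar> \<Longrightarrow> \<phi>' x = 0"
    using compact_support_vanish d s by metis
  have a: "prim_of \<phi> \<phi>'" using prim_of_C1 d c by blast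
  have ak: "prim_of (\<lambda>x. of_real (\<phi> x) :: 'k) (\<lambda>x. of_real (\<phi>' x))"
    by (rule prim_of_bounded_linear[OF bounded_linear_of_real a])
  have l: "loc_bdd lebesgue (\<lambda>x. \<phi>' x *\<^sub>R u x)" "loc_bdd lebesgue (\<lambda>x. \<phi> x *\<^sub>R v x)"
    using a assms by (auto intro!: loc_bdd_intros prim_of_loc_bdd[OF assms] prim_of_loc_bdd[OF a] dest: prim_ofD(1))
  have "0 = intI lebesgue (-R) R (\<lambda>x. \<phi>' x *\<^sub>R u x + \<phi> x *\<^sub>R v x)"
    using prim_ofD(2)[OF prim_of_mult[OF ak assms], of "-R" R] R by (simp add: scaleR_conv_of_real)
  then have "0 = intI lebesgue (-R) R (\<lambda>x. \<phi>' x *\<^sub>R u x) + intI lebesgue (-R) R (\<lambda>x. \<phi> x *\<^sub>R v x)"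
    by (simp add: intI_add l)
  moreover have "(LINT x|lebesgue. \<phi>' x *\<^sub>R u x) = intI lebesgue (-R) R (\<lambda>x. \<phi>' x *\<^sub>R u x)"
    by (rule integral_eq_intI) (auto intro!: R)
  moreover have "(LINT x|lebesgue. \<phi> x *\<^sub>R v x) = intI lebesgue (-R) R (\<lambda>x. \<phi> x *\<^sub>R v x)"
    by (rule integral_eq_intI) (auto intro!: R)
  ultimately show "(LINT x|lebesgue. \<phi>' x *\<^sub>R u x) = - (LINT x|lebesgue. \<phi> x *\<^sub>R v x)"
    by (simp add: eq_neg_iff_add_eq_0)
qed

lemma loc_bdd_locally_integrable:
  fixes f :: "real \<Rightarrow> 'b::{banach, second_countable_topology}"
  assumes "loc_bdd lebesgue f" shows "locally_integrable lebesgue f"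
  unfolding locally_integrable_def
proof (intro allI impI)
  fix K :: "real set" assume "compact K"
  then obtain s t where "K \<subseteq> {s<..t}" using bounded_subset_greaterThanAtMost compact_imp_bounded by metis
  then show "set_integrable lebesgue K f"
    using set_integrable_subset[OF loc_bdd_set_integrable[OF locfin_lebesgue assms]] \<open>compact K\<close>
    by (meson compact_imp_closed lmeasurable_compact fmeasurableD)
qed

lemma prim_of_W11loc:
  fixes u v :: "real \<Rightarrow> 'k::{real_normed_field, banach, second_countable_topology}"
  assumes "prim_of u v" shows "W11loc u v"
  unfolding W11loc_def
  by (intro conjI prim_of_continuous[OF assms] loc_bdd_locally_integrable prim_of_loc_bdd[OF assms locfin_lebesgue]
      prim_ofD(1)[OF assms] prim_of_weak_deriv[OF assms])

text \<open>
  The lemma of du Bois-Reymond.  The difference \<open>z\<close> of \<open>u\<close> and an indefinite integral of \<open>v\<close> is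
  annihilated by the derivatives of all test functions.  As derivative serves the difference of two
  tents, centred at \<open>s\<close> and \<open>t\<close>, whose indefinite integral has compact support; letting the tents
  shrink gives \<open>z s = z t\<close>.
\<close>

lemma weak_deriv_prim_of:
  fixes u v :: "real \<Rightarrow> 'k::{real_normed_field, banach, second_countable_topology}"
  assumes cu: "continuous_on UNIV u" and lv: "loc_bdd lebesgue v" and w: "weak_deriv u v"
  shows "prim_of u v"
proof -
  have ap: "prim_of (indef_int v) v" by (rule prim_of_indef_int[OF lv])
  define z where "z x = u x - indef_int v x" for x
  have cz: "continuous_on UNIV z" unfolding z_def by (intro continuous_intros cu prim_of_continuous[OF ap])
  have lz: "loc_bdd lebesgue z" by (rule loc_bdd_continuous[OF locfin_lebesgue cz])
  have lu: "loc_bdd lebesgue u" by (rule loc_bdd_continuous[OF locfin_lebesgue cu])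
  have test: "(LINT x|lebesgue. \<phi>' x *\<^sub>R z x) = 0"
    if d: "\<And>x. (\<phi> has_real_derivative \<phi>' x) (at x)" and c: "continuous_on UNIV \<phi>'" and s: "compact (spt_fun \<phi>)" 
    for \<phi> \<phi>' :: "real \<Rightarrow> real"
  proof -
    obtain R where R: "0 < R" "\<And>x. R \<le> \<bar>x\<bar> \<Longrightarrow> \<phi> x = 0" "\<And>x. R \<le> \<bar>x\<bar> \<Longrightarrow> \<phi>' x = 0"
      using compact_support_vanish d s by metis
    have l: "loc_bdd lebesgue \<phi>'" by (rule loc_bdd_continuous[OF locfin_lebesgue c])
    have "(LINT x|lebesgue. \<phi>' x *\<^sub>R u x) = (LINT x|lebesgue. \<phi>' x *\<^sub>R indef_int v x)"
      using w[unfolded weak_deriv_def, rule_format, OF d c s]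
        prim_of_weak_deriv[OF ap, unfolded weak_deriv_def, rule_format, OF d c s] by simp
    moreover have "(LINT x|lebesgue. \<phi>' x *\<^sub>R f x) = intI lebesgue (-R) R (\<lambda>x. \<phi>' x *\<^sub>R f x)" for f :: "real \<Rightarrow> 'k"
      by (rule integral_eq_intI) (auto intro!: R)
    moreover have "intI lebesgue (-R) R (\<lambda>x. \<phi>' x *\<^sub>R z x) =
      intI lebesgue (-R) R (\<lambda>x. \<phi>' x *\<^sub>R u x) - intI lebesgue (-R) R (\<lambda>x. \<phi>' x *\<^sub>R indef_int v x)"
      unfolding z_def scaleR_diff_right
      by (rule intI_diff[OF locfin_lebesgue]) (intro loc_bdd_intros l lu prim_of_loc_bdd[OF ap] locfin_lebesgue)+
    ultimately show ?thesis by simp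
  qed
  have "z s = z t" for s t
  proof (rule ccontr)
    assume "z s \<noteq> z t"
    define \<delta> where "\<delta> = norm (z s - z t) / 3"
    have \<delta>: "\<delta> > 0" using \<open>z s \<noteq> z t\<close> by (simp add: \<delta>_def)
    have cs: "isCont z x" for x using cz by (simp add: continuous_on_eq_continuous_at)
    have osc: "\<exists>e>0. \<forall>y. \<bar>y - x\<bar> < e \<longrightarrow> norm (z y - z x) < \<delta>" for x
      using cs[of x] \<delta> unfolding continuous_at_eps_delta by (force simp: dist_norm)
    obtain e1 where e1: "e1 > 0" "\<And>y. \<bar>y - s\<bar> < e1 \<Longrightarrow> norm (z y - z s) < \<delta>" using osc by metis
    obtain e2 where e2: "e2 > 0" "\<And>y. \<bar>y - t\<bar> < e2 \<Longrightarrow> norm (z y - z t) < \<delta>" using osc by metis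
    define e where "e = min e1 e2"
    have e: "e > 0" using e1 e2 by (simp add: e_def)
    define k where "k x = max 0 (e - \<bar>x\<bar>)" for x :: real
    have ck: "continuous_on UNIV k" unfolding k_def by (intro continuous_intros)
    have lk: "loc_bdd lebesgue k" by (rule loc_bdd_continuous[OF locfin_lebesgue ck])
    define K where "K = indef_int k"
    have aK: "prim_of K k" unfolding K_def by (rule prim_of_indef_int[OF lk])
    have dK: "(K has_real_derivative k x) (at x)" for x
      by (rule prim_of_has_derivative[OF aK]) (use ck in \<open>simp add: continuous_on_eq_continuous_at\<close>)
    have k0: "k x = 0" if "e \<le> \<bar>x\<bar>" for x using that by (simp add: k_def)
    have Kr: "K x = K e" if "e \<le> x" for x
      using prim_ofD(2)[OF aK that] intI_cong[of e x k "\<lambda>x. 0" lebesgue] k0 by simp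
    have Kl: "K x = K (-e)" if "x \<le> -e" for x
      using prim_ofD(2)[OF aK that] intI_cong[of x "-e" k "\<lambda>x. 0" lebesgue] k0 by simp
    define A where "A = K e - K (-e)"
    have A: "A > 0"
    proof -
      have "e / 2 * e = intI lebesgue (-e/2) (e/2) (\<lambda>x. e / 2)"
        using e by (simp add: intI_const[OF locfin_lebesgue] measure_lebesgue_Ioc del: content_real_eq_0)
      also have "\<dots> \<le> intI lebesgue (-e/2) (e/2) k"
        by (rule intI_mono[OF locfin_lebesgue loc_bdd_const lk]) (auto simp: k_def)
      also have "\<dots> = K (e/2) - K (-e/2)" using prim_ofD(2)[OF aK, of "-e/2" "e/2"] e by simp
      also have "\<dots> \<le> A"
        using prim_ofD(2)[OF aK, of "-e" "-e/2"] prim_ofD(2)[OF aK, of "e/2" e] e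
          intI_nonneg[of "-e" "-e/2" k lebesgue] intI_nonneg[of "e/2" e k lebesgue] 
        by (simp add: A_def k_def)
      finally show ?thesis using e by (smt (verit) mult_pos_pos half_gt_zero)
    qed
    define J where "J c = intI lebesgue (c - e) (c + e) (\<lambda>x. k (x - c) *\<^sub>R z x)" for c
    have lkc: "loc_bdd lebesgue (\<lambda>x. k (x - c))" for c using loc_bdd_shift[OF lk, of "-c"] by simp
    have J: "norm (J c - A *\<^sub>R z c) \<le> A * \<delta>" if "\<And>y. \<bar>y - c\<bar> < e \<Longrightarrow> norm (z y - z c) < \<delta>" for c
    proof -
      have Aeq: "intI lebesgue (c - e) (c + e) (\<lambda>x. k (x - c)) = A"
        using prim_ofD(2)[OF prim_of_shift[OF aK, of "-c"], of "c - e" "c + e"] e by (simp add: A_def)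
      have "A *\<^sub>R z c = intI lebesgue (c - e) (c + e) (\<lambda>x. k (x - c) *\<^sub>R z c)"
        unfolding intI_scaleR_left[OF locfin_lebesgue lkc] Aeq ..
      then have "J c - A *\<^sub>R z c = intI lebesgue (c - e) (c + e) (\<lambda>x. k (x - c) *\<^sub>R (z x - z c))"
        unfolding J_def scaleR_diff_right
        by (subst intI_diff[OF locfin_lebesgue]) (auto intro!: loc_bdd_intros lkc lz)
      also have "norm \<dots> \<le> intI lebesgue (c - e) (c + e) (\<lambda>x. k (x - c) *\<^sub>R \<delta>)"
      proof (rule intI_norm_le[OF locfin_lebesgue])
        fix x assume x: "c - e < x" "x \<le> c + e"
        show "norm (k (x - c) *\<^sub>R (z x - z c)) \<le> k (x - c) *\<^sub>R \<delta>"
        proof (cases "x = c + e")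
          case True then show ?thesis using e by (simp add: k_def)
        next
          case False
          then have "norm (z x - z c) < \<delta>" using x by (intro that) auto
          moreover have "0 \<le> k (x - c)" by (simp add: k_def)
          ultimately show ?thesis by (auto intro!: mult_left_mono)
        qed
      qed (auto intro!: loc_bdd_intros lkc lz)
      also have "\<dots> = A * \<delta>" by (simp add: Aeq)
      finally show ?thesis .
    qed
    have JJ: "(LINT x|lebesgue. k (x - c) *\<^sub>R z x) = J c" for c
      unfolding J_def by (rule integral_eq_intI) (auto simp: k_def)
    have int: "integrable lebesgue (\<lambda>x. k (x - c) *\<^sub>R z x)" for c
    proof -
      have "(\<lambda>x. indicator {c-e<..c+e} x *\<^sub>R (k (x - c) *\<^sub>R z x)) = (\<lambda>x. k (x - c) *\<^sub>R z x)"
        by (auto simp: k_def indicator_def fun_eq_iff)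
      then show ?thesis
        using loc_bdd_set_integrable[OF locfin_lebesgue, of "\<lambda>x. k (x - c) *\<^sub>R z x" "c-e" "c+e"]
        by (simp add: set_integrable_def loc_bdd_intros lkc lz)
    qed
    have "(LINT x|lebesgue. (k (x - s) - k (x - t)) *\<^sub>R z x) = 0"
    proof (rule test[where \<phi> = "\<lambda>x. K (x - s) - K (x - t)"])
      show "((\<lambda>x. K (x - s) - K (x - t)) has_real_derivative k (x - s) - k (x - t)) (at x)" for x
        by (auto intro!: derivative_eq_intros DERIV_chain2[OF dK])
      show "continuous_on UNIV (\<lambda>x. k (x - s) - k (x - t))" unfolding k_def by (intro continuous_intros)
      have "{x. K (x - s) - K (x - t) \<noteq> 0} \<subseteq> {-(\<bar>s\<bar> + \<bar>t\<bar> + e)..\<bar>s\<bar> + \<bar>t\<bar> + e}"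
      proof
        fix x assume "x \<in> {x. K (x - s) - K (x - t) \<noteq> 0}"
        moreover have "K (x - s) = K (x - t)" if "x > \<bar>s\<bar> + \<bar>t\<bar> + e"
          using Kr[of "x - s"] Kr[of "x - t"] that by linarith
        moreover have "K (x - s) = K (x - t)" if "x < -(\<bar>s\<bar> + \<bar>t\<bar> + e)"
          using Kl[of "x - s"] Kl[of "x - t"] that by linarith
        ultimately show "x \<in> {-(\<bar>s\<bar> + \<bar>t\<bar> + e)..\<bar>s\<bar> + \<bar>t\<bar> + e}" by force
      qed
      then show "compact (spt_fun (\<lambda>x. K (x - s) - K (x - t)))"
        unfolding spt_fun_def by (meson bounded_closed_interval bounded_subset compact_closure)
    qed
    then have "J s = J t"
      using int[of s] int[of t] by (simp add: scaleR_diff_left JJ)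
    then have "norm (A *\<^sub>R (z s - z t)) \<le> norm (J s - A *\<^sub>R z s) + norm (J t - A *\<^sub>R z t)"
      using norm_triangle_ineq4[of "J t - A *\<^sub>R z t" "J s - A *\<^sub>R z s"] by (simp add: algebra_simps)
    also have "\<dots> \<le> A * \<delta> + A * \<delta>"
      by (intro add_mono J) (use e1 e2 in \<open>auto simp: e_def\<close>)
    finally have "A * norm (z s - z t) \<le> A * (2 * \<delta>)" using A by simp
    then have "norm (z s - z t) \<le> 2 * \<delta>" using A by simp
    then show False using \<delta> by (simp add: \<delta>_def)
  qed
  then have "u x = indef_int v x + z 0" for x
    by (metis add_diff_cancel_right' diff_add_cancel z_def add.commute)
  with ap show ?thesis
    by (intro prim_of_cong[OF prim_of_add[OF ap prim_of_const[of "z 0"]]]) auto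
qed

section \<open>Linear systems with locally bounded coefficients\<close>

lemma prim_of_power:
  fixes L r0 :: real
  shows "prim_of (\<lambda>t. (L * (t - r0)) ^ Suc n / fact (Suc n)) (\<lambda>t. L * ((L * (t - r0)) ^ n / fact n))"
proof (rule prim_of_C1)
  fix x
  have "((\<lambda>t. L * (t - r0)) has_real_derivative L) (at x)"
    by (auto intro!: derivative_eq_intros)
  from DERIV_power_Suc[OF this, of n]
  have "((\<lambda>t. (L * (t - r0)) ^ Suc n) has_real_derivative real (Suc n) * (L * (x - r0)) ^ n * L) (at x)"
    by (simp add: algebra_simps)
  from DERIV_cdivide[OF this, of "fact (Suc n)"]
  have "((\<lambda>t. (L * (t - r0)) ^ Suc n / fact (Suc n)) has_real_derivative real (Suc n) * (L * (x - r0)) ^ n * L / fact (Suc n)) (at x)" .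
  moreover have "real (Suc n) * (L * (x - r0)) ^ n * L / fact (Suc n) = L * ((L * (x - r0)) ^ n / fact n)"
    by (simp add: fact_Suc divide_simps del: of_nat_Suc)
  ultimately show "((\<lambda>t. (L * (t - r0)) ^ Suc n / fact (Suc n)) has_real_derivative L * ((L * (x - r0)) ^ n / fact n)) (at x)"
    by (simp only:)
qed (intro continuous_intros, simp)

text \<open>
  The Neumann series: the \<open>n\<close>-th term is bounded by \<open>(L (t - r0)) ^ n / n!\<close>.  Because the coefficient
  vanishes to the left of \<open>r0\<close>, the solution is constant there and the initial value problem to the
  right of \<open>r0\<close> becomes a problem on the whole line.
\<close>

lemma linear_system_exists:
  fixes A :: "real \<Rightarrow> 'e \<Rightarrow> 'e::{banach, second_countable_topology}" and x0 :: 'e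
  assumes lin: "\<And>x. bounded_linear (A x)"
    and zero: "\<And>x v. x \<le> r0 \<Longrightarrow> A x v = 0"
    and bound: "\<And>T. \<exists>L\<ge>0. \<forall>x\<le>T. \<forall>v. norm (A x v) \<le> L * norm v"
    and meas: "\<And>X. X \<in> borel_measurable lebesgue \<Longrightarrow> (\<lambda>x. A x (X x)) \<in> borel_measurable lebesgue"
  shows "\<exists>X. prim_of X (\<lambda>x. A x (X x)) \<and> X r0 = x0"
proof -
  have lA: "loc_bdd lebesgue (\<lambda>x. A x (X x))" if lX': "loc_bdd lebesgue X" for X
    unfolding loc_bdd_def
  proof (intro conjI allI)
    show "(\<lambda>x. A x (X x)) \<in> borel_measurable lebesgue" by (rule meas[OF loc_bddD[OF lX']])
    fix s t
    obtain L where L: "L \<ge> 0" "\<And>x v. x \<le> t \<Longrightarrow> norm (A x v) \<le> L * norm v" using bound by metis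
    obtain B where B: "\<And>x. s \<le> x \<Longrightarrow> x \<le> t \<Longrightarrow> norm (X x) \<le> B" using loc_bdd_bound[OF lX'] by metis
    show "\<exists>B. \<forall>x\<in>{s..t}. norm (A x (X x)) \<le> B"
      using L B by (intro exI[of _ "L * B"] ballI order_trans[OF L(2)]) (auto intro!: mult_left_mono)
  qed
  have prim_ofI: "prim_of (\<lambda>t. x0' + intI lebesgue r0 t (\<lambda>x. A x (X x))) (\<lambda>x. A x (X x))" if "loc_bdd lebesgue X" for X x0'
    unfolding prim_of_def
  proof (intro conjI allI impI)
    show l: "loc_bdd lebesgue (\<lambda>x. A x (X x))" by (rule lA[OF that])
    have z: "intI lebesgue s t (\<lambda>x. A x (X x)) = 0" if "t \<le> r0" for s t
      using intI_cong[of s t "\<lambda>x. A x (X x)" "\<lambda>x. 0" lebesgue] that zero by simp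
    fix s t :: real assume "s \<le> t"
    note c = intI_combine[OF locfin_lebesgue l]
    consider "r0 \<le> s" | "s \<le> r0" "r0 \<le> t" | "t \<le> r0" by linarith
    then show "x0' + intI lebesgue r0 t (\<lambda>x. A x (X x)) - (x0' + intI lebesgue r0 s (\<lambda>x. A x (X x))) = intI lebesgue s t (\<lambda>x. A x (X x))"
    proof cases
      case 1 then show ?thesis using c[of r0 s t] \<open>s \<le> t\<close> by (auto simp: algebra_simps)
    next
      case 2 then show ?thesis using c[of s r0 t] z[of r0 s] by (simp add: intI_empty)
    next
      case 3 then show ?thesis using z[of t s] \<open>s \<le> t\<close> by (simp add: intI_empty)
    qed
  qed
  define D where "D = rec_nat (\<lambda>t. x0) (\<lambda>n X t. intI lebesgue r0 t (\<lambda>x. A x (X x)))"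
  have D0: "D 0 = (\<lambda>t. x0)" and DS: "\<And>n. D (Suc n) = (\<lambda>t. intI lebesgue r0 t (\<lambda>x. A x (D n x)))"
    by (simp_all add: D_def)
  have lD: "loc_bdd lebesgue (D n)" for n
  proof (induction n)
    case (Suc n)
    then show ?case using prim_of_loc_bdd[OF prim_ofI[OF Suc, of 0] locfin_lebesgue] by (simp add: DS)
  qed (simp add: D0)
  have Db: "norm (D n t) \<le> norm x0 * ((L * (t - r0)) ^ n / fact n)"
    if L: "L \<ge> 0" "\<And>x v. x \<le> T \<Longrightarrow> norm (A x v) \<le> L * norm v" and t: "r0 \<le> t" "t \<le> T" for n t T L
    using t
  proof (induction n arbitrary: t)
    case (Suc n)
    let ?g = "\<lambda>x. L * ((L * (x - r0)) ^ n / fact n)"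
    have ag: "prim_of (\<lambda>t. (L * (t - r0)) ^ Suc n / fact (Suc n)) ?g" by (rule prim_of_power)
    have "norm (D (Suc n) t) \<le> intI lebesgue r0 t (\<lambda>x. norm x0 * ?g x)"
      unfolding DS
    proof (rule intI_norm_le[OF locfin_lebesgue lA[OF lD]])
      show "loc_bdd lebesgue (\<lambda>x. norm x0 * ?g x)" using loc_bdd_scaleR[OF loc_bdd_const[of _ "norm x0"] prim_ofD(1)[OF ag]] by simp
      fix x assume x: "r0 < x" "x \<le> t"
      have "norm (A x (D n x)) \<le> L * norm (D n x)" using L x Suc.prems by auto
      also have "\<dots> \<le> L * (norm x0 * ((L * (x - r0)) ^ n / fact n))"
        using x Suc L by (intro mult_left_mono Suc.IH) auto
      finally show "norm (A x (D n x)) \<le> norm x0 * ?g x" by (simp add: ac_simps)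
    qed
    also have "\<dots> = norm x0 * ((L * (t - r0)) ^ Suc n / fact (Suc n))"
      using prim_ofD(2)[OF ag, of r0 t] Suc.prems by simp
    finally show ?case .
  qed (simp add: D0)
  define X where "X t = (\<Sum>n. D n t)" for t
  have summ: "summable (\<lambda>n. norm x0 * ((L * (t - r0)) ^ n / fact n))" for L t
    using summable_exp_generic[of "L * (t - r0)"] by (intro summable_mult) (simp add: field_simps)
  have Dneg: "D (Suc n) t = 0" if "t \<le> r0" for n t
    using that by (simp add: DS intI_empty)
  have sD: "summable (\<lambda>n. norm (D n t))" for t
  proof (cases "r0 \<le> t")
    case True
    obtain L where L: "L \<ge> 0" "\<And>x v. x \<le> t \<Longrightarrow> norm (A x v) \<le> L * norm v" using bound by metis
    show ?thesis by (rule summable_comparison_test[OF _ summ[of L t]]) (use Db[OF L True] in auto)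
  next
    case False
    have "D n t = 0" if "n \<notin> {0}" for n using that Dneg[of t] False by (cases n) auto
    then show ?thesis by (intro summable_finite[of "{0}"]) auto
  qed
  have Xm: "X \<in> borel_measurable lebesgue"
    unfolding X_def by (rule borel_measurable_suminf) (rule loc_bddD[OF lD])
  have Xneg: "X t = x0" if "t \<le> r0" for t
  proof -
    have "D n t = 0" if "n \<notin> {0}" for n using that Dneg[OF \<open>t \<le> r0\<close>] by (cases n) auto
    then have "(\<Sum>n. D n t) = (\<Sum>n\<in>{0}. D n t)" by (intro suminf_finite) auto
    then show ?thesis by (simp add: X_def D0)
  qed
  have Xb: "norm (X t) \<le> norm x0 * exp (L * (t - r0))"
    if L: "L \<ge> 0" "\<And>x v. x \<le> T \<Longrightarrow> norm (A x v) \<le> L * norm v" and t: "r0 \<le> t" "t \<le> T" for t T L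
  proof -
    have "norm (X t) \<le> (\<Sum>n. norm (D n t))" unfolding X_def by (rule summable_norm[OF sD])
    also have "\<dots> \<le> (\<Sum>n. norm x0 * ((L * (t - r0)) ^ n / fact n))"
      by (intro suminf_le sD summ) (use Db[OF L t] in auto)
    also have "\<dots> = norm x0 * exp (L * (t - r0))"
      using summable_exp_generic[of "L * (t - r0)"]
      by (subst suminf_mult) (simp_all add: exp_def field_simps)
    finally show ?thesis .
  qed
  have lX: "loc_bdd lebesgue X"
    unfolding loc_bdd_def
  proof (intro conjI allI Xm)
    fix s t
    obtain L where L: "L \<ge> 0" "\<And>x v. x \<le> t \<Longrightarrow> norm (A x v) \<le> L * norm v" using bound by metis
    have "norm (X x) \<le> norm x0 * exp (L * \<bar>t - r0\<bar>)" if "x \<in> {s..t}" for x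
    proof (cases "r0 \<le> x")
      case True
      have "norm (X x) \<le> norm x0 * exp (L * (x - r0))" by (rule Xb[OF L True]) (use that in auto)
      also have "\<dots> \<le> norm x0 * exp (L * \<bar>t - r0\<bar>)"
        using that L by (intro mult_left_mono) (auto intro!: mult_left_mono)
      finally show ?thesis .
    next
      case False
      then have "norm (X x) = norm x0 * 1" using Xneg[of x] by simp
      also have "\<dots> \<le> norm x0 * exp (L * \<bar>t - r0\<bar>)" using L by (intro mult_left_mono) auto
      finally show ?thesis .
    qed
    then show "\<exists>B. \<forall>x\<in>{s..t}. norm (X x) \<le> B" by blast
  qed
  have fix_eq: "X t = x0 + intI lebesgue r0 t (\<lambda>x. A x (X x))" for t
  proof (cases "r0 \<le> t")
    case False
    then show ?thesis by (simp add: Xneg intI_empty)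
  next
    case True
    obtain L where L: "L \<ge> 0" "\<And>x v. x \<le> t \<Longrightarrow> norm (A x v) \<le> L * norm v" using bound by metis
    let ?f = "\<lambda>n x. indicator {r0<..t} x *\<^sub>R A x (D n x)"
    have int: "integrable lebesgue (?f n)" for n
      using loc_bdd_set_integrable[OF locfin_lebesgue lA[OF lD[of n]], of r0 t] by (simp add: set_integrable_def)
    have fle: "norm (?f n x) \<le> indicator {r0<..t} x *\<^sub>R (L * (norm x0 * ((L * (t - r0)) ^ n / fact n)))" for n x
    proof (cases "x \<in> {r0<..t}")
      case True
      have "norm (A x (D n x)) \<le> L * norm (D n x)" using L True by auto
      also have "\<dots> \<le> L * (norm x0 * ((L * (x - r0)) ^ n / fact n))"
        using True L by (intro mult_left_mono Db[OF L]) auto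
      also have "\<dots> \<le> L * (norm x0 * ((L * (t - r0)) ^ n / fact n))"
        using True L by (intro mult_left_mono divide_right_mono power_mono) auto
      finally show ?thesis using True by simp
    qed simp
    have AX: "(\<Sum>n. ?f n x) = indicator {r0<..t} x *\<^sub>R A x (X x)" and Asum: "summable (\<lambda>n. norm (?f n x))" for x
    proof -
      interpret b: bounded_linear "A x" by (rule lin)
      show "(\<Sum>n. ?f n x) = indicator {r0<..t} x *\<^sub>R A x (X x)"
        unfolding X_def using sD[of x, THEN summable_norm_cancel] b.summable[of "\<lambda>n. D n x"]
        by (simp add: b.suminf suminf_scaleR_right)
      show "summable (\<lambda>n. norm (?f n x))"
      proof (rule summable_comparison_test)
        show "\<exists>N. \<forall>n\<ge>N. norm (norm (?f n x)) \<le> indicator {r0<..t} x *\<^sub>R (L * (norm x0 * ((L * (t - r0)) ^ n / fact n)))"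
          using fle by simp
        show "summable (\<lambda>n. indicator {r0<..t} x *\<^sub>R (L * (norm x0 * ((L * (t - r0)) ^ n / fact n))))"
          by (intro summable_scaleR_right summable_mult[of _ L] summ)
      qed
    qed
    have "summable (\<lambda>n. \<integral>x. norm (?f n x) \<partial>lebesgue)"
    proof (rule summable_comparison_test)
      show "summable (\<lambda>n. (t - r0) * (L * (norm x0 * ((L * (t - r0)) ^ n / fact n))))"
        by (intro summable_mult summ)
      have "(\<integral>x. norm (?f n x) \<partial>lebesgue) \<le> (t - r0) * (L * (norm x0 * ((L * (t - r0)) ^ n / fact n)))" for n
      proof -
        have "(\<integral>x. norm (?f n x) \<partial>lebesgue) \<le> intI lebesgue r0 t (\<lambda>x. L * (norm x0 * ((L * (t - r0)) ^ n / fact n)))"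
          unfolding set_lebesgue_integral_def
        proof (rule integral_mono)
          show "integrable lebesgue (\<lambda>x. norm (?f n x))" by (rule integrable_norm[OF int])
          show "integrable lebesgue (\<lambda>x. indicator {r0<..t} x *\<^sub>R (L * (norm x0 * ((L * (t - r0)) ^ n / fact n))))"
            using loc_bdd_set_integrable[OF locfin_lebesgue loc_bdd_const] unfolding set_integrable_def .
        qed (rule fle)
        also have "\<dots> = (t - r0) * (L * (norm x0 * ((L * (t - r0)) ^ n / fact n)))"
          unfolding intI_const[OF locfin_lebesgue] measure_lebesgue_Ioc[OF True] by simp
        finally show ?thesis .
      qed
      then show "\<exists>N. \<forall>n\<ge>N. norm (\<integral>x. norm (?f n x) \<partial>lebesgue) \<le> (t - r0) * (L * (norm x0 * ((L * (t - r0)) ^ n / fact n)))"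
        by auto
    qed
    from integral_suminf[OF int _ this] Asum
    have "intI lebesgue r0 t (\<lambda>x. A x (X x)) = (\<Sum>n. D (Suc n) t)"
      by (simp add: AX DS set_lebesgue_integral_def)
    also have "\<dots> = X t - x0"
      unfolding X_def using suminf_split_head[OF sD[of t, THEN summable_norm_cancel]] by (simp add: D0)
    finally show ?thesis by simp
  qed
  have "(\<lambda>t. x0 + intI lebesgue r0 t (\<lambda>x. A x (X x))) = X" by (intro ext fix_eq[symmetric])
  then have "prim_of X (\<lambda>x. A x (X x))" using prim_ofI[OF lX, of x0] by (simp only:)
  then show ?thesis using Xneg[of r0] by auto
qed

section \<open>Comparison and growth of solutions\<close>

text \<open>
  The system \<open>u' = b y\<close>, \<open>dy = u d\<Phi>\<close> in the form that makes sense for every locally bounded \<open>\<Phi>\<close>: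
  \<open>y - \<Phi> u\<close> has the derivative \<open>- \<Phi> b y\<close>.  Its coefficient matrix in the variables \<open>u\<close> and
  \<open>y - \<Phi> u\<close> has trace \<open>0\<close>.
\<close>

definition quasi_sol :: "(real \<Rightarrow> real) \<Rightarrow> (real \<Rightarrow> 'k) \<Rightarrow> (real \<Rightarrow> 'k) \<Rightarrow> (real \<Rightarrow> 'k::{real_normed_field, banach, second_countable_topology}) \<Rightarrow> bool" where
  "quasi_sol b \<Phi> u y \<longleftrightarrow>
     prim_of u (\<lambda>x. b x *\<^sub>R y x) \<and> prim_of (\<lambda>x. y x - \<Phi> x * u x) (\<lambda>x. - (b x *\<^sub>R (\<Phi> x * y x)))"

lemma quasi_sol_exists:
  fixes \<Phi> :: "real \<Rightarrow> 'k::{real_normed_field, banach, second_countable_topology}"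
  assumes b: "loc_bdd lebesgue b" and P: "loc_bdd lebesgue \<Phi>"
  shows "\<exists>u y. quasi_sol (\<lambda>x. if r0 < x then b x else 0) \<Phi> u y \<and> u r0 = u0 \<and> y r0 = y0"
proof -
  define b0 where "b0 x = (if r0 < x then b x else 0)" for x
  define A where "A x v = (b0 x *\<^sub>R (snd v + \<Phi> x * fst v), - (b0 x *\<^sub>R (\<Phi> x * (snd v + \<Phi> x * fst v))))" for x and v :: "'k \<times> 'k"
  have b0m: "b0 \<in> borel_measurable lebesgue"
  proof -
    have "b0 = (\<lambda>x. indicator {r0<..} x * b x)" by (auto simp: b0_def indicator_def)
    then show ?thesis by (simp add: loc_bddD[OF b] borel_measurable_times borel_measurable_indicator)
  qed
  note Pm = loc_bddD[OF P]
  have "\<exists>X. prim_of X (\<lambda>x. A x (X x)) \<and> X r0 = (u0, y0 - \<Phi> r0 * u0)"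
  proof (rule linear_system_exists)
    show "bounded_linear (A x)" for x
      unfolding A_def by (intro bounded_linear_Pair bounded_linear_minus bounded_linear_scaleR_const
        bounded_linear_const_mult bounded_linear_add bounded_linear_snd bounded_linear_fst bounded_linear_compose[OF bounded_linear_scaleR_right])
    show "A x v = 0" if "x \<le> r0" for x v using that by (simp add: A_def b0_def zero_prod_def)
    show "\<exists>L\<ge>0. \<forall>x\<le>T. \<forall>v. norm (A x v) \<le> L * norm v" for T
    proof -
      obtain B where B: "0 \<le> B" "\<And>x. r0 \<le> x \<Longrightarrow> x \<le> T \<Longrightarrow> norm (b x) \<le> B" using loc_bdd_bound[OF b] by metis
      obtain C where C: "0 \<le> C" "\<And>x. r0 \<le> x \<Longrightarrow> x \<le> T \<Longrightarrow> norm (\<Phi> x) \<le> C" using loc_bdd_bound[OF P] by metis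
      have "norm (A x v) \<le> (B * (1 + C) + B * (C * (1 + C))) * norm v" if x: "x \<le> T" for x v
      proof (cases "r0 < x")
        case True
        have 1: "norm (snd v + \<Phi> x * fst v) \<le> (1 + C) * norm v"
        proof -
          have "norm (snd v + \<Phi> x * fst v) \<le> norm (snd v) + norm (\<Phi> x) * norm (fst v)"
            by (metis norm_mult norm_triangle_ineq)
          also have "\<dots> \<le> norm v + C * norm v"
            using C True x norm_fst_le[of "fst v" "snd v"] norm_snd_le[of "snd v" "fst v"]
            by (intro add_mono mult_mono) auto
          finally show ?thesis by (simp add: algebra_simps)
        qed
        have bx: "\<bar>b0 x\<bar> \<le> B" using B(2)[of x] True x by (simp add: b0_def)
        have "norm (A x v) \<le> norm (b0 x *\<^sub>R (snd v + \<Phi> x * fst v)) + norm (- (b0 x *\<^sub>R (\<Phi> x * (snd v + \<Phi> x * fst v))))"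
          unfolding A_def by (rule norm_Pair_le)
        also have "\<dots> = \<bar>b0 x\<bar> * norm (snd v + \<Phi> x * fst v) + \<bar>b0 x\<bar> * (norm (\<Phi> x) * norm (snd v + \<Phi> x * fst v))"
          by (simp add: norm_mult)
        also have "\<dots> \<le> B * ((1 + C) * norm v) + B * (C * ((1 + C) * norm v))"
          using B(1) C(1) C(2)[of x] True x by (intro add_mono mult_mono bx 1) auto
        finally show ?thesis by (simp add: algebra_simps)
      next
        case False
        then have "A x v = 0" by (simp add: A_def b0_def zero_prod_def)
        then show ?thesis using B(1) C(1) by simp
      qed
      then show ?thesis using B(1) C(1)
        by (intro exI[of _ "B * (1 + C) + B * (C * (1 + C))"]) auto
    qed
    show "(\<lambda>x. A x (X x)) \<in> borel_measurable lebesgue" if [measurable]: "X \<in> borel_measurable lebesgue" for X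
    proof -
      have 1: "(\<lambda>x. fst (X x)) \<in> borel_measurable lebesgue"
        by (rule measurable_compose[OF that borel_measurable_continuous_onI]) (intro continuous_intros)
      have 2: "(\<lambda>x. snd (X x)) \<in> borel_measurable lebesgue"
        by (rule measurable_compose[OF that borel_measurable_continuous_onI]) (intro continuous_intros)
      show ?thesis
        unfolding A_def
        by (intro borel_measurable_Pair borel_measurable_uminus borel_measurable_scaleR borel_measurable_times
            borel_measurable_add b0m Pm 1 2)
    qed
  qed
  then obtain X where X: "prim_of X (\<lambda>x. A x (X x))" "X r0 = (u0, y0 - \<Phi> r0 * u0)" by blast
  define u where "u x = fst (X x)" for x
  define y where "y x = snd (X x) + \<Phi> x * u x" for x
  have "prim_of u (\<lambda>x. b0 x *\<^sub>R y x)"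
    using prim_of_bounded_linear[OF bounded_linear_fst X(1)] by (rule prim_of_cong) (simp_all add: u_def y_def A_def)
  moreover have "prim_of (\<lambda>x. y x - \<Phi> x * u x) (\<lambda>x. - (b0 x *\<^sub>R (\<Phi> x * y x)))"
    using prim_of_bounded_linear[OF bounded_linear_snd X(1)] by (rule prim_of_cong) (simp_all add: u_def y_def A_def)
  moreover have "u r0 = u0" "y r0 = y0" using X(2) by (simp_all add: u_def y_def)
  ultimately show ?thesis unfolding quasi_sol_def b0_def by blast
qed

text \<open>
  Variation of constants.  A solution \<open>(w, yw)\<close> for other coefficients \<open>d\<close> and \<open>\<Psi>\<close> becomes, after
  replacing \<open>yw\<close> by \<open>yw + \<theta> w\<close>, a solution for \<open>b\<close> and \<open>\<Phi>\<close> up to terms that are small if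
  \<open>d - b\<close> and \<open>\<theta>\<close> are small in \<open>L\<^sub>1\<close>.  The constant \<open>c\<close> is at our disposal because the equation
  depends only on the increments of \<open>\<Psi>\<close>.  For a solution \<open>(u, y)\<close> with \<open>u t = 0\<close> and \<open>y t = 1\<close> the
  Wronskian at \<open>t\<close> is \<open>w t\<close>.
\<close>

lemma wronskian:
  fixes u w :: "real \<Rightarrow> 'k::{real_normed_field, banach, second_countable_topology}"
  assumes q1: "quasi_sol b \<Phi> u y" and q2: "quasi_sol d \<Psi> w yw"
    and th: "\<And>x. \<theta> x = \<Phi> x - \<Psi> x - c" and st: "s \<le> t"
  shows "(w t * y t - (yw t + \<theta> t * w t) * u t) - (w s * y s - (yw s + \<theta> s * w s) * u s) =
    intI lebesgue s t (\<lambda>x. (d x - b x) *\<^sub>R (yw x * y x) - d x *\<^sub>R (\<theta> x * yw x * u x) - b x *\<^sub>R (\<theta> x * w x * y x))"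
proof -
  note a1 = q1[unfolded quasi_sol_def, THEN conjunct1] and a2 = q1[unfolded quasi_sol_def, THEN conjunct2]
    and a3 = q2[unfolded quasi_sol_def, THEN conjunct1] and a4 = q2[unfolded quasi_sol_def, THEN conjunct2]
  note a5 = prim_of_diff[OF a4 prim_of_cmult[OF a3, of c]]
  have "prim_of (\<lambda>x. w x * y x - (yw x + \<theta> x * w x) * u x)
    (\<lambda>x. (d x - b x) *\<^sub>R (yw x * y x) - d x *\<^sub>R (\<theta> x * yw x * u x) - b x *\<^sub>R (\<theta> x * w x * y x))"
    by (rule prim_of_cong[OF prim_of_diff[OF prim_of_mult[OF a3 a2] prim_of_mult[OF a5 a1]]])
       (simp_all add: th scaleR_conv_of_real algebra_simps)
  from prim_ofD(2)[OF this st] show ?thesis .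
qed

text \<open>
  One step of length \<open>h\<close>, in which the measure has mass \<open>m\<close>, in the growth estimate for
  \<open>U' = \<beta> Y\<close>, \<open>dY = U dF\<close>.  The functional \<open>ln U + r / (2 \<omega>)\<close> with \<open>r = \<beta> Y / U\<close> has, by the
  Riccati equation \<open>r' = \<beta> F' - r\<^sup>2\<close>, the derivative \<open>r - r\<^sup>2 / (2 \<omega>) + \<beta> F' / (2 \<omega>)\<close>, which is at most
  \<open>\<omega> / 2 + \<beta> F' / (2 \<omega>)\<close>.  The last summand of the bound is the discretisation error, of
  second order as required by lemma \<open>increment_le\<close>; this form also covers atoms of \<open>F\<close>.
\<close>

lemma growth_step:
  fixes U0 U1 Y0 Y1 h m :: real
  assumes pos: "0 < \<omega>" "0 < \<beta>" "0 < U0" "0 \<le> Y0" "0 \<le> h" "0 \<le> m"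
    and Y: "Y1 \<le> Y0 + m * U1" and U: "U0 + \<beta> * h * Y0 \<le> U1" "U1 \<le> U0 + \<beta> * h * Y1"
    and QR: "U1 \<le> Q * U0" "\<beta> * Y0 \<le> R * U0" 
  shows "(ln U1 + \<beta> * Y1 / (2 * \<omega> * U1)) - (ln U0 + \<beta> * Y0 / (2 * \<omega> * U0))
    \<le> \<omega> / 2 * h + \<beta> * m / (2 * \<omega>) + h * (\<beta> * Q * m + R ^ 3 / (2 * \<omega>) * h)"
proof -
  define q where "q = U1 / U0"
  define r where "r = \<beta> * Y0 / U0"
  have U1: "U1 > 0" using U(1) pos by (smt (verit) mult_nonneg_nonneg)
  have q: "q > 0" "q \<le> Q" using U1 pos QR by (simp_all add: q_def field_simps)
  have r: "0 \<le> r" "r \<le> R" using pos QR by (simp_all add: r_def field_simps)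
  have q1: "1 + h * r \<le> q"
  proof -
    have "1 + h * r = (U0 + \<beta> * h * Y0) / U0" using pos by (simp add: r_def field_simps)
    also have "\<dots> \<le> q" unfolding q_def using U(1) pos by (intro divide_right_mono) auto
    finally show ?thesis .
  qed
  have lnq: "ln U1 - ln U0 \<le> q - 1"
    using ln_le_minus_one[OF q(1)] U1 pos by (simp add: q_def ln_div)
  have "U1 \<le> U0 + \<beta> * h * (Y0 + m * U1)"
    by (rule order_trans[OF U(2) add_left_mono[OF mult_left_mono[OF Y]]]) (use pos in simp)
  then have "q \<le> (U0 + \<beta> * h * (Y0 + m * U1)) / U0" unfolding q_def using pos by (intro divide_right_mono) auto
  also have "\<dots> = 1 + (h * r + h * \<beta> * m * q)"
    using pos by (simp add: q_def r_def add_divide_distrib distrib_left ac_simps)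
  finally have q2: "q - 1 \<le> h * r + h * \<beta> * m * q" by simp
  have q3: "h * \<beta> * m * q \<le> h * \<beta> * m * Q" using pos q by (intro mult_left_mono) auto
  have Yq: "\<beta> * Y1 / U1 \<le> r / q + \<beta> * m"
  proof -
    have "\<beta> * Y1 / U1 \<le> \<beta> * (Y0 + m * U1) / U1" using Y U1 pos by (intro divide_right_mono mult_left_mono) auto
    also have "\<dots> = r / q + \<beta> * m" using U1 pos by (simp add: r_def q_def field_simps)
    finally show ?thesis .
  qed
  have rq: "r / q \<le> r - h * r ^ 2 + h ^ 2 * r ^ 3"
  proof -
    have p: "0 < 1 + h * r" using pos r by (simp add: add_pos_nonneg)
    have "r / q \<le> r / (1 + h * r)" using r q1 p q by (intro divide_left_mono) auto
    also have "\<dots> \<le> r - h * r ^ 2 + h ^ 2 * r ^ 3"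
    proof -
      have "(r - h * r ^ 2 + h ^ 2 * r ^ 3) * (1 + h * r) = r + h ^ 3 * r ^ 4"
        by (simp add: power2_eq_square power3_eq_cube power4_eq_xxxx algebra_simps)
      moreover have "0 \<le> h ^ 3 * r ^ 4" using pos r by simp
      ultimately show ?thesis using p by (simp add: pos_divide_le_eq)
    qed
    finally show ?thesis .
  qed
  have r3: "h ^ 2 * r ^ 3 \<le> h ^ 2 * R ^ 3" using r by (intro mult_left_mono power_mono) auto
  have amgm: "2 * \<omega> * r \<le> r ^ 2 + \<omega> ^ 2" using zero_le_power2[of "r - \<omega>"] by (simp add: power2_diff algebra_simps)
  have "2 * \<omega> * ((ln U1 + \<beta> * Y1 / (2 * \<omega> * U1)) - (ln U0 + \<beta> * Y0 / (2 * \<omega> * U0)))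
    = 2 * \<omega> * (ln U1 - ln U0) + \<beta> * Y1 / U1 - r"
    using pos U1 by (simp add: r_def field_simps)
  also have "\<dots> \<le> 2 * \<omega> * (h * r + h * \<beta> * m * Q) + (r - h * r ^ 2 + h ^ 2 * R ^ 3 + \<beta> * m) - r"
  proof -
    have "ln U1 - ln U0 \<le> h * r + h * \<beta> * m * Q" using lnq q2 q3 by linarith
    then have "2 * \<omega> * (ln U1 - ln U0) \<le> 2 * \<omega> * (h * r + h * \<beta> * m * Q)"
      using pos by (intro mult_left_mono) auto
    then show ?thesis using Yq rq r3 by linarith
  qed
  also have "\<dots> = h * (2 * \<omega> * r - r ^ 2) + \<beta> * m + 2 * \<omega> * (h * \<beta> * m * Q) + h ^ 2 * R ^ 3"
    by (simp add: algebra_simps)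
  also have "\<dots> \<le> h * \<omega> ^ 2 + \<beta> * m + 2 * \<omega> * (h * \<beta> * m * Q) + h ^ 2 * R ^ 3"
    using amgm pos by (intro add_right_mono mult_left_mono) auto
  also have "\<dots> = 2 * \<omega> * (\<omega> / 2 * h + \<beta> * m / (2 * \<omega>) + h * (\<beta> * Q * m + R ^ 3 / (2 * \<omega>) * h))"
    using pos by (simp add: field_simps power2_eq_square)
  finally show ?thesis using pos by simp
qed

lemma growth:
  fixes U Y F :: "real \<Rightarrow> real"
  assumes "a \<le> T" and pos: "0 < \<omega>" "0 < \<beta>" "0 < U a" "0 \<le> Y a"
    and step: "\<And>s t. a \<le> s \<Longrightarrow> s \<le> t \<Longrightarrow> t \<le> T \<Longrightarrow> Y s \<le> Y t \<and> F s \<le> F t \<and> Y t \<le> Y s + (F t - F s) * U t \<and>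
      U s + \<beta> * (t - s) * Y s \<le> U t \<and> U t \<le> U s + \<beta> * (t - s) * Y t"
  shows "U T \<le> U a * exp (\<beta> * Y a / (2 * \<omega> * U a) + \<omega> / 2 * (T - a) + \<beta> * (F T - F a) / (2 * \<omega>))"
proof -
  have Yp: "0 \<le> Y t" if "a \<le> t" "t \<le> T" for t using step[of a t] that pos by auto
  have Um: "U s \<le> U t" if "a \<le> s" "s \<le> t" "t \<le> T" for s t
  proof -
    have "0 \<le> \<beta> * (t - s) * Y s" using that Yp[of s] pos by simp
    then show ?thesis using step[OF that] by linarith
  qed
  have Up: "0 < U t" if "a \<le> t" "t \<le> T" for t using Um[of a t] that pos by auto
  define Q where "Q = U T / U a"
  define R where "R = \<beta> * Y T / U a"
  have R0: "0 \<le> R" using Yp[of T] pos assms(1) by (simp add: R_def)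
  have Q0: "0 \<le> Q" using Up[of T] pos assms(1) by (simp add: Q_def)
  define X where "X t = ln (U t) + \<beta> * Y t / (2 * \<omega> * U t)" for t
  define B where "B t = \<omega> / 2 * t" for t
  define C where "C t = \<beta> * F t / (2 * \<omega>)" for t
  define V where "V t = \<beta> * Q * F t + R ^ 3 / (2 * \<omega>) * t" for t
  have Bd: "B t - B s = \<omega> / 2 * (t - s)" for s t by (simp add: B_def right_diff_distrib)
  have Cd: "C t - C s = \<beta> * (F t - F s) / (2 * \<omega>)" for s t
    by (simp add: C_def right_diff_distrib diff_divide_distrib)
  have Vd: "V t - V s = \<beta> * Q * (F t - F s) + R ^ 3 / (2 * \<omega>) * (t - s)" for s t
    by (simp add: V_def right_diff_distrib)
  have "X T - B T - C T \<le> X a - B a - C a"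
  proof (rule increment_le[OF assms(1), where V = V])
    fix s t assume st: "a \<le> s" "s \<le> t" "t \<le> T"
    note S = step[OF st]
    have "U t \<le> Q * U s"
    proof -
      have "U t \<le> Q * U a" using Um[of t T] st pos by (simp add: Q_def)
      also have "\<dots> \<le> Q * U s" using Um[of a s] st Q0 by (intro mult_left_mono) auto
      finally show ?thesis .
    qed
    moreover have "\<beta> * Y s \<le> R * U s"
    proof -
      have "\<beta> * Y s \<le> R * U a" using step[of s T] st pos by (simp add: R_def)
      also have "\<dots> \<le> R * U s" using Um[of a s] st R0 by (intro mult_left_mono) auto
      finally show ?thesis .
    qed
    moreover have "0 \<le> F t - F s" "Y t \<le> Y s + (F t - F s) * U t" using S by auto
    moreover have "U s + \<beta> * (t - s) * Y s \<le> U t" "U t \<le> U s + \<beta> * (t - s) * Y t" using S by auto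
    moreover have "0 < U s" "0 \<le> Y s" "0 \<le> t - s" using Up[of s] Yp[of s] st by auto
    ultimately have "X t - X s \<le> (B t - B s) + (C t - C s) + (t - s) * (V t - V s)"
      unfolding Bd Cd Vd X_def by (intro growth_step pos(1,2))
    then show "X t - B t - C t - (X s - B s - C s) \<le> (t - s) * (V t - V s)" by linarith
  qed
  moreover have "ln (U T) \<le> X T" using Yp[of T] Up[of T] pos assms(1) by (simp add: X_def)
  ultimately have "ln (U T) \<le> X a + (B T - B a) + (C T - C a)" by linarith
  then have "ln (U T) \<le> ln (U a) + (\<beta> * Y a / (2 * \<omega> * U a) + \<omega> / 2 * (T - a) + \<beta> * (F T - F a) / (2 * \<omega>))"
    unfolding Bd Cd X_def by (simp only: add.assoc)
  then have "exp (ln (U T)) \<le> exp (ln (U a) + (\<beta> * Y a / (2 * \<omega> * U a) + \<omega> / 2 * (T - a) + \<beta> * (F T - F a) / (2 * \<omega>)))"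
    by (simp only: exp_le_cancel_iff)
  then show ?thesis using Up[of T] pos assms(1) by (simp add: exp_add)
qed

text \<open>
  If the mass \<open>F\<close> of an interval of length \<open>l\<close> is at most \<open>\<kappa> (l + 1)\<close>, the two halves of the exponent in
  lemma \<open>growth\<close> add up to at most \<open>\<omega> l\<close> and a constant as soon as \<open>\<beta> * \<kappa> \<le> \<omega>\<^sup>2\<close>.  Here \<open>J\<close> stands for the
  integral of \<open>norm u\<close> with respect to the variation; the majorant \<open>Y\<close> of \<open>norm y\<close> is defined by
  \<open>dY = dJ\<close> from \<open>u\<close> itself, and the majorant \<open>U\<close> of \<open>norm u\<close> by \<open>U' = \<beta> Y\<close>.  The bound of \<open>Y\<close> at \<open>t\<close>
  follows from that of \<open>U\<close> at \<open>t + 1\<close>, since \<open>Y\<close> is increasing.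
\<close>

lemma solution_growth:
  fixes u y :: "real \<Rightarrow> 'k::{real_normed_field, banach, second_countable_topology}" and J F :: "real \<Rightarrow> real"
  assumes pos: "0 < \<omega>" "0 < \<beta>"
    and u: "\<And>s t. a \<le> s \<Longrightarrow> s \<le> t \<Longrightarrow> u t - u s = intI lebesgue s t (\<lambda>x. b x *\<^sub>R y x)" "loc_bdd lebesgue (\<lambda>x. b x *\<^sub>R y x)"
    and b: "\<And>x. \<bar>b x\<bar> \<le> \<beta>"
    and y: "\<And>s t. a \<le> s \<Longrightarrow> s \<le> t \<Longrightarrow> norm (y t - y s) \<le> J t - J s"
    and J: "\<And>s t S. a \<le> s \<Longrightarrow> s \<le> t \<Longrightarrow> (\<And>x. s < x \<Longrightarrow> x \<le> t \<Longrightarrow> norm (u x) \<le> S) \<Longrightarrow> J t - J s \<le> S * (F t - F s)"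
    and F: "\<And>s t. a \<le> s \<Longrightarrow> s \<le> t \<Longrightarrow> 0 \<le> F t - F s \<and> F t - F s \<le> \<kappa> * (t - s + 1)"
    and \<kappa>: "\<beta> * \<kappa> \<le> \<omega>\<^sup>2" and init: "norm (u a) \<le> m" "norm (y a) \<le> m" and t: "a \<le> t"
  shows "norm (u t) \<le> m * (exp (\<beta> / (2 * \<omega>) + \<omega> / 2) * exp (\<omega> * (t - a)))"
    and "norm (y t) \<le> m * (exp (\<beta> / (2 * \<omega>) + \<omega> / 2) * exp \<omega> / \<beta> * exp (\<omega> * (t - a)))"
proof -
  define c where "c = \<beta> / (2 * \<omega>) + \<omega> / 2"
  \<comment> \<open>The logarithm needs positive initial values, so \<open>m\<close> is approximated from above.\<close>
  have main: "norm (u t) \<le> m' * (exp c * exp (\<omega> * (t - a)))" "norm (y t) \<le> m' * (exp c * exp \<omega> / \<beta> * exp (\<omega> * (t - a)))"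
    if m': "m \<le> m'" "0 < m'" and t: "a \<le> t" for m' t
  proof -
    define Y where "Y t = m' + (J (max a t) - J a)" for t
    have Yt: "Y t = m' + (J t - J a)" if "a \<le> t" for t using that by (simp add: Y_def)
    have Jm: "J s \<le> J t" if "a \<le> s" "s \<le> t" for s t using y[OF that] norm_ge_zero[of "y t - y s"] by linarith
    have Ymono: "mono Y" by (rule monoI) (auto simp: Y_def intro!: Jm)
    have lY: "loc_bdd lebesgue Y"
      unfolding loc_bdd_def
    proof (intro conjI allI)
      show "Y \<in> borel_measurable lebesgue"
        by (rule locfin_measurable[OF locfin_lebesgue borel_measurable_mono[OF Ymono]])
      fix s t
      show "\<exists>B. \<forall>x\<in>{s..t}. norm (Y x) \<le> B"
        by (intro exI[of _ "\<bar>Y s\<bar> + \<bar>Y t\<bar>"] ballI) 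
           (use monoD[OF Ymono] in \<open>fastforce simp: abs_if\<close>)
    qed
    define U where "U t = m' + \<beta> * (indef_int Y t - indef_int Y a)" for t
    have Ud: "U t - U s = \<beta> * intI lebesgue s t Y" if "s \<le> t" for s t
      using prim_ofD(2)[OF prim_of_indef_int[OF lY] that] by (simp add: U_def algebra_simps)
    have Yle: "norm (y t) \<le> Y t" if "a \<le> t" for t
      using y[of a t] that init m' norm_triangle_sub[of "y t" "y a"] by (simp add: Yt)
    have Ule: "norm (u t) \<le> U t" if "a \<le> t" for t
    proof -
      have "norm (u t - u a) \<le> intI lebesgue a t (\<lambda>x. \<beta> *\<^sub>R Y x)"
        unfolding u(1)[OF order_refl that]
      proof (rule intI_norm_le[OF locfin_lebesgue u(2)])
        fix x assume "a < x" "x \<le> t"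
        then show "norm (b x *\<^sub>R y x) \<le> \<beta> *\<^sub>R Y x"
          using b[of x] Yle[of x] pos by (simp add: mult_mono)
      qed (intro loc_bdd_intros lY)
      also have "\<dots> = U t - U a" using Ud[OF that] by simp
      finally show ?thesis using init m' norm_triangle_sub[of "u t" "u a"] by (simp add: U_def)
    qed
    have Ub: "U s + \<beta> * (t - s) * Y s \<le> U t" "U t \<le> U s + \<beta> * (t - s) * Y t" if "a \<le> s" "s \<le> t" for s t
    proof -
      have "intI lebesgue s t (\<lambda>x. Y s) \<le> intI lebesgue s t Y"
        by (rule intI_mono[OF locfin_lebesgue loc_bdd_const lY]) (auto intro: monoD[OF Ymono])
      moreover have "intI lebesgue s t Y \<le> intI lebesgue s t (\<lambda>x. Y t)"
        by (rule intI_mono[OF locfin_lebesgue lY loc_bdd_const]) (auto intro: monoD[OF Ymono])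
      ultimately have "(t - s) * Y s \<le> intI lebesgue s t Y" "intI lebesgue s t Y \<le> (t - s) * Y t"
        unfolding intI_const[OF locfin_lebesgue] measure_lebesgue_Ioc[OF that(2)] by simp_all
      then have "\<beta> * ((t - s) * Y s) \<le> \<beta> * intI lebesgue s t Y" "\<beta> * intI lebesgue s t Y \<le> \<beta> * ((t - s) * Y t)"
        using pos by (auto intro!: mult_left_mono)
      then show "U s + \<beta> * (t - s) * Y s \<le> U t" "U t \<le> U s + \<beta> * (t - s) * Y t"
        using Ud[OF that(2)] by (auto simp: mult.assoc)
    qed
    have Ya: "Y a = m'" and Ua: "U a = m'" by (simp_all add: Y_def U_def)
    have U: "U T \<le> m' * (exp c * exp (\<omega> * (T - a)))" if T: "a \<le> T" for T
    proof -
      have "U T \<le> U a * exp (\<beta> * Y a / (2 * \<omega> * U a) + \<omega> / 2 * (T - a) + \<beta> * (F T - F a) / (2 * \<omega>))"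
      proof (rule growth[OF T pos])
        show "0 < U a" "0 \<le> Y a" using m' by (auto simp: Ya Ua)
        fix s t assume st: "a \<le> s" "s \<le> t" "t \<le> T"
        have Yp: "0 \<le> Y x" if "a \<le> x" for x using Yle[OF that] norm_ge_zero[of "y x"] by linarith
        have mU: "U x \<le> U t" if "s \<le> x" "x \<le> t" for x
        proof -
          have "0 \<le> \<beta> * (t - x) * Y x" using that pos st Yp[of x] by simp
          then show ?thesis using Ub(1)[of x t] that st by linarith
        qed
        have "J t - J s \<le> U t * (F t - F s)"
        proof (rule J[OF st(1,2)])
          fix x assume "s < x" "x \<le> t"
          then show "norm (u x) \<le> U t" using Ule[of x] mU[of x] st by simp
        qed
        then show "Y s \<le> Y t \<and> F s \<le> F t \<and> Y t \<le> Y s + (F t - F s) * U t \<and>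
          U s + \<beta> * (t - s) * Y s \<le> U t \<and> U t \<le> U s + \<beta> * (t - s) * Y t"
          using Ub[OF st(1,2)] monoD[OF Ymono st(2)] F[OF st(1,2)] st by (auto simp: Yt mult.commute)
      qed
      also have "\<dots> \<le> m' * exp (c + \<omega> * (T - a))"
      proof -
        have "\<beta> * (F T - F a) \<le> \<beta> * (\<kappa> * (T - a + 1))" using F[OF order_refl T] pos by (intro mult_left_mono) auto
        also have "\<dots> \<le> \<omega>\<^sup>2 * (T - a + 1)" using \<kappa> T by (simp add: mult.assoc[symmetric] mult_right_mono)
        finally have "\<beta> * (F T - F a) / (2 * \<omega>) \<le> \<omega>\<^sup>2 * (T - a + 1) / (2 * \<omega>)"
          using pos by (intro divide_right_mono) auto
        also have "\<dots> = \<omega> / 2 * (T - a) + \<omega> / 2" using pos by (simp add: field_simps power2_eq_square)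
        finally have 1: "\<beta> * (F T - F a) / (2 * \<omega>) \<le> \<omega> / 2 * (T - a) + \<omega> / 2" .
        define A where "A = \<omega> / 2 * (T - a)"
        have 2: "\<omega> * (T - a) = A + A" by (simp add: A_def)
        have 3: "\<beta> * Y a / (2 * \<omega> * U a) = \<beta> / (2 * \<omega>)" using m' by (simp add: Ya Ua)
        have "\<beta> * Y a / (2 * \<omega> * U a) + \<omega> / 2 * (T - a) + \<beta> * (F T - F a) / (2 * \<omega>) \<le> c + \<omega> * (T - a)"
          using 1 unfolding 2 3 c_def A_def[symmetric] by linarith
        then show ?thesis using m' by (simp add: Ua)
      qed
      finally show ?thesis by (simp add: exp_add)
    qed
    show "norm (u t) \<le> m' * (exp c * exp (\<omega> * (t - a)))" using Ule[OF t] U[OF t] by linarith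
    have "0 \<le> U t" using Ule[OF t] norm_ge_zero[of "u t"] by linarith
    then have "\<beta> * Y t \<le> U (t + 1)" using Ub(1)[of t "t + 1"] t by simp
    also have "\<dots> \<le> m' * (exp c * exp (\<omega> * (t + 1 - a)))" by (rule U) (use t in simp)
    also have "\<dots> = m' * (exp c * exp \<omega> * exp (\<omega> * (t - a)))" by (simp add: algebra_simps flip: exp_add)
    finally have "Y t \<le> m' * (exp c * exp \<omega> / \<beta> * exp (\<omega> * (t - a)))" using pos by (simp add: field_simps)
    then show "norm (y t) \<le> m' * (exp c * exp \<omega> / \<beta> * exp (\<omega> * (t - a)))" using Yle[OF t] by linarith
  qed
  have lim: "x \<le> m * C" if "\<And>m'. m \<le> m' \<Longrightarrow> 0 < m' \<Longrightarrow> x \<le> m' * C" "0 < C" for x C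
  proof (rule field_le_epsilon)
    fix e :: real assume e: "0 < e"
    have "0 \<le> m" using init norm_ge_zero order_trans by blast
    then have "x \<le> (m + e / C) * C" using e that(2) by (intro that(1)) (auto intro: add_nonneg_pos)
    moreover have "(m + e / C) * C = m * C + e" using that(2) by (simp add: distrib_right)
    ultimately show "x \<le> m * C + e" by simp
  qed
  show "norm (u t) \<le> m * (exp (\<beta> / (2 * \<omega>) + \<omega> / 2) * exp (\<omega> * (t - a)))"
    using main(1)[OF _ _ t] unfolding c_def by (rule lim) simp_all
  show "norm (y t) \<le> m * (exp (\<beta> / (2 * \<omega>) + \<omega> / 2) * exp \<omega> / \<beta> * exp (\<omega> * (t - a)))"
    using main(2)[OF _ _ t] unfolding c_def by (rule lim) (simp_all add: pos)
qed

section \<open>Integration by parts for a local measure\<close>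

lemma locfin_pos_part: "loc_finite \<mu> \<Longrightarrow> locfin (pos_part_measure \<mu>)"
  unfolding locfin_def using loc_finite_finite(2)[of \<mu>] by (auto simp: emeasure_pos_part loc_finiteD)

lemma locfin_neg_part: "loc_finite \<mu> \<Longrightarrow> locfin (neg_part_measure \<mu>)"
  unfolding locfin_def using loc_finite_finite(3)[of \<mu>] by (auto simp: emeasure_neg_part loc_finiteD)

lemma locfin_variation: "loc_finite \<mu> \<Longrightarrow> locfin (variation_measure \<mu>)"
  unfolding locfin_def using loc_finiteD(2)[of \<mu>] by (auto simp: emeasure_variation_measure loc_finiteD)

lemma loc_finite_variation_eq:
  assumes "loc_finite \<mu>"
  shows "variation \<mu> {s<..t} = ennreal (measure (pos_part_measure \<mu>) {s<..t} + measure (neg_part_measure \<mu>) {s<..t})"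
proof -
  have lm: "local_measure \<mu>" using assms by (rule loc_finiteD)
  have "pos_set \<mu> {s<..t} = ennreal (measure (pos_part_measure \<mu>) {s<..t})"
    using locfin_emeasure[OF locfin_pos_part[OF assms], of s t]
    by (simp add: emeasure_pos_part[OF lm, symmetric] emeasure_eq_ennreal_measure less_top)
  moreover have "pos_set (\<lambda>B. - \<mu> B) {s<..t} = ennreal (measure (neg_part_measure \<mu>) {s<..t})"
    using locfin_emeasure[OF locfin_neg_part[OF assms], of s t]
    by (simp add: emeasure_neg_part[OF lm, symmetric] emeasure_eq_ennreal_measure less_top)
  ultimately show ?thesis by (simp add: variation_eq_pos_add_neg[OF lm])
qed

text \<open>
  The distribution function normalised to vanish at \<open>0\<close>; one of the two intervals is empty.
\<close>

definition dist_fun :: "(real set \<Rightarrow> real) \<Rightarrow> real \<Rightarrow> real" where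
  "dist_fun \<mu> t = \<mu> {0<..t} - \<mu> {t<..0}"

lemma loc_finite_Ioc_add:
  assumes "loc_finite \<mu>" "s \<le> r" "r \<le> t"
  shows "\<mu> {s<..t} = \<mu> {s<..r} + \<mu> {r<..t}"
proof -
  have "{s<..t} = {s<..r} \<union> {r<..t}" using assms by auto
  moreover have "\<mu> ({s<..r} \<union> {r<..t}) = \<mu> {s<..r} + \<mu> {r<..t}"
    by (rule local_measure_Un[OF loc_finiteD(1)[OF assms(1)]]) auto
  ultimately show ?thesis by simp
qed

lemma dist_fun_diff:
  assumes "loc_finite \<mu>" "s \<le> t" shows "dist_fun \<mu> t - dist_fun \<mu> s = \<mu> {s<..t}"
proof -
  have e: "\<mu> {a<..b} = 0" if "b \<le> a" for a b using that local_measure_empty[OF loc_finiteD(1)[OF assms(1)]] by simp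
  note c = loc_finite_Ioc_add[OF assms(1)]
  consider "0 \<le> s" | "s < 0" "0 \<le> t" | "t < 0" by linarith
  then show ?thesis
  proof cases
    case 1 then show ?thesis using c[of 0 s t] assms e[of 0 s] e[of 0 t] by (simp add: dist_fun_def)
  next
    case 2 then show ?thesis using c[of s 0 t] e[of s 0] e[of 0 t] by (simp add: dist_fun_def)
  next
    case 3 then show ?thesis using c[of s t 0] assms e[of t 0] e[of s 0] by (simp add: dist_fun_def)
  qed
qed

lemma loc_bdd_dist_fun:
  assumes "loc_finite \<mu>" "locfin N" shows "loc_bdd N (dist_fun \<mu>)"
proof -
  have m: "loc_bdd N (\<lambda>t. measure M {t<..0})" if M: "locfin M" for M
    unfolding loc_bdd_def
  proof (intro conjI allI)
    have "mono (\<lambda>t. - measure M {t<..0})" using measure_Ioc_mono[OF M] by (auto intro!: monoI)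
    from borel_measurable_mono[OF this] have "(\<lambda>t. - (- measure M {t<..0})) \<in> borel_measurable borel"
      by (rule borel_measurable_uminus)
    then show "(\<lambda>t. measure M {t<..0}) \<in> borel_measurable N"
      using locfin_measurable[OF assms(2)] by simp
    fix s t
    show "\<exists>B. \<forall>x\<in>{s..t}. norm (measure M {x<..0}) \<le> B"
      by (intro exI[of _ "measure M {s<..0}"]) (auto intro!: measure_Ioc_mono M)
  qed
  note p = locfin_pos_part[OF assms(1)] and n = locfin_neg_part[OF assms(1)]
  let ?p = "pos_part_measure \<mu>" and ?n = "neg_part_measure \<mu>"
  have "loc_bdd N (\<lambda>t. (measure ?p {0<..t} - measure ?n {0<..t}) - (measure ?p {t<..0} - measure ?n {t<..0}))"
    by (intro loc_bdd_diff loc_bdd_measure_Ioc p n assms(2) m)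
  moreover have "(\<lambda>t. (measure ?p {0<..t} - measure ?n {0<..t}) - (measure ?p {t<..0} - measure ?n {t<..0})) = dist_fun \<mu>"
    by (simp add: fun_eq_iff dist_fun_def loc_finite_eq_diff[OF assms(1)])
  ultimately show ?thesis by simp
qed

text \<open>
  On indefinite integrals, integration against \<open>\<mu>\<close> depends only on the distribution function.
  Linearity in \<open>\<mu>\<close> and compatibility with translations are obvious from this formula, although the
  parts of the Jordan decomposition do not depend linearly on \<open>\<mu>\<close>.
\<close>

lemma integral_lm_by_parts:
  fixes w :: "real \<Rightarrow> 'k::{real_normed_field, banach, second_countable_topology}"
  assumes mu: "loc_finite \<mu>" and w: "prim_of w F" and st: "s \<le> t"
  shows "integral_lm \<mu> {s<..t} w =
    (dist_fun \<mu> t *\<^sub>R w t - dist_fun \<mu> s *\<^sub>R w s) - intI lebesgue s t (\<lambda>x. dist_fun \<mu> x *\<^sub>R F x)"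
proof -
  let ?p = "pos_part_measure \<mu>" and ?n = "neg_part_measure \<mu>"
  note p = locfin_pos_part[OF mu] and n = locfin_neg_part[OF mu]
  note lF = prim_ofD(1)[OF w]
  have lp: "loc_bdd lebesgue (\<lambda>x. measure ?p {s<..x} *\<^sub>R F x)" "loc_bdd lebesgue (\<lambda>x. measure ?n {s<..x} *\<^sub>R F x)"
    by (intro loc_bdd_scaleR lF loc_bdd_measure_Ioc p n locfin_lebesgue)+
  have lc: "loc_bdd lebesgue (\<lambda>x. dist_fun \<mu> x *\<^sub>R F x)" by (intro loc_bdd_scaleR lF loc_bdd_dist_fun mu locfin_lebesgue)
  have "integral_lm \<mu> {s<..t} w = \<mu> {s<..t} *\<^sub>R w t -
    (intI lebesgue s t (\<lambda>x. measure ?p {s<..x} *\<^sub>R F x) - intI lebesgue s t (\<lambda>x. measure ?n {s<..x} *\<^sub>R F x))"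
    unfolding integral_lm_def integral_by_parts_measure[OF p w st] integral_by_parts_measure[OF n w st]
    by (simp add: loc_finite_eq_diff[OF mu] scaleR_diff_left)
  also have "intI lebesgue s t (\<lambda>x. measure ?p {s<..x} *\<^sub>R F x) - intI lebesgue s t (\<lambda>x. measure ?n {s<..x} *\<^sub>R F x)
    = intI lebesgue s t (\<lambda>x. measure ?p {s<..x} *\<^sub>R F x - measure ?n {s<..x} *\<^sub>R F x)"
    by (rule intI_diff[OF locfin_lebesgue lp, symmetric])
  also have "\<dots> = intI lebesgue s t (\<lambda>x. dist_fun \<mu> x *\<^sub>R F x - dist_fun \<mu> s *\<^sub>R F x)"
  proof (rule intI_cong)
    fix x assume "s < x" "x \<le> t"
    then have "dist_fun \<mu> x - dist_fun \<mu> s = measure ?p {s<..x} - measure ?n {s<..x}"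
      using dist_fun_diff[OF mu, of s x] by (simp add: loc_finite_eq_diff[OF mu])
    then show "measure ?p {s<..x} *\<^sub>R F x - measure ?n {s<..x} *\<^sub>R F x = dist_fun \<mu> x *\<^sub>R F x - dist_fun \<mu> s *\<^sub>R F x"
      by (simp flip: scaleR_diff_left)
  qed
  also have "\<dots> = intI lebesgue s t (\<lambda>x. dist_fun \<mu> x *\<^sub>R F x) - intI lebesgue s t (\<lambda>x. dist_fun \<mu> s *\<^sub>R F x)"
    by (rule intI_diff[OF locfin_lebesgue lc]) (intro loc_bdd_scaleR lF loc_bdd_const)
  also have "intI lebesgue s t (\<lambda>x. dist_fun \<mu> s *\<^sub>R F x) = dist_fun \<mu> s *\<^sub>R (w t - w s)"
    using prim_ofD(2)[OF w st] by simp
  also have "\<mu> {s<..t} = dist_fun \<mu> t - dist_fun \<mu> s" using dist_fun_diff[OF mu st] by simp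
  finally show ?thesis by (simp add: algebra_simps)
qed

section \<open>The Sturm--Liouville equation\<close>

text \<open>
  The equation \<open>u' = b y\<close>, \<open>dy = u d\<nu>\<close> with \<open>\<nu> = \<mu> - z \<rho>\<close>; \<open>k1\<close> and \<open>k2\<close> bound the uniform norms of
  \<open>\<mu>\<close> and \<open>\<rho>\<close>, so that \<open>\<kappa>\<close> bounds the mass of \<open>\<bar>\<mu>\<bar> + \<bar>z\<bar> \<bar>\<rho>\<bar>\<close> on unit intervals.
\<close>

locale sl_equation =
  fixes \<mu> \<rho> :: "real set \<Rightarrow> real" and z :: "'k::{real_normed_field, banach, second_countable_topology}"
    and b :: "real \<Rightarrow> real" and \<beta> k1 k2 :: real
  assumes mu: "loc_finite \<mu>" and rho: "loc_finite \<rho>"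
    and b_meas: "b \<in> borel_measurable lebesgue" and b_nonneg: "\<And>x. 0 \<le> b x" and b_le: "\<And>x. b x \<le> \<beta>"
    and beta: "0 < \<beta>"
    and k1: "0 \<le> k1" "\<And>t. variation \<mu> {t<..t + 1} \<le> ennreal k1"
    and k2: "0 \<le> k2" "\<And>t. variation \<rho> {t<..t + 1} \<le> ennreal k2"
begin

definition "\<kappa> = k1 + norm z * k2"

definition \<Phi> :: "real \<Rightarrow> 'k" where "\<Phi> x = of_real (dist_fun \<mu> x) - z * of_real (dist_fun \<rho> x)"

definition nu_int :: "real \<Rightarrow> real \<Rightarrow> (real \<Rightarrow> 'k) \<Rightarrow> 'k" where
  "nu_int s t u = integral_lm \<mu> {s<..t} u - z * integral_lm \<rho> {s<..t} u"

abbreviation "mp \<equiv> pos_part_measure \<mu>"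
abbreviation "mn \<equiv> neg_part_measure \<mu>"
abbreviation "rp \<equiv> pos_part_measure \<rho>"
abbreviation "rn \<equiv> neg_part_measure \<rho>"

lemmas lf = locfin_pos_part[OF mu] locfin_neg_part[OF mu] locfin_pos_part[OF rho] locfin_neg_part[OF rho]

definition mass :: "real \<Rightarrow> real \<Rightarrow> real" where
  "mass s t = measure mp {s<..t} + measure mn {s<..t} + norm z * (measure rp {s<..t} + measure rn {s<..t})"

definition abs_int :: "(real \<Rightarrow> 'k) \<Rightarrow> real \<Rightarrow> real \<Rightarrow> real" where
  "abs_int u s t = intI mp s t (\<lambda>x. norm (u x)) + intI mn s t (\<lambda>x. norm (u x))
     + norm z * (intI rp s t (\<lambda>x. norm (u x)) + intI rn s t (\<lambda>x. norm (u x)))"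

lemma loc_bdd_b: "loc_bdd lebesgue b"
  unfolding loc_bdd_def using b_meas b_nonneg b_le by (auto intro!: exI[of _ \<beta>])

lemma loc_bdd_Phi: "loc_bdd lebesgue \<Phi>"
  unfolding \<Phi>_def by (intro loc_bdd_intros loc_bdd_dist_fun mu rho locfin_lebesgue)

lemma nu_int_by_parts:
  assumes u: "prim_of u U" and st: "s \<le> t"
  shows "nu_int s t u = (\<Phi> t * u t - \<Phi> s * u s) - intI lebesgue s t (\<lambda>x. \<Phi> x * U x)"
proof -
  note lU = prim_ofD(1)[OF u]
  have l: "loc_bdd lebesgue (\<lambda>x. dist_fun \<mu> x *\<^sub>R U x)" "loc_bdd lebesgue (\<lambda>x. dist_fun \<rho> x *\<^sub>R U x)"
    by (intro loc_bdd_scaleR lU loc_bdd_dist_fun mu rho locfin_lebesgue)+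
  have "intI lebesgue s t (\<lambda>x. \<Phi> x * U x) = intI lebesgue s t (\<lambda>x. dist_fun \<mu> x *\<^sub>R U x - z * (dist_fun \<rho> x *\<^sub>R U x))"
    by (rule intI_cong) (simp add: \<Phi>_def scaleR_conv_of_real algebra_simps)
  also have "\<dots> = intI lebesgue s t (\<lambda>x. dist_fun \<mu> x *\<^sub>R U x) - z * intI lebesgue s t (\<lambda>x. dist_fun \<rho> x *\<^sub>R U x)"
  proof -
    have "intI lebesgue s t (\<lambda>x. z * (dist_fun \<rho> x *\<^sub>R U x)) = z * intI lebesgue s t (\<lambda>x. dist_fun \<rho> x *\<^sub>R U x)"
      by (rule set_integral_mult_right)
    then show ?thesis
      using intI_diff[OF locfin_lebesgue l(1) loc_bdd_mult[OF loc_bdd_const[of _ z] l(2)], of s t] by simp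
  qed
  finally show ?thesis
    unfolding nu_int_def integral_lm_by_parts[OF mu u st] integral_lm_by_parts[OF rho u st]
    by (simp add: \<Phi>_def scaleR_conv_of_real algebra_simps)
qed

lemma mass_nonneg: "0 \<le> mass s t"
  by (simp add: mass_def)

lemma mass_add: "s \<le> r \<Longrightarrow> r \<le> t \<Longrightarrow> mass s t = mass s r + mass r t"
  unfolding mass_def using lf[THEN measure_Ioc_add, of s r t] by (simp add: algebra_simps)

lemma mass_unit: "mass t (t + 1) \<le> \<kappa>"
proof -
  have "measure mp {t<..t+1} + measure mn {t<..t+1} \<le> k1"
    using k1 loc_finite_variation_eq[OF mu, of t "t+1"] by (metis ennreal_le_iff)
  moreover have "measure rp {t<..t+1} + measure rn {t<..t+1} \<le> k2"
    using k2 loc_finite_variation_eq[OF rho, of t "t+1"] by (metis ennreal_le_iff)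
  ultimately show ?thesis unfolding mass_def \<kappa>_def by (intro add_mono mult_left_mono) auto
qed

lemma kappa_nonneg: "0 \<le> \<kappa>"
  using k1 k2 by (simp add: \<kappa>_def)

lemma mass_le: assumes "s \<le> t" shows "mass s t \<le> \<kappa> * (t - s + 1)"
proof -
  have n: "mass s (s + real n) \<le> \<kappa> * real n" for n
  proof (induction n)
    case 0 show ?case by (simp add: mass_def)
  next
    case (Suc n)
    have "mass s (s + real (Suc n)) = mass s (s + real n) + mass (s + real n) (s + real n + 1)"
      using mass_add[of s "s + real n" "s + real n + 1"] by (simp add: add_ac)
    then show ?case using Suc mass_unit[of "s + real n"] by (simp add: algebra_simps)
  qed
  define n where "n = nat \<lceil>t - s\<rceil>"
  have "t - s \<le> real n" unfolding n_def by (rule real_nat_ceiling_ge)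
  moreover have "real n = of_int \<lceil>t - s\<rceil>" using assms by (simp add: n_def)
  ultimately have n1: "t \<le> s + real n" "real n \<le> t - s + 1"
    using of_int_ceiling_le_add_one[of "t - s"] by linarith+
  have "mass s t \<le> mass s (s + real n)" using mass_add[of s t "s + real n"] mass_nonneg[of t "s + real n"] assms n1 by simp
  also have "\<dots> \<le> \<kappa> * real n" by (rule n)
  also have "\<dots> \<le> \<kappa> * (t - s + 1)" using n1 kappa_nonneg by (intro mult_left_mono)
  finally show ?thesis .
qed

lemma abs_int_add:
  assumes "continuous_on UNIV u" "s \<le> r" "r \<le> t"
  shows "abs_int u s r + abs_int u r t = abs_int u s t"
proof -
  have l: "loc_bdd M (\<lambda>x. norm (u x))" if "locfin M" for M by (intro loc_bdd_norm loc_bdd_continuous that assms)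
  note c = intI_combine[OF _ l, symmetric]
  show ?thesis unfolding abs_int_def
    unfolding c[OF lf(1) lf(1) assms(2,3)] c[OF lf(2) lf(2) assms(2,3)] c[OF lf(3) lf(3) assms(2,3)] c[OF lf(4) lf(4) assms(2,3)]
    by (simp add: algebra_simps)
qed

lemma abs_int_le:
  assumes "continuous_on UNIV u" "\<And>x. s < x \<Longrightarrow> x \<le> t \<Longrightarrow> norm (u x) \<le> S"
  shows "abs_int u s t \<le> S * mass s t"
proof -
  have b: "intI M s t (\<lambda>x. norm (u x)) \<le> S * measure M {s<..t}" if "locfin M" for M
    using intI_bound[OF that loc_bdd_norm[OF loc_bdd_continuous[OF that assms(1)]], of s t S] assms(2) by simp
  have "abs_int u s t \<le> S * measure mp {s<..t} + S * measure mn {s<..t} + norm z * (S * measure rp {s<..t} + S * measure rn {s<..t})"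
    unfolding abs_int_def by (intro add_mono mult_left_mono b lf) auto
  then show ?thesis by (simp add: mass_def algebra_simps)
qed

lemma nu_int_le_abs_int:
  assumes "continuous_on UNIV u"
  shows "norm (nu_int s t u) \<le> abs_int u s t"
proof -
  have b: "norm (intI M s t u) \<le> intI M s t (\<lambda>x. norm (u x))" if "locfin M" for M
    by (rule intI_norm_le) (auto intro!: that loc_bdd_norm loc_bdd_continuous assms)
  have "norm (nu_int s t u) \<le> norm (integral_lm \<mu> {s<..t} u) + norm z * norm (integral_lm \<rho> {s<..t} u)"
    unfolding nu_int_def by (metis norm_mult norm_triangle_ineq4)
  also have "\<dots> \<le> (norm (intI mp s t u) + norm (intI mn s t u)) + norm z * (norm (intI rp s t u) + norm (intI rn s t u))"
    unfolding integral_lm_def by (intro add_mono mult_left_mono norm_triangle_ineq4) auto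
  also have "\<dots> \<le> abs_int u s t"
    unfolding abs_int_def by (intro add_mono mult_left_mono b lf) auto
  finally show ?thesis .
qed

text \<open>
  For the distribution function \<open>\<Phi>\<close> of \<open>\<nu>\<close>, integration by parts leads back to \<open>dy = u d\<nu>\<close>.
\<close>

lemma quasi_sol_nu_int:
  assumes q: "quasi_sol b1 \<Phi> u y" and st: "s \<le> t"
  shows "y t - y s = nu_int s t u"
proof -
  have a: "prim_of u (\<lambda>x. b1 x *\<^sub>R y x)" and a': "prim_of (\<lambda>x. y x - \<Phi> x * u x) (\<lambda>x. - (b1 x *\<^sub>R (\<Phi> x * y x)))"
    using q by (auto simp: quasi_sol_def)
  have "(y t - \<Phi> t * u t) - (y s - \<Phi> s * u s) = - intI lebesgue s t (\<lambda>x. b1 x *\<^sub>R (\<Phi> x * y x))"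
    using prim_ofD(2)[OF a' st] intI_uminus by metis
  moreover have "intI lebesgue s t (\<lambda>x. b1 x *\<^sub>R (\<Phi> x * y x)) = intI lebesgue s t (\<lambda>x. \<Phi> x * (b1 x *\<^sub>R y x))"
    by (rule intI_cong) simp
  ultimately show ?thesis unfolding nu_int_by_parts[OF a st] by (simp add: algebra_simps)
qed

lemma qsolI:
  assumes a: "prim_of u (\<lambda>x. b x *\<^sub>R y x)" and y: "\<And>s t. s \<le> t \<Longrightarrow> y t - y s = nu_int s t u"
  shows "quasi_sol b \<Phi> u y"
  unfolding quasi_sol_def
proof (intro conjI a)
  have l: "loc_bdd lebesgue (\<lambda>x. \<Phi> x * (b x *\<^sub>R y x))" by (intro loc_bdd_mult loc_bdd_Phi prim_ofD(1)[OF a])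
  have "prim_of (\<lambda>x. y x - \<Phi> x * u x) (\<lambda>x. - (\<Phi> x * (b x *\<^sub>R y x)))"
    unfolding prim_of_def
  proof (intro conjI allI impI loc_bdd_uminus l)
    fix s t :: real assume st: "s \<le> t"
    show "y t - \<Phi> t * u t - (y s - \<Phi> s * u s) = intI lebesgue s t (\<lambda>x. - (\<Phi> x * (b x *\<^sub>R y x)))"
      using y[OF st] unfolding nu_int_by_parts[OF a st] intI_uminus by (simp add: algebra_simps)
  qed
  then show "prim_of (\<lambda>x. y x - \<Phi> x * u x) (\<lambda>x. - (b x *\<^sub>R (\<Phi> x * y x)))" by simp
qed

definition growth_const :: "real \<Rightarrow> real" where
  "growth_const \<omega> = exp (\<beta> / (2 * \<omega>) + \<omega> / 2) * max 1 (exp \<omega> / \<beta>)"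

lemma growth_const_pos: "0 < growth_const \<omega>" unfolding growth_const_def by (intro mult_pos_pos) auto

lemma quasi_sol_growth:
  assumes q: "quasi_sol b1 \<Phi> u y" and b1: "\<And>x. \<bar>b1 x\<bar> \<le> \<beta>" and om: "0 < \<omega>" "\<beta> * \<kappa> \<le> \<omega>\<^sup>2"
    and init: "norm (u a) \<le> m" "norm (y a) \<le> m" and t: "a \<le> t"
  shows "norm (u t) \<le> m * (growth_const \<omega> * exp (\<omega> * (t - a)))" "norm (y t) \<le> m * (growth_const \<omega> * exp (\<omega> * (t - a)))"
proof -
  have au: "prim_of u (\<lambda>x. b1 x *\<^sub>R y x)" using q by (simp add: quasi_sol_def)
  have cu: "continuous_on UNIV u" by (rule prim_of_continuous[OF au])
  define J where "J t = abs_int u a t" for t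
  define F where "F t = mass a t" for t
  have Jd: "J t - J s = abs_int u s t" if "a \<le> s" "s \<le> t" for s t using abs_int_add[OF cu that] by (simp add: J_def)
  have Fd: "F t - F s = mass s t" if "a \<le> s" "s \<le> t" for s t using mass_add[OF that] by (simp add: F_def)
  have *: "norm (u t) \<le> m * (exp (\<beta> / (2 * \<omega>) + \<omega> / 2) * exp (\<omega> * (t - a)))"
    "norm (y t) \<le> m * (exp (\<beta> / (2 * \<omega>) + \<omega> / 2) * exp \<omega> / \<beta> * exp (\<omega> * (t - a)))"
  proof -
    have 1: "u t - u s = intI lebesgue s t (\<lambda>x. b1 x *\<^sub>R y x)" if "a \<le> s" "s \<le> t" for s t by (rule prim_ofD(2)[OF au that(2)])
    have 2: "norm (y t - y s) \<le> J t - J s" if "a \<le> s" "s \<le> t" for s t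
      unfolding Jd[OF that] quasi_sol_nu_int[OF q that(2)] by (rule nu_int_le_abs_int[OF cu])
    have 3: "J t - J s \<le> S * (F t - F s)" if "a \<le> s" "s \<le> t" "\<And>x. s < x \<Longrightarrow> x \<le> t \<Longrightarrow> norm (u x) \<le> S" for s t S
      unfolding Jd[OF that(1,2)] Fd[OF that(1,2)] by (rule abs_int_le[OF cu that(3)])
    have 4: "0 \<le> F t - F s \<and> F t - F s \<le> \<kappa> * (t - s + 1)" if "a \<le> s" "s \<le> t" for s t
      unfolding Fd[OF that(1,2)] using mass_nonneg mass_le[OF that(2)] by simp
    note sg = solution_growth[OF om(1) beta 1 prim_ofD(1)[OF au] b1 2 3 4 om(2) init t]
    show "norm (u t) \<le> m * (exp (\<beta> / (2 * \<omega>) + \<omega> / 2) * exp (\<omega> * (t - a)))" by (rule sg(1))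
    show "norm (y t) \<le> m * (exp (\<beta> / (2 * \<omega>) + \<omega> / 2) * exp \<omega> / \<beta> * exp (\<omega> * (t - a)))" by (rule sg(2))
  qed
  have m: "0 \<le> m" using init(1) norm_ge_zero order_trans by blast
  let ?e = "exp (\<beta> / (2 * \<omega>) + \<omega> / 2)"
  have "?e * 1 \<le> growth_const \<omega>" unfolding growth_const_def by (rule mult_left_mono) auto
  moreover have "?e * (exp \<omega> / \<beta>) \<le> growth_const \<omega>" unfolding growth_const_def by (rule mult_left_mono) auto
  ultimately have e: "?e \<le> growth_const \<omega>" "?e * exp \<omega> / \<beta> \<le> growth_const \<omega>" by simp_all
  have "m * (?e * exp (\<omega> * (t - a))) \<le> m * (growth_const \<omega> * exp (\<omega> * (t - a)))"
    "m * (?e * exp \<omega> / \<beta> * exp (\<omega> * (t - a))) \<le> m * (growth_const \<omega> * exp (\<omega> * (t - a)))"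
    by (intro mult_left_mono[OF mult_right_mono[OF e(1)]] mult_left_mono[OF mult_right_mono[OF e(2)]] m exp_ge_zero)+
  then show "norm (u t) \<le> m * (growth_const \<omega> * exp (\<omega> * (t - a)))" "norm (y t) \<le> m * (growth_const \<omega> * exp (\<omega> * (t - a)))"
    using * by linarith+
qed

text \<open>
  Fundamental systems are constructed on the whole line by switching the coefficient off to the
  left of the initial point; they solve the original equation to its right.
\<close>

definition trunc :: "real \<Rightarrow> real \<Rightarrow> real" where "trunc r0 x = (if r0 < x then b x else 0)"

lemma trunc_le: "\<bar>trunc r0 x\<bar> \<le> \<beta>"
  using b_nonneg[of x] b_le[of x] beta by (simp add: trunc_def)

definition fundamental :: "real \<Rightarrow> (real \<Rightarrow> 'k) \<Rightarrow> (real \<Rightarrow> 'k) \<Rightarrow> (real \<Rightarrow> 'k) \<Rightarrow> (real \<Rightarrow> 'k) \<Rightarrow> bool" where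
  "fundamental r0 c1 d1 c2 d2 \<longleftrightarrow> quasi_sol (trunc r0) \<Phi> c1 d1 \<and> quasi_sol (trunc r0) \<Phi> c2 d2 \<and>
     c1 r0 = 1 \<and> d1 r0 = 0 \<and> c2 r0 = 0 \<and> d2 r0 = 1"

lemma fundamental_exists: "\<exists>c1 d1 c2 d2. fundamental r0 c1 d1 c2 d2"
  using quasi_sol_exists[OF loc_bdd_b loc_bdd_Phi, of r0 1 0] quasi_sol_exists[OF loc_bdd_b loc_bdd_Phi, of r0 0 1]
  unfolding fundamental_def trunc_def by metis

lemma fundamental_det:
  assumes f: "fundamental r0 c1 d1 c2 d2" and t: "r0 \<le> t"
  shows "c1 t * d2 t - c2 t * d1 t = 1"
  using wronskian[of "trunc r0" \<Phi> c2 d2 "trunc r0" \<Phi> c1 d1 "\<lambda>x. 0" 0 r0 t] f t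
  by (simp add: fundamental_def algebra_simps)

text \<open>
  The Wronskian of two solutions is constant; the Wronskians with the fundamental system are the
  initial values.
\<close>

lemma fundamental_rep:
  assumes f: "fundamental r0 c1 d1 c2 d2" and q: "quasi_sol b \<Phi> u y" and t: "r0 \<le> t"
  shows "u t = u r0 * c1 t + y r0 * c2 t" "y t = u r0 * d1 t + y r0 * d2 t"
proof -
  have z: "intI lebesgue r0 t (\<lambda>x. (b x - trunc r0 x) *\<^sub>R g x) = 0" for g :: "real \<Rightarrow> 'k"
    using intI_cong[of r0 t "\<lambda>x. (b x - trunc r0 x) *\<^sub>R g x" "\<lambda>x. 0" lebesgue] by (simp add: trunc_def)
  have 1: "u t * d1 t - y t * c1 t = - y r0"
    using wronskian[of "trunc r0" \<Phi> c1 d1 b \<Phi> u y "\<lambda>x. 0" 0 r0 t] f q t z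
    by (simp add: fundamental_def algebra_simps)
  have 2: "u t * d2 t - y t * c2 t = u r0"
    using wronskian[of "trunc r0" \<Phi> c2 d2 b \<Phi> u y "\<lambda>x. 0" 0 r0 t] f q t z
    by (simp add: fundamental_def algebra_simps)
  have y0: "y r0 = y t * c1 t - u t * d1 t" using 1 by (simp add: algebra_simps)
  have "u r0 * c1 t + y r0 * c2 t = u t * (c1 t * d2 t - c2 t * d1 t)"
    unfolding y0 2[symmetric] by (simp add: algebra_simps)
  then show "u t = u r0 * c1 t + y r0 * c2 t" by (simp add: fundamental_det[OF f t])
  have "u r0 * d1 t + y r0 * d2 t = y t * (c1 t * d2 t - c2 t * d1 t)"
    unfolding y0 2[symmetric] by (simp add: algebra_simps)
  then show "y t = u r0 * d1 t + y r0 * d2 t" by (simp add: fundamental_det[OF f t])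
qed

lemma quasi_sol_lincomb:
  assumes "quasi_sol d \<Psi> u y" "quasi_sol d \<Psi> u' y'"
  shows "quasi_sol d \<Psi> (\<lambda>x. p * u x - q * u' x) (\<lambda>x. p * y x - q * y' x)"
  unfolding quasi_sol_def
proof
  have 1: "prim_of u (\<lambda>x. d x *\<^sub>R y x)" "prim_of u' (\<lambda>x. d x *\<^sub>R y' x)" 
    "prim_of (\<lambda>x. y x - \<Psi> x * u x) (\<lambda>x. - (d x *\<^sub>R (\<Psi> x * y x)))" "prim_of (\<lambda>x. y' x - \<Psi> x * u' x) (\<lambda>x. - (d x *\<^sub>R (\<Psi> x * y' x)))"
    using assms by (auto simp: quasi_sol_def)
  show "prim_of (\<lambda>x. p * u x - q * u' x) (\<lambda>x. d x *\<^sub>R (p * y x - q * y' x))"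
    by (rule prim_of_cong[OF prim_of_diff[OF prim_of_cmult[OF 1(1), of p] prim_of_cmult[OF 1(2), of q]]])
       (simp_all add: scaleR_conv_of_real algebra_simps)
  show "prim_of (\<lambda>x. p * y x - q * y' x - \<Psi> x * (p * u x - q * u' x)) (\<lambda>x. - (d x *\<^sub>R (\<Psi> x * (p * y x - q * y' x))))"
    by (rule prim_of_cong[OF prim_of_diff[OF prim_of_cmult[OF 1(3), of p] prim_of_cmult[OF 1(4), of q]]])
       (simp_all add: scaleR_conv_of_real algebra_simps)
qed

text \<open>
  Two entries of the propagator from \<open>a\<close> to \<open>t\<close>.  As its determinant is \<open>1\<close>, the inverse has the same
  entries up to sign and position, so the forward growth estimate covers \<open>t < a\<close> as well.
\<close>

lemma kernel_bound:
  assumes f: "fundamental r0 c1 d1 c2 d2" and om: "0 < \<omega>" "\<beta> * \<kappa> \<le> \<omega>\<^sup>2" and at: "r0 \<le> a" "r0 \<le> t"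
  shows "norm (c1 a * c2 t - c2 a * c1 t) \<le> growth_const \<omega> * exp (\<omega> * \<bar>t - a\<bar>)"
    "norm (c1 a * d2 t - c2 a * d1 t) \<le> growth_const \<omega> * exp (\<omega> * \<bar>t - a\<bar>)"
proof -
  have q1: "quasi_sol (trunc r0) \<Phi> c1 d1" and q2: "quasi_sol (trunc r0) \<Phi> c2 d2" using f by (auto simp: fundamental_def)
  have fwd: "norm (c1 a * c2 t - c2 a * c1 t) \<le> 1 * (growth_const \<omega> * exp (\<omega> * (t - a)))"
    "norm (c1 a * d2 t - c2 a * d1 t) \<le> 1 * (growth_const \<omega> * exp (\<omega> * (t - a)))"
    "norm (d2 a * c1 t - d1 a * c2 t) \<le> 1 * (growth_const \<omega> * exp (\<omega> * (t - a)))"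
    if "r0 \<le> a" "a \<le> t" for a t
  proof -
    note g = quasi_sol_growth[OF quasi_sol_lincomb[OF q2 q1, of "c1 a" "c2 a"] trunc_le om _ _ that(2), of 1]
    show "norm (c1 a * c2 t - c2 a * c1 t) \<le> 1 * (growth_const \<omega> * exp (\<omega> * (t - a)))"
      by (rule g(1)) (simp_all add: fundamental_det[OF f that(1)] mult.commute)
    show "norm (c1 a * d2 t - c2 a * d1 t) \<le> 1 * (growth_const \<omega> * exp (\<omega> * (t - a)))"
      by (rule g(2)) (simp_all add: fundamental_det[OF f that(1)] mult.commute)
    show "norm (d2 a * c1 t - d1 a * c2 t) \<le> 1 * (growth_const \<omega> * exp (\<omega> * (t - a)))"
      by (rule quasi_sol_growth(1)[OF quasi_sol_lincomb[OF q1 q2, of "d2 a" "d1 a"] trunc_le om _ _ that(2), of 1])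
         (use fundamental_det[OF f that(1)] in \<open>simp_all add: mult.commute\<close>)
  qed
  show "norm (c1 a * c2 t - c2 a * c1 t) \<le> growth_const \<omega> * exp (\<omega> * \<bar>t - a\<bar>)"
  proof (cases "a \<le> t")
    case True then show ?thesis using fwd(1)[OF at(1) True] by simp
  next
    case False
    then have "norm (c1 t * c2 a - c2 t * c1 a) \<le> growth_const \<omega> * exp (\<omega> * \<bar>t - a\<bar>)"
      using fwd(1)[of t a] at by simp
    then show ?thesis by (simp add: norm_minus_commute mult.commute)
  qed
  show "norm (c1 a * d2 t - c2 a * d1 t) \<le> growth_const \<omega> * exp (\<omega> * \<bar>t - a\<bar>)"
  proof (cases "a \<le> t")
    case True then show ?thesis using fwd(2)[OF at(1) True] by simp
  next
    case False
    then have "norm (d2 t * c1 a - d1 t * c2 a) \<le> growth_const \<omega> * exp (\<omega> * \<bar>t - a\<bar>)"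
      using fwd(3)[of t a] at by simp
    then show ?thesis by (simp add: mult.commute)
  qed
qed

lemma quasi_sol_backward:
  assumes q: "quasi_sol b \<Phi> u y" and om: "0 < \<omega>" "\<beta> * \<kappa> \<le> \<omega>\<^sup>2" and at: "a \<le> t" 
    and m: "norm (u t) \<le> m" "norm (y t) \<le> m"
  shows "norm (u a) \<le> 2 * m * (growth_const \<omega> * exp (\<omega> * (t - a)))" "norm (y a) \<le> 2 * m * (growth_const \<omega> * exp (\<omega> * (t - a)))"
proof -
  obtain c1 d1 c2 d2 where f: "fundamental a c1 d1 c2 d2" using fundamental_exists by blast
  have q1: "quasi_sol (trunc a) \<Phi> c1 d1" and q2: "quasi_sol (trunc a) \<Phi> c2 d2" 
    and i: "c1 a = 1" "d1 a = 0" "c2 a = 0" "d2 a = 1" using f by (auto simp: fundamental_def)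
  let ?E = "growth_const \<omega> * exp (\<omega> * (t - a))"
  have b: "norm (c1 t) \<le> ?E" "norm (d1 t) \<le> ?E" "norm (c2 t) \<le> ?E" "norm (d2 t) \<le> ?E"
    using quasi_sol_growth[OF q1 trunc_le om _ _ at, of 1] quasi_sol_growth[OF q2 trunc_le om _ _ at, of 1] i by auto
  note r = fundamental_rep[OF f q at]
  have "u t * d2 t - y t * c2 t = u a * (c1 t * d2 t - c2 t * d1 t)"
    unfolding r by (simp add: algebra_simps)
  then have ua: "u a = u t * d2 t - y t * c2 t" by (simp add: fundamental_det[OF f at])
  have "y t * c1 t - u t * d1 t = y a * (c1 t * d2 t - c2 t * d1 t)"
    unfolding r by (simp add: algebra_simps)
  then have ya: "y a = y t * c1 t - u t * d1 t" by (simp add: fundamental_det[OF f at])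
  have m0: "0 \<le> m" using m norm_ge_zero order_trans by blast
  have "norm (u a) \<le> norm (u t) * norm (d2 t) + norm (y t) * norm (c2 t)"
    unfolding ua by (metis norm_mult norm_triangle_ineq4)
  also have "\<dots> \<le> m * ?E + m * ?E" using m0 by (intro add_mono mult_mono m b) auto
  finally show "norm (u a) \<le> 2 * m * ?E" by simp
  have "norm (y a) \<le> norm (y t) * norm (c1 t) + norm (u t) * norm (d1 t)"
    unfolding ya by (metis norm_mult norm_triangle_ineq4)
  also have "\<dots> \<le> m * ?E + m * ?E" using m0 by (intro add_mono mult_mono m b) auto
  finally show "norm (y a) \<le> 2 * m * ?E" by simp
qed

lemma quasi_sol_loc_bdd:
  assumes "quasi_sol d \<Phi> u y" shows "loc_bdd lebesgue u" "loc_bdd lebesgue y"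
proof -
  show lu: "loc_bdd lebesgue u"
    by (rule prim_of_loc_bdd[OF conjunct1[OF assms[unfolded quasi_sol_def]] locfin_lebesgue])
  have "loc_bdd lebesgue (\<lambda>x. (y x - \<Phi> x * u x) + \<Phi> x * u x)"
    by (rule loc_bdd_add[OF prim_of_loc_bdd[OF conjunct2[OF assms[unfolded quasi_sol_def]] locfin_lebesgue] loc_bdd_mult[OF loc_bdd_Phi lu]])
  then show "loc_bdd lebesgue y" by simp
qed

lemma quasi_sol_shift:
  "quasi_sol d \<Psi> u y \<Longrightarrow> quasi_sol (\<lambda>x. d (x + q)) (\<lambda>x. \<Psi> (x + q)) (\<lambda>x. u (x + q)) (\<lambda>x. y (x + q))"
  unfolding quasi_sol_def
  using prim_of_shift[of u "\<lambda>x. d x *\<^sub>R y x" q] prim_of_shift[of "\<lambda>x. y x - \<Psi> x * u x" "\<lambda>x. - (d x *\<^sub>R (\<Psi> x * y x))" q]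
  by blast

text \<open>
  The translate of \<open>u\<close> by \<open>q'\<close> follows, from \<open>s\<close> to \<open>t\<close>, the solution of the equation that has the same
  value and quasi-derivative at \<open>s\<close>.  As \<open>\<theta>\<close> vanishes at \<open>s\<close>, the correction \<open>\<theta> w\<close> of the
  quasi-derivative does not affect the initial data, and it never enters the value at \<open>t\<close>.
\<close>

lemma shifted_solution:
  assumes f: "fundamental r0 c1 d1 c2 d2" and q: "quasi_sol b \<Phi> u y" and om: "0 < \<omega>" "\<beta> * \<kappa> \<le> \<omega>\<^sup>2"
    and st: "r0 \<le> s" "r0 \<le> t" and B: "\<And>x. norm (u x) \<le> B" "\<And>x. norm (y x) \<le> B"
    and th: "\<And>x. \<theta> x = \<Phi> x - \<Phi> (x + q') - c" and ths: "\<theta> s = 0"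
  shows "norm (u (t + q') - (u (s + q') * (c1 t * d2 s - c2 t * d1 s) - y (s + q') * (c1 t * c2 s - c2 t * c1 s)))
    \<le> growth_const \<omega> * exp (\<omega> * \<bar>t - s\<bar>) * B * intI lebesgue (min s t) (max s t) (\<lambda>x. \<bar>b (x + q') - b x\<bar> + 2 * \<beta> * norm (\<theta> x))"
proof -
  have q1: "quasi_sol (trunc r0) \<Phi> c1 d1" and q2: "quasi_sol (trunc r0) \<Phi> c2 d2" using f by (auto simp: fundamental_def)
  define U where "U x = c1 t * c2 x - c2 t * c1 x" for x
  define Y where "Y x = c1 t * d2 x - c2 t * d1 x" for x
  have qU: "quasi_sol (trunc r0) \<Phi> U Y" unfolding U_def Y_def by (rule quasi_sol_lincomb[OF q2 q1])
  have Ut: "U t = 0" and Yt: "Y t = 1" using fundamental_det[OF f st(2)] by (simp_all add: U_def Y_def)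
  define E where "E = growth_const \<omega> * exp (\<omega> * \<bar>t - s\<bar>)"
  have E0: "0 \<le> E" using growth_const_pos[of \<omega>] by (simp add: E_def)
  have B0: "0 \<le> B" using B(1)[of 0] norm_ge_zero order_trans by blast
  define lo hi where "lo = min s t" and "hi = max s t"
  have lohi: "lo \<le> hi" "r0 \<le> lo" using st by (auto simp: lo_def hi_def)
  have UY: "norm (U x) \<le> E" "norm (Y x) \<le> E" if "lo < x" "x \<le> hi" for x
  proof -
    have "growth_const \<omega> * exp (\<omega> * \<bar>x - t\<bar>) \<le> E"
      unfolding E_def using growth_const_pos[of \<omega>] om that by (intro mult_left_mono) (auto simp: lo_def hi_def)
    then show "norm (U x) \<le> E" "norm (Y x) \<le> E"
      using kernel_bound[OF f om st(2), of x] that lohi by (auto simp: U_def Y_def)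
  qed
  let ?W = "\<lambda>x. u (x + q') * Y x - (y (x + q') + \<theta> x * u (x + q')) * U x"
  let ?g = "\<lambda>x. (b (x + q') - trunc r0 x) *\<^sub>R (y (x + q') * Y x) - b (x + q') *\<^sub>R (\<theta> x * y (x + q') * U x) - trunc r0 x *\<^sub>R (\<theta> x * u (x + q') * Y x)"
  let ?h = "\<lambda>x. \<bar>b (x + q') - b x\<bar> + 2 * \<beta> * norm (\<theta> x)"
  have W: "?W hi - ?W lo = intI lebesgue lo hi ?g"
    by (rule wronskian[OF qU quasi_sol_shift[OF q] th lohi(1)])
  have lth: "loc_bdd lebesgue \<theta>"
  proof -
    have "loc_bdd lebesgue (\<lambda>x. \<Phi> x - \<Phi> (x + q') - c)" by (intro loc_bdd_intros loc_bdd_Phi loc_bdd_shift)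
    moreover have "\<theta> = (\<lambda>x. \<Phi> x - \<Phi> (x + q') - c)" by (rule ext) (rule th)
    ultimately show ?thesis by (simp only:)
  qed
  have lh: "loc_bdd lebesgue ?h"
  proof -
    have "loc_bdd lebesgue (\<lambda>x. norm (b (x + q') - b x) + (2 * \<beta>) *\<^sub>R norm (\<theta> x))"
      by (intro loc_bdd_intros loc_bdd_shift loc_bdd_b lth)
    then show ?thesis by simp
  qed
  have lg: "loc_bdd lebesgue ?g"
  proof -
    have "loc_bdd lebesgue (\<lambda>x. b (x + q') *\<^sub>R y (x + q'))" "loc_bdd lebesgue (\<lambda>x. trunc r0 x *\<^sub>R Y x)"
      using quasi_sol_shift[OF q, of q'] qU by (auto simp: quasi_sol_def prim_of_def)
    moreover note quasi_sol_loc_bdd[OF q] quasi_sol_loc_bdd[OF qU]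
    moreover have "loc_bdd lebesgue (trunc r0)"
    proof -
      have "trunc r0 = (\<lambda>x. indicator {r0<..} x * b x)" by (auto simp: trunc_def indicator_def)
      then have "trunc r0 \<in> borel_measurable lebesgue"
        by (simp add: b_meas borel_measurable_times borel_measurable_indicator)
      then show ?thesis unfolding loc_bdd_def using trunc_le by auto
    qed
    ultimately show ?thesis
      by (intro loc_bdd_diff loc_bdd_scaleR loc_bdd_mult loc_bdd_shift loc_bdd_b lth)
  qed
  have "norm (?W hi - ?W lo) \<le> intI lebesgue lo hi (\<lambda>x. (E * B) *\<^sub>R ?h x)"
    unfolding W
  proof (rule intI_norm_le[OF locfin_lebesgue lg])
    fix x assume x: "lo < x" "x \<le> hi"
    have tr: "trunc r0 x = b x" using x lohi by (simp add: trunc_def)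
    have bb: "\<bar>b x\<bar> \<le> \<beta>" for x using b_nonneg[of x] b_le[of x] by simp
    note uy = UY[OF x]
    have "norm (?g x) \<le> norm ((b (x + q') - b x) *\<^sub>R (y (x + q') * Y x)) + norm (b (x + q') *\<^sub>R (\<theta> x * y (x + q') * U x)) + norm (b x *\<^sub>R (\<theta> x * u (x + q') * Y x))"
      unfolding tr by (intro order_trans[OF norm_triangle_ineq4] add_right_mono norm_triangle_ineq4)
    also have "\<dots> = \<bar>b (x + q') - b x\<bar> * (norm (y (x + q')) * norm (Y x)) + \<bar>b (x + q')\<bar> * (norm (\<theta> x) * norm (y (x + q')) * norm (U x)) + \<bar>b x\<bar> * (norm (\<theta> x) * norm (u (x + q')) * norm (Y x))"
      by (simp add: norm_mult)
    also have "\<dots> \<le> \<bar>b (x + q') - b x\<bar> * (B * E) + \<beta> * (norm (\<theta> x) * B * E) + \<beta> * (norm (\<theta> x) * B * E)"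
      by (intro add_mono mult_mono mult_left_mono bb B uy order_refl) (use beta B0 E0 in auto)
    finally show "norm (?g x) \<le> (E * B) *\<^sub>R ?h x" by (simp add: algebra_simps)
  qed (intro loc_bdd_scaleR loc_bdd_const lh)
  also have "\<dots> = E * B * intI lebesgue lo hi ?h" by simp
  finally have le: "norm (?W hi - ?W lo) \<le> E * B * intI lebesgue lo hi ?h" .
  have "norm (?W t - ?W s) \<le> E * B * intI lebesgue lo hi ?h"
  proof (cases "s \<le> t")
    case True then show ?thesis using le by (simp add: lo_def hi_def)
  next
    case False then show ?thesis using le by (simp add: lo_def hi_def norm_minus_commute)
  qed
  moreover have "?W t = u (t + q')" by (simp add: Ut Yt)
  moreover have "?W s = u (s + q') * (c1 t * d2 s - c2 t * d1 s) - y (s + q') * (c1 t * c2 s - c2 t * c1 s)"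
    by (simp add: ths U_def Y_def)
  ultimately show ?thesis by (simp only: E_def lo_def hi_def)
qed

text \<open>
  Let \<open>M\<close> be the propagator from \<open>s\<close> to \<open>s + p\<close>, with trace \<open>D\<close>.  Carrying the data of \<open>u\<close> at
  \<open>s + p\<close> (which are \<open>M\<close> times those at \<open>s\<close>) from \<open>s\<close> to \<open>t\<close> gives nearly \<open>u (t + p)\<close>; carrying the
  data at \<open>s\<close> backwards from \<open>s + p\<close> to \<open>t\<close>, which amounts to carrying \<open>M\<close> inverse times the data
  from \<open>s\<close> to \<open>t\<close>, gives nearly \<open>u (t - p)\<close>.  The sum is exactly \<open>D u t\<close> because \<open>M\<close> plus its
  inverse is \<open>D\<close> times the identity.  The two errors are integrals over \<open>{s<..t}\<close> and, after translation by
  \<open>p\<close>, over \<open>{t - p<..s}\<close>.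
\<close>

lemma gordon_relation:
  assumes q: "quasi_sol b \<Phi> u y" and om: "0 < \<omega>" "\<beta> * \<kappa> \<le> \<omega>\<^sup>2"
    and s: "0 \<le> s" and p: "0 < p" and B: "\<And>x. norm (u x) \<le> B" "\<And>x. norm (y x) \<le> B"
    and th: "\<And>x. \<theta> x = \<Phi> x - \<Phi> (x + p) - c" and ths: "\<theta> s = 0"
  shows "\<exists>D. \<forall>t. s \<le> t \<longrightarrow> t \<le> s + p \<longrightarrow> norm (u (t + p) + u (t - p) - D * u t) \<le>
    growth_const \<omega> * exp (\<omega> * p) * B * intI lebesgue (t - p) t (\<lambda>x. \<bar>b (x + p) - b x\<bar> + 2 * \<beta> * norm (\<theta> x))"
proof -
  obtain c1 d1 c2 d2 where f: "fundamental 0 c1 d1 c2 d2" using fundamental_exists by blast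
  \<comment> \<open>the trace of the propagator from \<open>s\<close> to \<open>s + p\<close>\<close>
  define D where "D = (c1 (s + p) * d2 s - c2 (s + p) * d1 s) + (d2 (s + p) * c1 s - d1 (s + p) * c2 s)"
  let ?h = "\<lambda>x. \<bar>b (x + p) - b x\<bar> + 2 * \<beta> * norm (\<theta> x)"
  have lth: "loc_bdd lebesgue \<theta>"
  proof -
    have "loc_bdd lebesgue (\<lambda>x. \<Phi> x - \<Phi> (x + p) - c)" by (intro loc_bdd_intros loc_bdd_Phi loc_bdd_shift)
    moreover have "\<theta> = (\<lambda>x. \<Phi> x - \<Phi> (x + p) - c)" by (rule ext) (rule th)
    ultimately show ?thesis by (simp only:)
  qed
  have lh: "loc_bdd lebesgue ?h"
  proof -
    have "loc_bdd lebesgue (\<lambda>x. norm (b (x + p) - b x) + (2 * \<beta>) *\<^sub>R norm (\<theta> x))"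
      by (intro loc_bdd_intros loc_bdd_shift loc_bdd_b lth)
    then show ?thesis by simp
  qed
  have B0: "0 \<le> B" using B(1)[of 0] norm_ge_zero order_trans by blast
  have "norm (u (t + p) + u (t - p) - D * u t) \<le> growth_const \<omega> * exp (\<omega> * p) * B * intI lebesgue (t - p) t ?h"
    if t: "s \<le> t" "t \<le> s + p" for t
  proof -
    define v1 where "v1 = u (s + p) * (c1 t * d2 s - c2 t * d1 s) - y (s + p) * (c1 t * c2 s - c2 t * c1 s)"
    define v2 where "v2 = u s * (c1 t * d2 (s + p) - c2 t * d1 (s + p)) - y s * (c1 t * c2 (s + p) - c2 t * c1 (s + p))"
    have t0: "0 \<le> t" "0 \<le> s + p" using s t p by auto
    note r = fundamental_rep[OF f q]
    have v: "v1 + v2 = D * u t"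
      unfolding v1_def v2_def D_def r[OF s] r[OF t0(1)] r[OF t0(2)] by (simp add: algebra_simps)
    have 1: "norm (u (t + p) - v1) \<le> growth_const \<omega> * exp (\<omega> * \<bar>t - s\<bar>) * B * intI lebesgue (min s t) (max s t) ?h"
      unfolding v1_def by (rule shifted_solution[OF f q om s t0(1) B th ths])
    define \<theta>' where "\<theta>' x = - \<theta> (x - p)" for x
    have th': "\<theta>' x = \<Phi> x - \<Phi> (x + - p) - (- c)" for x by (simp add: \<theta>'_def th)
    have ths': "\<theta>' (s + p) = 0" by (simp add: \<theta>'_def ths)
    have 2: "norm (u (t + - p) - v2) \<le> growth_const \<omega> * exp (\<omega> * \<bar>t - (s + p)\<bar>) * B *
      intI lebesgue (min (s + p) t) (max (s + p) t) (\<lambda>x. \<bar>b (x + - p) - b x\<bar> + 2 * \<beta> * norm (\<theta>' x))"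
      using shifted_solution[OF f q om t0(2) t0(1) B th' ths'] by (simp add: v2_def)
    have "intI lebesgue (min (s + p) t) (max (s + p) t) (\<lambda>x. \<bar>b (x + - p) - b x\<bar> + 2 * \<beta> * norm (\<theta>' x))
       = intI lebesgue t (s + p) (\<lambda>x. ?h (x + - p))"
      using t by (simp add: min_def max_def \<theta>'_def abs_minus_commute)
    also have "\<dots> = intI lebesgue (t - p) s ?h" by (subst intI_shift[OF loc_bddD[OF lh]]) simp
    finally have i2: "intI lebesgue (min (s + p) t) (max (s + p) t) (\<lambda>x. \<bar>b (x + - p) - b x\<bar> + 2 * \<beta> * norm (\<theta>' x)) = intI lebesgue (t - p) s ?h" .
    have e: "growth_const \<omega> * exp (\<omega> * \<bar>x\<bar>) * B * intI lebesgue l r ?h \<le> growth_const \<omega> * exp (\<omega> * p) * B * intI lebesgue l r ?h" if "\<bar>x\<bar> \<le> p" for x l r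
      using that growth_const_pos[of \<omega>] om(1) B0 beta by (intro mult_right_mono mult_left_mono intI_nonneg) auto
    have "norm (u (t + p) + u (t - p) - D * u t) \<le> norm (u (t + p) - v1) + norm (u (t + - p) - v2)"
      unfolding v[symmetric] using norm_triangle_ineq[of "u (t + p) - v1" "u (t + - p) - v2"] by (simp add: algebra_simps)
    also have "\<dots> \<le> growth_const \<omega> * exp (\<omega> * p) * B * intI lebesgue s t ?h + growth_const \<omega> * exp (\<omega> * p) * B * intI lebesgue (t - p) s ?h"
    proof (rule add_mono)
      show "norm (u (t + p) - v1) \<le> growth_const \<omega> * exp (\<omega> * p) * B * intI lebesgue s t ?h"
        using order_trans[OF 1 e[of "t - s"]] t p by simp
      show "norm (u (t + - p) - v2) \<le> growth_const \<omega> * exp (\<omega> * p) * B * intI lebesgue (t - p) s ?h"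
        using order_trans[OF 2[unfolded i2] e[of "t - (s + p)"]] t p by simp
    qed
    also have "\<dots> = growth_const \<omega> * exp (\<omega> * p) * B * (intI lebesgue (t - p) s ?h + intI lebesgue s t ?h)"
      by (simp only: distrib_left add.commute)
    also have "intI lebesgue (t - p) s ?h + intI lebesgue s t ?h = intI lebesgue (t - p) t ?h"
      by (rule intI_combine[OF locfin_lebesgue lh]) (use t in auto)
    finally show ?thesis .
  qed
  then show ?thesis by blast
qed

end

section \<open>Supports of local measures\<close>

lemma nonneg_pos_set_uminus:
  assumes "\<forall>B\<in>bounded_borel. 0 \<le> \<rho> B" shows "pos_set (\<lambda>B. - \<rho> B) B = 0"
proof -
  have "pos_set (\<lambda>B. - \<rho> B) B \<le> 0"
    unfolding pos_set_def using assms by (intro SUP_least) (simp add: ennreal_neg)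
  then show ?thesis by simp
qed

lemma nonneg_variation:
  assumes "loc_finite \<rho>" "\<forall>B\<in>bounded_borel. 0 \<le> \<rho> B" "B \<in> bounded_borel"
  shows "variation \<rho> B = ennreal (\<rho> B)"
proof -
  have lm: "local_measure \<rho>" and Bb: "B \<in> sets borel" using assms loc_finiteD by (auto simp: bounded_borel_def)
  have n: "emeasure (neg_part_measure \<rho>) B = 0"
    using nonneg_pos_set_uminus[OF assms(2)] by (simp add: emeasure_neg_part[OF lm Bb])
  have "\<rho> B = measure (pos_part_measure \<rho>) B"
    using loc_finite_eq_diff[OF assms(1,3)] n by (simp add: measure_def)
  moreover have "emeasure (pos_part_measure \<rho>) B \<noteq> top"
    using loc_finite_finite(2)[OF assms(1,3)] by (simp add: emeasure_pos_part[OF lm Bb])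
  ultimately have "emeasure (pos_part_measure \<rho>) B = ennreal (\<rho> B)"
    by (simp add: emeasure_eq_ennreal_measure)
  then show ?thesis
    using nonneg_pos_set_uminus[OF assms(2)] 
    by (simp add: variation_eq_pos_add_neg[OF lm Bb] emeasure_pos_part[OF lm Bb])
qed

lemma nonneg_integral_lm:
  fixes h :: "real \<Rightarrow> 'k::{real_normed_field, banach, second_countable_topology}"
  assumes "loc_finite \<rho>" "\<forall>B\<in>bounded_borel. 0 \<le> \<rho> B"
  shows "integral_lm \<rho> S h = set_lebesgue_integral (variation_measure \<rho>) S h"
proof -
  have lm: "local_measure \<rho>" using assms loc_finiteD by blast
  have "pos_part_measure \<rho> = variation_measure \<rho>"
  proof (rule measure_eqI)
    fix A assume "A \<in> sets (pos_part_measure \<rho>)"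
    then have A: "A \<in> sets borel" by simp
    show "emeasure (pos_part_measure \<rho>) A = emeasure (variation_measure \<rho>) A"
      by (simp add: emeasure_pos_part[OF lm A] emeasure_variation_measure[OF lm A] 
          variation_eq_pos_add_neg[OF lm A] nonneg_pos_set_uminus[OF assms(2)])
  qed simp
  moreover have "emeasure (neg_part_measure \<rho>) UNIV = 0"
    by (simp add: emeasure_neg_part[OF lm] nonneg_pos_set_uminus[OF assms(2)])
  then have "AE x in neg_part_measure \<rho>. indicator S x *\<^sub>R h x = 0"
    by (intro AE_I[of _ _ UNIV]) auto
  then have "set_lebesgue_integral (neg_part_measure \<rho>) S h = 0"
    unfolding set_lebesgue_integral_def by (rule integral_eq_zero_AE)
  ultimately show ?thesis by (simp add: integral_lm_def)
qed

text \<open>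
  Countably many intervals with rational end points cover the complement of the support.
\<close>

lemma AE_spt_measure:
  assumes "local_measure \<mu>"
  shows "AE x in variation_measure \<mu>. x \<in> spt_measure \<mu>"
proof -
  define I where "I = {(p, q). p \<in> \<rat> \<and> q \<in> \<rat> \<and> variation \<mu> {p<..<q} = 0}"
  have "countable I"
    by (rule countable_subset[of _ "\<rat> \<times> \<rat>"]) (auto simp: I_def countable_rat)
  then have "(\<Union>i\<in>I. {fst i<..<snd i}) \<in> null_sets (variation_measure \<mu>)"
    by (intro null_sets_UN') (auto simp: I_def null_sets_def emeasure_variation_measure[OF assms])
  moreover have "{x. x \<notin> spt_measure \<mu>} \<subseteq> (\<Union>i\<in>I. {fst i<..<snd i})"
  proof
    fix x assume "x \<in> {x. x \<notin> spt_measure \<mu>}"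
    then obtain U where U: "open U" "x \<in> U" "variation \<mu> U = 0" by (auto simp: spt_measure_def)
    then obtain e where e: "e > 0" "ball x e \<subseteq> U" by (auto simp: open_contains_ball)
    obtain p where p: "p \<in> \<rat>" "x - e < p" "p < x" using Rats_dense_in_real[of "x - e" x] e by auto
    obtain q where q: "q \<in> \<rat>" "x < q" "q < x + e" using Rats_dense_in_real[of x "x + e"] e by auto
    have "{p<..<q} \<subseteq> U" using e p q by (intro order_trans[OF _ e(2)]) (auto simp: dist_real_def)
    then have "variation \<mu> {p<..<q} = 0" using variation_mono[of "{p<..<q}" U \<mu>] U by simp
    then show "x \<in> (\<Union>i\<in>I. {fst i<..<snd i})" using p q by (auto simp: I_def intro!: bexI[of _ "(p, q)"])
  qed
  ultimately show ?thesis by (intro AE_I') auto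
qed

lemma AE_spt_parts:
  assumes "local_measure \<mu>"
  shows "AE x in pos_part_measure \<mu>. x \<in> spt_measure \<mu>" "AE x in neg_part_measure \<mu>. x \<in> spt_measure \<mu>"
proof -
  obtain N where N: "{x. x \<notin> spt_measure \<mu>} \<subseteq> N" "N \<in> sets borel" "variation \<mu> N = 0"
    using AE_spt_measure[OF assms] by (auto elim!: AE_E simp: emeasure_variation_measure[OF assms])
  have "pos_set \<mu> N = 0" "pos_set (\<lambda>B. - \<mu> B) N = 0"
    using N(3) by (simp_all add: variation_eq_pos_add_neg[OF assms N(2)])
  then have "N \<in> null_sets (pos_part_measure \<mu>)" "N \<in> null_sets (neg_part_measure \<mu>)"
    using N(2) by (auto simp: null_sets_def emeasure_pos_part[OF assms] emeasure_neg_part[OF assms])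
  then show "AE x in pos_part_measure \<mu>. x \<in> spt_measure \<mu>" "AE x in neg_part_measure \<mu>. x \<in> spt_measure \<mu>"
    using N(1) by (auto intro: AE_I')
qed

lemma intI_le_AE:
  fixes f :: "real \<Rightarrow> real"
  assumes M: "locfin M" and f: "loc_bdd M f" and AE: "AE x in M. s < x \<longrightarrow> x \<le> t \<longrightarrow> f x \<le> S"
  shows "intI M s t f \<le> S * measure M {s<..t}"
proof -
  have "intI M s t f \<le> intI M s t (\<lambda>x. S)"
    unfolding set_lebesgue_integral_def
    by (rule integral_mono_AE)
       (use loc_bdd_set_integrable[OF M f, of s t] loc_bdd_set_integrable[OF M loc_bdd_const, of s t S] AE
         in \<open>auto simp: set_integrable_def indicator_def elim!: eventually_mono\<close>)
  then show ?thesis by (simp add: intI_const[OF M] mult.commute)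
qed

section \<open>Decay of eigenfunctions\<close>

text \<open>
  What makes membership in \<open>L\<^sub>p(\<rho>)\<close> effective: by periodicity \<open>\<rho>\<close> charges the neighbourhoods of its
  support uniformly, and as \<open>b\<close> stays away from \<open>0\<close>, small differences of \<open>u\<close> mean that \<open>y\<close> is small
  somewhere.
\<close>

locale sl_periodic = sl_equation \<mu> \<rho> z b \<beta> k1 k2
  for \<mu> \<rho> and z :: "'k::{real_normed_field, banach, second_countable_topology}" and b \<beta> k1 k2 +
  fixes \<alpha> q :: real
  assumes rho_nonneg: "\<forall>B\<in>bounded_borel. 0 \<le> \<rho> B"
    and q_pos: "0 < q" and q_per: "\<And>B. B \<in> bounded_borel \<Longrightarrow> \<rho> ((\<lambda>x. x + q) ` B) = \<rho> B"
    and alpha: "0 < \<alpha>" and b_ge: "\<And>x. 1 / \<alpha> \<le> b x"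
    and spt: "spt_measure \<mu> \<subseteq> spt_measure \<rho>" and rho_nonzero: "\<exists>B\<in>bounded_borel. \<rho> B \<noteq> 0"
begin

abbreviation "nbd r \<delta> \<equiv> {r - \<delta><..<r + \<delta>::real}"

lemma nbd_bounded_borel [simp]: "nbd r \<delta> \<in> bounded_borel"
  by (auto simp: bounded_borel_def)

lemma variation_nbd: "variation \<rho> (nbd r \<delta>) = ennreal (\<rho> (nbd r \<delta>))"
  by (rule nonneg_variation[OF rho rho_nonneg]) simp

lemma spt_iff: "r \<in> spt_measure \<rho> \<longleftrightarrow> (\<forall>\<delta>>0. 0 < \<rho> (nbd r \<delta>))"
proof
  assume r: "r \<in> spt_measure \<rho>"
  show "\<forall>\<delta>>0. 0 < \<rho> (nbd r \<delta>)"
  proof (intro allI impI)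
    fix \<delta> :: real assume "\<delta> > 0"
    then have "variation \<rho> (nbd r \<delta>) \<noteq> 0"
      using r unfolding spt_measure_def by auto
    then show "0 < \<rho> (nbd r \<delta>)" unfolding variation_nbd by (auto simp: ennreal_eq_0_iff)
  qed
next
  assume r: "\<forall>\<delta>>0. 0 < \<rho> (nbd r \<delta>)"
  show "r \<in> spt_measure \<rho>"
    unfolding spt_measure_def
  proof (intro CollectI allI impI notI)
    fix U assume U: "open U" "r \<in> U" "variation \<rho> U = 0"
    then obtain e where e: "e > 0" "ball r e \<subseteq> U" by (auto simp: open_contains_ball)
    have "nbd r e \<subseteq> U" by (rule order_trans[OF _ e(2)]) (auto simp: dist_real_def)
    from variation_mono[OF this, of \<rho>] U(3) have "variation \<rho> (nbd r e) = 0" by simp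
    then have "\<rho> (nbd r e) \<le> 0" unfolding variation_nbd by (simp add: ennreal_eq_0_iff)
    then show False using r e(1) by force
  qed
qed

lemma rho_nbd_shift: "\<rho> (nbd (r + of_int k * q) \<delta>) = \<rho> (nbd r \<delta>)"
proof -
  have 1: "\<rho> (nbd (r + q) \<delta>) = \<rho> (nbd r \<delta>)" for r
  proof -
    have "(\<lambda>x. x + q) ` nbd r \<delta> = nbd (r + q) \<delta>"
    proof
      show "nbd (r + q) \<delta> \<subseteq> (\<lambda>x. x + q) ` nbd r \<delta>"
      proof
        fix x assume "x \<in> nbd (r + q) \<delta>"
        then show "x \<in> (\<lambda>x. x + q) ` nbd r \<delta>" by (intro image_eqI[of _ _ "x - q"]) auto
      qed
    qed auto
    then show ?thesis using q_per[OF nbd_bounded_borel, of r \<delta>] by simp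
  qed
  have 2: "\<rho> (nbd (r + of_nat n * q) \<delta>) = \<rho> (nbd r \<delta>)" for r n
  proof (induction n)
    case (Suc n)
    have "r + of_nat (Suc n) * q = (r + of_nat n * q) + q" by (simp add: algebra_simps)
    then show ?case using 1[of "r + of_nat n * q"] Suc by (simp only:)
  qed simp
  show ?thesis
  proof (cases "0 \<le> k")
    case True
    then show ?thesis using 2[of r "nat k"] by simp
  next
    case False
    then have "r = (r + of_int k * q) + of_nat (nat (- k)) * q" by simp
    then show ?thesis using 2[of "r + of_int k * q" "nat (- k)"] by (simp only:)
  qed
qed

lemma spt_shift: "r + of_int k * q \<in> spt_measure \<rho> \<longleftrightarrow> r \<in> spt_measure \<rho>"
  unfolding spt_iff by (simp only: rho_nbd_shift)

lemma rho_nbd_mono: 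
  assumes "nbd r \<delta> \<subseteq> nbd r' \<delta>'" shows "\<rho> (nbd r \<delta>) \<le> \<rho> (nbd r' \<delta>')"
proof -
  have "ennreal (\<rho> (nbd r \<delta>)) \<le> ennreal (\<rho> (nbd r' \<delta>'))"
    using variation_mono[OF assms, of \<rho>] by (simp only: variation_nbd)
  moreover have "0 \<le> \<rho> (nbd r' \<delta>')" using rho_nonneg nbd_bounded_borel by blast
  ultimately show ?thesis by simp
qed

text \<open>
  By periodicity the points may be taken from the compact interval \<open>{0..q}\<close>, so a sequence
  with masses tending to \<open>0\<close> would accumulate at a point with a null neighbourhood.
\<close>

lemma spt_uniform:
  assumes "0 < \<delta>"
  shows "\<exists>c>0. \<forall>r\<in>spt_measure \<rho>. c \<le> \<rho> (nbd r \<delta>)"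
proof (rule ccontr)
  assume neg: "\<not> (\<exists>c>0. \<forall>r\<in>spt_measure \<rho>. c \<le> \<rho> (nbd r \<delta>))"
  have "\<exists>r. r \<in> {0..q} \<and> r \<in> spt_measure \<rho> \<and> \<rho> (nbd r \<delta>) < 1 / real (Suc n)" for n
  proof -
    have "0 < 1 / real (Suc n)" by simp
    then obtain r where r: "r \<in> spt_measure \<rho>" "\<rho> (nbd r \<delta>) < 1 / real (Suc n)"
      using neg by (meson not_le)
    define k where "k = - \<lfloor>r / q\<rfloor>"
    have "of_int \<lfloor>r / q\<rfloor> * q \<le> r" "r \<le> (of_int \<lfloor>r / q\<rfloor> + 1) * q"
      using floor_divide_lower[OF q_pos, of r] floor_divide_upper[OF q_pos, of r] by simp_all
    then have "r + of_int k * q \<in> {0..q}" by (auto simp: k_def algebra_simps)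
    then show ?thesis using r spt_shift[of r k] rho_nbd_shift[of r k \<delta>] by (intro exI[of _ "r + of_int k * q"]) simp
  qed
  then obtain x where x: "\<And>n. x n \<in> {0..q}" "\<And>n. x n \<in> spt_measure \<rho>" "\<And>n. \<rho> (nbd (x n) \<delta>) < 1 / real (Suc n)"
    by metis
  obtain l \<phi> where l: "strict_mono \<phi>" "(x \<circ> \<phi>) \<longlonglongrightarrow> l"
    using compact_Icc[of 0 q] x(1) unfolding compact_def by metis
  have ev: "\<forall>\<^sub>F n in sequentially. \<bar>x (\<phi> n) - l\<bar> < \<delta> / 2"
    using tendstoD[OF l(2), of "\<delta> / 2"] assms by (simp add: dist_real_def)
  have small: "\<forall>\<^sub>F n in sequentially. \<rho> (nbd l (\<delta> / 2)) \<le> 1 / real (Suc n)"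
    using ev
  proof eventually_elim
    case (elim n)
    have "nbd l (\<delta> / 2) \<subseteq> nbd (x (\<phi> n)) \<delta>" using elim by (auto simp: abs_if field_simps split: if_splits)
    then have "\<rho> (nbd l (\<delta> / 2)) < 1 / real (Suc (\<phi> n))" using rho_nbd_mono x(3)[of "\<phi> n"] by (meson le_less_trans)
    also have "\<dots> \<le> 1 / real (Suc n)"
      using seq_suble[OF l(1), of n] by (intro divide_left_mono) auto
    finally show ?case by simp
  qed
  have "\<rho> (nbd l (\<delta> / 2)) \<le> 0"
    by (rule tendsto_lowerbound[OF LIMSEQ_Suc[OF lim_const_over_n[of 1]] small]) simp
  obtain n where n: "\<bar>x (\<phi> n) - l\<bar> < \<delta> / 2" using eventually_happens[OF ev] by auto
  define e where "e = \<delta> / 2 - \<bar>x (\<phi> n) - l\<bar>"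
  have "0 < e" using n by (simp add: e_def)
  then have "0 < \<rho> (nbd (x (\<phi> n)) e)" using x(2)[of "\<phi> n"] unfolding spt_iff by blast
  also have "\<dots> \<le> \<rho> (nbd l (\<delta> / 2))"
    by (rule rho_nbd_mono) (auto simp: e_def abs_if split: if_splits)
  finally show False using \<open>\<rho> (nbd l (\<delta> / 2)) \<le> 0\<close> by simp
qed

lemma spt_meets: "\<exists>r\<in>spt_measure \<rho>. t \<le> r \<and> r \<le> t + q"
proof -
  have "spt_measure \<rho> \<noteq> {}"
  proof
    assume "spt_measure \<rho> = {}"
    then have "AE x in variation_measure \<rho>. False" using AE_spt_measure[OF loc_finiteD(1)[OF rho]] by simp
    then have "emeasure (variation_measure \<rho>) B = 0" if "B \<in> sets borel" for B
    proof -
      have "AE x in variation_measure \<rho>. x \<notin> B" using \<open>AE x in _. False\<close> by (rule eventually_mono) simp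
      then have "B \<in> null_sets (variation_measure \<rho>)" using AE_iff_null_sets[of B "variation_measure \<rho>"] that by simp
      then show ?thesis by (rule null_setsD1)
    qed
    moreover obtain B where B: "B \<in> bounded_borel" "\<rho> B \<noteq> 0" using rho_nonzero by blast
    moreover have "B \<in> sets borel" using B by (simp add: bounded_borel_def)
    moreover have "0 \<le> \<rho> B" using B rho_nonneg by blast
    ultimately show False
      using nonneg_variation[OF rho rho_nonneg B(1)] emeasure_variation_measure[OF loc_finiteD(1)[OF rho], of B] by auto
  qed
  then obtain r where r: "r \<in> spt_measure \<rho>" by blast
  define k where "k = \<lceil>(t - r) / q\<rceil>"
  have "(t - r) / q \<le> of_int k" "of_int k \<le> (t - r) / q + 1" unfolding k_def by linarith+
  then have "t - r \<le> of_int k * q" "of_int k * q \<le> t - r + q"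
    using q_pos by (simp_all add: pos_divide_le_eq pos_le_divide_eq[symmetric] add_divide_distrib)
  then show ?thesis using r spt_shift[of r k] by (intro bexI[of _ "r + of_int k * q"]) auto
qed

text \<open>
  Otherwise \<open>\<bar>u\<bar> powr p\<close> would have the integral at least \<open>\<tau> powr p * c\<close> over a neighbourhood of
  a far-away point of the support, by the uniform lower bound \<open>c\<close> for its
  \<open>\<rho>\<close>-measure; but the tails of the integral tend to \<open>0\<close>.
\<close>

lemma small_near_spt:
  fixes u :: "real \<Rightarrow> 'k"
  assumes int: "integrable (variation_measure \<rho>) (\<lambda>x. norm (u x) powr p)" and p: "0 < p"
    and pos: "0 < \<delta>" "0 < \<tau>"
  shows "\<exists>X. \<forall>r\<in>spt_measure \<rho>. X \<le> \<bar>r\<bar> \<longrightarrow> (\<exists>x. \<bar>x - r\<bar> < \<delta> \<and> norm (u x) < \<tau>)"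
proof -
  let ?M = "variation_measure \<rho>" and ?f = "\<lambda>x. norm (u x) powr p"
  obtain c where c: "c > 0" "\<And>r. r \<in> spt_measure \<rho> \<Longrightarrow> c \<le> \<rho> (nbd r \<delta>)" using spt_uniform[OF pos(1)] by metis
  have tail: "(\<lambda>n. LINT x|?M. indicator {x. real n \<le> \<bar>x\<bar>} x * ?f x) \<longlonglongrightarrow> (LINT x|?M. 0)"
  proof (rule integral_dominated_convergence[where w = ?f])
    show "AE x in ?M. (\<lambda>n. indicator {x. real n \<le> \<bar>x\<bar>} x * ?f x) \<longlonglongrightarrow> 0"
    proof (rule AE_I2, rule tendsto_eventually)
      fix x
      have "\<forall>\<^sub>F n in sequentially. \<bar>x\<bar> < real n"
        using filterlim_real_sequentially unfolding filterlim_at_top_dense by blast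
      then show "\<forall>\<^sub>F n in sequentially. indicator {x. real n \<le> \<bar>x\<bar>} x * ?f x = 0"
        by eventually_elim simp
    qed
    show "AE x in ?M. norm (indicator {x. real n \<le> \<bar>x\<bar>} x * ?f x) \<le> ?f x" for n
      by (auto simp: indicator_def)
    have "{x::real. real n \<le> \<bar>x\<bar>} \<in> sets borel" for n
      by (intro borel_closed closed_Collect_le continuous_intros)
    then show "(\<lambda>x. indicator {x. real n \<le> \<bar>x\<bar>} x * ?f x) \<in> borel_measurable ?M" for n
      using int by (intro borel_measurable_times borel_measurable_indicator) auto
  qed (use int in auto)
  have "0 < \<tau> powr p * c" using pos c by simp
  from order_tendstoD(2)[OF tail, of "\<tau> powr p * c"] this
  obtain n where n: "(LINT x|?M. indicator {x. real n \<le> \<bar>x\<bar>} x * ?f x) < \<tau> powr p * c"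
    by (auto simp: eventually_sequentially)
  show ?thesis
  proof (rule exI[of _ "real n + \<delta>"], intro ballI impI)
    fix r assume r: "r \<in> spt_measure \<rho>" "real n + \<delta> \<le> \<bar>r\<bar>"
    show "\<exists>x. \<bar>x - r\<bar> < \<delta> \<and> norm (u x) < \<tau>"
    proof (rule ccontr)
      assume "\<not> (\<exists>x. \<bar>x - r\<bar> < \<delta> \<and> norm (u x) < \<tau>)"
      then have big: "\<tau> \<le> norm (u x)" if "\<bar>x - r\<bar> < \<delta>" for x using that by force
      have fin: "emeasure ?M (nbd r \<delta>) = ennreal (\<rho> (nbd r \<delta>))"
        by (simp add: emeasure_variation_measure[OF loc_finiteD(1)[OF rho]] variation_nbd)
      have "\<tau> powr p * c \<le> \<tau> powr p * \<rho> (nbd r \<delta>)" using c r by (intro mult_left_mono) auto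
      also have "\<rho> (nbd r \<delta>) = measure ?M (nbd r \<delta>)"
        using rho_nonneg by (simp add: measure_def fin)
      also have "\<tau> powr p * measure ?M (nbd r \<delta>) = (LINT x|?M. \<tau> powr p * indicator (nbd r \<delta>) x)"
        by simp
      also have "\<dots> \<le> (LINT x|?M. indicator {x. real n \<le> \<bar>x\<bar>} x * ?f x)"
      proof (rule integral_mono)
        show "integrable ?M (\<lambda>x. \<tau> powr p * indicator (nbd r \<delta>) x)"
          by (intro integrable_mult_right integrable_real_indicator) (simp_all add: fin)
        have "{x::real. real n \<le> \<bar>x\<bar>} \<in> sets borel"
          by (intro borel_closed closed_Collect_le continuous_intros)
        then show "integrable ?M (\<lambda>x. indicator {x. real n \<le> \<bar>x\<bar>} x * ?f x)"
          using integrable_mult_indicator[OF _ int, of "{x. real n \<le> \<bar>x\<bar>}"] by simp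
        fix x
        show "\<tau> powr p * indicator (nbd r \<delta>) x \<le> indicator {x. real n \<le> \<bar>x\<bar>} x * ?f x"
        proof (cases "x \<in> nbd r \<delta>")
          case True
          then have "\<bar>x - r\<bar> < \<delta>" by auto
          then have "real n \<le> \<bar>x\<bar>" "\<tau> \<le> norm (u x)" using r(2) big by auto
          then show ?thesis using True pos p by (simp add: powr_mono2)
        qed simp
      qed
      finally show False using n by simp
    qed
  qed
qed

lemma nu_int_le_spt:
  assumes cu: "continuous_on UNIV u" and S: "\<And>x. s < x \<Longrightarrow> x \<le> t \<Longrightarrow> x \<in> spt_measure \<rho> \<Longrightarrow> norm (u x) \<le> S"
  shows "norm (nu_int s t u) \<le> S * mass s t"
proof -
  have l: "loc_bdd M (\<lambda>x. norm (u x))" if "locfin M" for M by (intro loc_bdd_norm loc_bdd_continuous that cu)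
  have 1: "intI M s t (\<lambda>x. norm (u x)) \<le> S * measure M {s<..t}"
    if "locfin M" "AE x in M. x \<in> spt_measure \<rho>" for M
    by (rule intI_le_AE[OF that(1) l[OF that(1)]]) (use that(2) S in \<open>auto elim!: eventually_mono\<close>)
  have a: "AE x in mp. x \<in> spt_measure \<rho>" "AE x in mn. x \<in> spt_measure \<rho>"
    using AE_spt_parts[OF loc_finiteD(1)[OF mu]] spt by (auto elim!: eventually_mono)
  note a' = AE_spt_parts[OF loc_finiteD(1)[OF rho]]
  have "abs_int u s t \<le> S * measure mp {s<..t} + S * measure mn {s<..t} + norm z * (S * measure rp {s<..t} + S * measure rn {s<..t})"
    unfolding abs_int_def by (intro add_mono mult_left_mono 1 lf a a') auto
  then have "abs_int u s t \<le> S * mass s t" by (simp add: mass_def algebra_simps)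
  then show ?thesis using nu_int_le_abs_int[OF cu, of s t] by linarith
qed

lemma quasi_sol_local_bound:
  assumes qs: "quasi_sol b \<Phi> u y" and om: "0 < \<omega>" "\<beta> * \<kappa> \<le> \<omega>\<^sup>2"
    and m: "norm (u t) \<le> m" "norm (y t) \<le> m" and x: "\<bar>x - t\<bar> \<le> L"
  shows "norm (u x) \<le> m * (2 * growth_const \<omega> * exp (\<omega> * L))" "norm (y x) \<le> m * (2 * growth_const \<omega> * exp (\<omega> * L))"
proof -
  have m0: "0 \<le> m" using m(1) norm_ge_zero order_trans by blast
  have bb: "\<bar>b x\<bar> \<le> \<beta>" for x using b_nonneg[of x] b_le[of x] by simp
  have e: "m * (growth_const \<omega> * exp (\<omega> * d)) \<le> m * (2 * growth_const \<omega> * exp (\<omega> * L))"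
    "2 * m * (growth_const \<omega> * exp (\<omega> * d)) \<le> m * (2 * growth_const \<omega> * exp (\<omega> * L))" if "d \<le> L" for d
  proof -
    have 1: "growth_const \<omega> * exp (\<omega> * d) \<le> growth_const \<omega> * exp (\<omega> * L)"
      using that om growth_const_pos[of \<omega>] by (intro mult_left_mono) auto
    have 2: "0 \<le> growth_const \<omega> * exp (\<omega> * L)" using growth_const_pos[of \<omega>] by simp
    have 3: "m * (growth_const \<omega> * exp (\<omega> * d)) \<le> m * (growth_const \<omega> * exp (\<omega> * L))" by (rule mult_left_mono[OF 1 m0])
    have "0 \<le> m * (growth_const \<omega> * exp (\<omega> * L))" using m0 2 by simp
    with 3 show "m * (growth_const \<omega> * exp (\<omega> * d)) \<le> m * (2 * growth_const \<omega> * exp (\<omega> * L))"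
      "2 * m * (growth_const \<omega> * exp (\<omega> * d)) \<le> m * (2 * growth_const \<omega> * exp (\<omega> * L))" by (simp_all add: mult_ac)
  qed
  show "norm (u x) \<le> m * (2 * growth_const \<omega> * exp (\<omega> * L))" "norm (y x) \<le> m * (2 * growth_const \<omega> * exp (\<omega> * L))"
  proof -
    show "norm (u x) \<le> m * (2 * growth_const \<omega> * exp (\<omega> * L))"
    proof (cases "t \<le> x")
      case True
      then show ?thesis using quasi_sol_growth(1)[OF qs bb om m True] e(1)[of "x - t"] x by linarith
    next
      case False
      then show ?thesis using quasi_sol_backward(1)[OF qs om _ m, of x] e(2)[of "t - x"] x by linarith
    qed
    show "norm (y x) \<le> m * (2 * growth_const \<omega> * exp (\<omega> * L))"
    proof (cases "t \<le> x")
      case True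
      then show ?thesis using quasi_sol_growth(2)[OF qs bb om m True] e(1)[of "x - t"] x by linarith
    next
      case False
      then show ?thesis using quasi_sol_backward(2)[OF qs om _ m, of x] e(2)[of "t - x"] x by linarith
    qed
  qed
qed

text \<open>
  If \<open>u\<close> is small on the support of \<open>\<rho>\<close>, then \<open>y\<close> is almost constant, as \<open>\<nu>\<close> is concentrated there.
  Comparing \<open>u\<close> at two points of the support a period apart shows that the constant is small,
  because the integral of \<open>b\<close> over a period is at least \<open>q / \<alpha>\<close>.
\<close>

lemma window_estimate:
  assumes qs: "quasi_sol b \<Phi> u y" and S: "\<And>r. r \<in> spt_measure \<rho> \<Longrightarrow> t \<le> r \<Longrightarrow> r \<le> t + 2 * q \<Longrightarrow> norm (u r) \<le> S"
  defines "V \<equiv> \<kappa> * (2 * q + 1)"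
  defines "C1 \<equiv> \<alpha> / q * (2 + \<beta> * q * V)"
  shows "norm (y t) \<le> C1 * S" "norm (u t) \<le> (1 + \<beta> * q * (C1 + V)) * S"
proof -
  have au: "prim_of u (\<lambda>x. b x *\<^sub>R y x)" using qs by (simp add: quasi_sol_def)
  have cu: "continuous_on UNIV u" by (rule prim_of_continuous[OF au])
  obtain r0 where r0: "r0 \<in> spt_measure \<rho>" "t \<le> r0" "r0 \<le> t + q" using spt_meets by blast
  have r1: "r0 + q \<in> spt_measure \<rho>" using spt_shift[of r0 1] r0 by simp
  have S0: "0 \<le> S" using S[OF r0(1)] r0 q_pos norm_ge_zero[of "u r0"] by linarith
  have V0: "0 \<le> V" using kappa_nonneg q_pos by (simp add: V_def)
  have yd: "norm (y x - y t) \<le> S * V" if x: "t \<le> x" "x \<le> t + 2 * q" for x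
  proof -
    have "norm (y x - y t) \<le> S * mass t x"
      unfolding quasi_sol_nu_int[OF qs x(1)] by (rule nu_int_le_spt[OF cu]) (use S x in auto)
    also have "\<dots> \<le> S * V"
    proof (intro mult_left_mono S0)
      have "mass t x \<le> \<kappa> * (x - t + 1)" by (rule mass_le[OF x(1)])
      also have "\<dots> \<le> V" unfolding V_def using x kappa_nonneg by (intro mult_left_mono) auto
      finally show "mass t x \<le> V" .
    qed
    finally show ?thesis .
  qed
  have ly: "loc_bdd lebesgue y" by (rule quasi_sol_loc_bdd[OF qs])
  have lby: "loc_bdd lebesgue (\<lambda>x. b x *\<^sub>R y x)" by (rule prim_ofD(1)[OF au])
  have bb: "\<bar>b x\<bar> \<le> \<beta>" for x using b_nonneg[of x] b_le[of x] by simp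
  show y1: "norm (y t) \<le> C1 * S"
  proof -
    let ?I = "intI lebesgue r0 (r0 + q)"
    have "?I (\<lambda>x. b x *\<^sub>R (y x - y t)) = ?I (\<lambda>x. b x *\<^sub>R y x) - ?I b *\<^sub>R y t"
    proof -
      have "?I (\<lambda>x. b x *\<^sub>R y t) = ?I b *\<^sub>R y t" by (rule intI_scaleR_left[OF locfin_lebesgue loc_bdd_b])
      then show ?thesis
        using intI_diff[OF locfin_lebesgue lby loc_bdd_scaleR[OF loc_bdd_b loc_bdd_const[of _ "y t"]], of r0 "r0 + q"]
        by (simp add: scaleR_diff_right)
    qed
    then have eq: "?I b *\<^sub>R y t = (u (r0 + q) - u r0) - ?I (\<lambda>x. b x *\<^sub>R (y x - y t))"
      using prim_ofD(2)[OF au, of r0 "r0 + q"] q_pos by simp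
    have "norm (?I b *\<^sub>R y t) \<le> norm (u (r0 + q)) + norm (u r0) + norm (?I (\<lambda>x. b x *\<^sub>R (y x - y t)))"
      unfolding eq by (rule order_trans[OF norm_triangle_ineq4 add_right_mono[OF norm_triangle_ineq4]])
    moreover have "norm (?I (\<lambda>x. b x *\<^sub>R (y x - y t))) \<le> \<beta> * (S * V) * measure lebesgue {r0<..r0 + q}"
    proof (rule intI_bound[OF locfin_lebesgue])
      show "loc_bdd lebesgue (\<lambda>x. b x *\<^sub>R (y x - y t))" by (intro loc_bdd_intros loc_bdd_b ly)
      fix x assume "r0 < x" "x \<le> r0 + q"
      then show "norm (b x *\<^sub>R (y x - y t)) \<le> \<beta> * (S * V)"
        using r0 by (auto intro!: mult_mono bb yd simp: beta less_imp_le)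
    qed
    moreover have "measure lebesgue {r0<..r0 + q} = q" using measure_lebesgue_Ioc[of r0 "r0 + q"] q_pos by simp
    moreover have "norm (u (r0 + q)) \<le> S" "norm (u r0) \<le> S" using r0 r1 q_pos by (auto intro!: S)
    moreover have "q / \<alpha> \<le> ?I b"
    proof -
      have "?I (\<lambda>x. 1 / \<alpha>) \<le> ?I b" by (rule intI_mono[OF locfin_lebesgue loc_bdd_const loc_bdd_b b_ge])
      then show ?thesis using measure_lebesgue_Ioc[of r0 "r0 + q"] q_pos by (simp add: intI_const[OF locfin_lebesgue])
    qed
    moreover have "norm (?I b *\<^sub>R y t) = \<bar>?I b\<bar> * norm (y t)" by simp
    ultimately have "\<bar>?I b\<bar> * norm (y t) \<le> S * (2 + \<beta> * q * V)" and Ib: "q / \<alpha> \<le> ?I b"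
      by (simp_all add: algebra_simps)
    moreover have "q / \<alpha> * norm (y t) \<le> \<bar>?I b\<bar> * norm (y t)" using Ib by (intro mult_right_mono) auto
    ultimately have "q / \<alpha> * norm (y t) \<le> S * (2 + \<beta> * q * V)" by linarith
    then have "\<alpha> / q * (q / \<alpha> * norm (y t)) \<le> \<alpha> / q * (S * (2 + \<beta> * q * V))"
      using alpha q_pos by (intro mult_left_mono) auto
    then show ?thesis using alpha q_pos by (simp add: C1_def mult_ac)
  qed
  show "norm (u t) \<le> (1 + \<beta> * q * (C1 + V)) * S"
  proof -
    have C10: "0 \<le> C1 + V" using alpha q_pos beta V0 by (simp add: C1_def)
    have "norm (u r0 - u t) \<le> (\<beta> * ((C1 + V) * S)) * (r0 - t)"
    proof (rule prim_of_lipschitz[OF au r0(2)])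
      fix x assume x: "t < x" "x \<le> r0"
      have "norm (y x) \<le> norm (y t) + norm (y x - y t)" by (metis add.commute diff_add_cancel norm_triangle_ineq)
      also have "\<dots> \<le> C1 * S + S * V" using x r0 q_pos by (intro add_mono y1 yd) auto
      finally have "norm (y x) \<le> (C1 + V) * S" by (simp add: algebra_simps)
      then show "norm (b x *\<^sub>R y x) \<le> \<beta> * ((C1 + V) * S)"
        using bb[of x] beta by (auto intro!: mult_mono)
    qed
    also have "\<dots> \<le> (\<beta> * ((C1 + V) * S)) * q"
      using r0 beta C10 S0 by (intro mult_left_mono) auto
    finally have "norm (u t) \<le> norm (u r0) + (\<beta> * ((C1 + V) * S)) * q"
      using norm_triangle_ineq2[of "u t" "u r0"] by (simp add: norm_minus_commute)
    moreover have "norm (u r0) \<le> S" using r0 q_pos by (intro S) auto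
    ultimately show ?thesis by (simp add: algebra_simps)
  qed
qed

text \<open>
  Let \<open>m\<close> be the size of \<open>(u, y)\<close> at \<open>t\<close>.  On a window around \<open>t\<close> the function \<open>u\<close> has a Lipschitz
  constant proportional to \<open>m\<close>, so \<open>u\<close> is at most \<open>\<tau> + const * \<delta> * m\<close> on the support.  Lemma
  \<open>window_estimate\<close> turns this into \<open>m \<le> C * \<tau> + m / 2\<close> if \<open>\<delta>\<close> is chosen small.
\<close>

lemma quasi_sol_decay:
  assumes qs: "quasi_sol b \<Phi> u y" and om: "0 < \<omega>" "\<beta> * \<kappa> \<le> \<omega>\<^sup>2"
    and int: "integrable (variation_measure \<rho>) (\<lambda>x. norm (u x) powr p)" and p: "0 < p" and eps: "0 < \<epsilon>"
  shows "\<exists>X. \<forall>t. X \<le> \<bar>t\<bar> \<longrightarrow> norm (u t) \<le> \<epsilon> \<and> norm (y t) \<le> \<epsilon>"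
proof -
  have au: "prim_of u (\<lambda>x. b x *\<^sub>R y x)" using qs by (simp add: quasi_sol_def)
  define V where "V = \<kappa> * (2 * q + 1)"
  define C1 where "C1 = \<alpha> / q * (2 + \<beta> * q * V)"
  define C where "C = C1 + (1 + \<beta> * q * (C1 + V))"
  define K where "K = 2 * growth_const \<omega> * exp (\<omega> * (2 * q + 1))"
  have V0: "0 \<le> V" using kappa_nonneg q_pos by (simp add: V_def)
  have C10: "0 \<le> C1" using alpha q_pos beta V0 by (simp add: C1_def)
  have C0: "0 < C" using C10 V0 beta q_pos by (simp add: C_def add_nonneg_pos add_pos_nonneg)
  have K0: "0 < K" using growth_const_pos[of \<omega>] by (simp add: K_def)
  \<comment> \<open>Small enough for the term proportional to \<open>m\<close> to be absorbed into the left-hand side.\<close>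
  define \<delta> where "\<delta> = min 1 (1 / (2 * C * \<beta> * K))"
  have d: "0 < \<delta>" "\<delta> \<le> 1" "C * (\<beta> * K * \<delta>) \<le> 1 / 2"
  proof -
    show "0 < \<delta>" "\<delta> \<le> 1" using C0 K0 beta by (auto simp: \<delta>_def)
    have "C * (\<beta> * K * \<delta>) \<le> C * (\<beta> * K * (1 / (2 * C * \<beta> * K)))"
      using C0 K0 beta by (intro mult_left_mono) (auto simp: \<delta>_def)
    also have "\<dots> = 1 / 2" using C0 K0 beta by simp
    finally show "C * (\<beta> * K * \<delta>) \<le> 1 / 2" .
  qed
  define \<tau> where "\<tau> = \<epsilon> / (2 * C)"
  have t0: "0 < \<tau>" using eps C0 by (simp add: \<tau>_def)
  obtain X where X: "\<And>r. r \<in> spt_measure \<rho> \<Longrightarrow> X \<le> \<bar>r\<bar> \<Longrightarrow> \<exists>x. \<bar>x - r\<bar> < \<delta> \<and> norm (u x) < \<tau>"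
    using small_near_spt[OF int p d(1) t0] by blast
  have bb: "\<bar>b x\<bar> \<le> \<beta>" for x using b_nonneg[of x] b_le[of x] by simp
  show ?thesis
  proof (intro exI[of _ "X + 2 * q"] allI impI)
    fix t assume t: "X + 2 * q \<le> \<bar>t\<bar>"
    define m where "m = max (norm (u t)) (norm (y t))"
    have m: "norm (u t) \<le> m" "norm (y t) \<le> m" and m0: "0 \<le> m" by (auto simp: m_def intro: max.coboundedI1)
    have loc: "norm (y x) \<le> m * K" if "\<bar>x - t\<bar> \<le> 2 * q + 1" for x
      unfolding K_def by (rule quasi_sol_local_bound[OF qs om m that])
    define S where "S = \<tau> + \<beta> * (m * K) * \<delta>"
    have uS: "norm (u r) \<le> S" if r: "r \<in> spt_measure \<rho>" "t \<le> r" "r \<le> t + 2 * q" for r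
    proof -
      have "X \<le> \<bar>r\<bar>" using t r by linarith
      then obtain x where x: "\<bar>x - r\<bar> < \<delta>" "norm (u x) < \<tau>" using X r by blast
      have B: "norm (b w *\<^sub>R y w) \<le> \<beta> * (m * K)" if "\<bar>w - t\<bar> \<le> 2 * q + 1" for w
        using bb[of w] loc[OF that] beta by (auto intro!: mult_mono)
      have "norm (u r - u x) \<le> \<beta> * (m * K) * \<bar>r - x\<bar>"
      proof (cases "x \<le> r")
        case True
        have "norm (u r - u x) \<le> \<beta> * (m * K) * (r - x)"
          by (rule prim_of_lipschitz[OF au True], rule B) (use x r d True q_pos in linarith)
        then show ?thesis using True by simp
      next
        case False
        have "norm (u x - u r) \<le> \<beta> * (m * K) * (x - r)"
          by (rule prim_of_lipschitz[OF au], use False in simp, rule B) (use x r d False q_pos in linarith)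
        then show ?thesis using False by (simp add: norm_minus_commute)
      qed
      also have "\<dots> \<le> \<beta> * (m * K) * \<delta>" using x(1) beta m0 K0 by (intro mult_left_mono) auto
      finally show ?thesis using x(2) norm_triangle_sub[of "u r" "u x"] unfolding S_def by linarith
    qed
    have S0: "0 \<le> S" using t0 beta m0 K0 d by (simp add: S_def)
    note w = window_estimate[OF qs, of t S, folded V_def, folded C1_def, OF uS]
    have "norm (y t) \<le> C * S" "norm (u t) \<le> C * S"
    proof -
      have "C1 * S \<le> C * S" "(1 + \<beta> * q * (C1 + V)) * S \<le> C * S"
        using S0 C10 V0 beta q_pos by (auto intro!: mult_right_mono simp: C_def)
      then show "norm (y t) \<le> C * S" "norm (u t) \<le> C * S" using w by linarith+
    qed
    then have "m \<le> C * S" by (simp add: m_def)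
    also have "C * S = C * \<tau> + C * (\<beta> * K * \<delta>) * m" by (simp add: S_def algebra_simps)
    also have "\<dots> \<le> C * \<tau> + 1 / 2 * m" by (intro add_left_mono mult_right_mono d m0)
    finally have "m \<le> 2 * (C * \<tau>)" by simp
    also have "\<dots> = \<epsilon>" using C0 by (simp add: \<tau>_def)
    finally show "norm (u t) \<le> \<epsilon> \<and> norm (y t) \<le> \<epsilon>" using m by linarith
  qed
qed

lemma quasi_sol_bounded:
  assumes qs: "quasi_sol b \<Phi> u y" and om: "0 < \<omega>" "\<beta> * \<kappa> \<le> \<omega>\<^sup>2"
    and int: "integrable (variation_measure \<rho>) (\<lambda>x. norm (u x) powr p)" and p: "0 < p"
  shows "\<exists>B. \<forall>x. norm (u x) \<le> B \<and> norm (y x) \<le> B"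
proof -
  obtain X where X: "\<And>t. X \<le> \<bar>t\<bar> \<Longrightarrow> norm (u t) \<le> 1 \<and> norm (y t) \<le> 1"
    using quasi_sol_decay[OF qs om int p zero_less_one] by blast
  obtain B1 where B1: "\<And>x. - X \<le> x \<Longrightarrow> x \<le> X \<Longrightarrow> norm (u x) \<le> B1" using loc_bdd_bound[OF quasi_sol_loc_bdd(1)[OF qs]] by metis
  obtain B2 where B2: "\<And>x. - X \<le> x \<Longrightarrow> x \<le> X \<Longrightarrow> norm (y x) \<le> B2" using loc_bdd_bound[OF quasi_sol_loc_bdd(2)[OF qs]] by metis
  show ?thesis
  proof (intro exI[of _ "max 1 (max B1 B2)"] allI)
    fix x
    show "norm (u x) \<le> max 1 (max B1 B2) \<and> norm (y x) \<le> max 1 (max B1 B2)"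
    proof (cases "X \<le> \<bar>x\<bar>")
      case True then show ?thesis using X[of x] by auto
    next
      case False
      then have "- X \<le> x" "x \<le> X" by auto
      then show ?thesis using B1[of x] B2[of x] by auto
    qed
  qed
qed

text \<open>
  On an interval where \<open>u\<close> vanishes, \<open>y\<close> is constant, and the constant is \<open>0\<close> since \<open>b > 0\<close>; zero data
  at one point are propagated in both directions.
\<close>

lemma quasi_sol_unique_continuation:
  assumes qs: "quasi_sol b \<Phi> u y" and om: "0 < \<omega>" "\<beta> * \<kappa> \<le> \<omega>\<^sup>2"
    and st: "s < t" and z: "\<And>x. s \<le> x \<Longrightarrow> x \<le> t \<Longrightarrow> u x = 0"
  shows "u x = 0"
proof -
  have au: "prim_of u (\<lambda>x. b x *\<^sub>R y x)" using qs by (simp add: quasi_sol_def)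
  have cu: "continuous_on UNIV u" by (rule prim_of_continuous[OF au])
  have yc: "y x = y s" if "s \<le> x" "x \<le> t" for x
  proof -
    have "norm (nu_int s x u) \<le> 0 * mass s x" by (rule order_trans[OF nu_int_le_abs_int[OF cu] abs_int_le[OF cu]]) (use z that in auto)
    then show ?thesis using quasi_sol_nu_int[OF qs that(1)] by simp
  qed
  have "intI lebesgue s t (\<lambda>x. b x *\<^sub>R y x) = 0" using prim_ofD(2)[OF au, of s t] z st by simp
  moreover have "intI lebesgue s t (\<lambda>x. b x *\<^sub>R y x) = intI lebesgue s t (\<lambda>x. b x *\<^sub>R y s)"
  proof (rule intI_cong)
    fix x assume "s < x" "x \<le> t"
    then show "b x *\<^sub>R y x = b x *\<^sub>R y s" using yc[of x] by simp
  qed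
  moreover have "intI lebesgue s t (\<lambda>x. b x *\<^sub>R y s) = intI lebesgue s t b *\<^sub>R y s"
    by (rule intI_scaleR_left[OF locfin_lebesgue loc_bdd_b])
  moreover have "0 < intI lebesgue s t b"
  proof -
    have "0 < (t - s) / \<alpha>" using st alpha by simp
    also have "\<dots> = intI lebesgue s t (\<lambda>x. 1 / \<alpha>)"
      using measure_lebesgue_Ioc[of s t] st by (simp add: intI_const[OF locfin_lebesgue])
    also have "\<dots> \<le> intI lebesgue s t b" by (rule intI_mono[OF locfin_lebesgue loc_bdd_const loc_bdd_b b_ge])
    finally show ?thesis .
  qed
  ultimately have "y s = 0" by simp
  then have "norm (u s) \<le> 0" "norm (y s) \<le> 0" using z[of s] st by auto
  from quasi_sol_local_bound(1)[OF qs om this order_refl, of x] show ?thesis by simp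
qed

end

section \<open>The dual Lipschitz norm\<close>

text \<open>
  A disjoint family in \<open>B\<close> is translated to a disjoint family in \<open>B + p\<close>.
\<close>

lemma loc_finite_diff_shift:
  fixes p :: real
  assumes "loc_finite \<mu>"
  defines "\<sigma> \<equiv> \<lambda>B. \<mu> B - shift_measure p \<mu> B"
  shows "loc_finite \<sigma>"
  unfolding loc_finite_def
proof (intro conjI allI)
  note lm = loc_finiteD(1)[OF assms(1)]
  have img: "(\<lambda>x. x + p) ` A \<in> sets borel" if "A \<in> sets borel" for A :: "real set"
  proof -
    have "(\<lambda>x. x + p) ` A = (\<lambda>x. x - p) -` A"
    proof
      show "(\<lambda>x. x - p) -` A \<subseteq> (\<lambda>x. x + p) ` A"
      proof
        fix x assume "x \<in> (\<lambda>x. x - p) -` A"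
        then show "x \<in> (\<lambda>x. x + p) ` A" by (intro image_eqI[of _ _ "x - p"]) auto
      qed
    qed auto
    moreover have "(\<lambda>x::real. x - p) -` A \<inter> space borel \<in> sets borel" by (rule measurable_sets[OF _ that]) simp
    ultimately show ?thesis by simp
  qed
  have bd: "bounded ((\<lambda>x. x + p) ` A)" if "bounded A" for A :: "real set"
    using bounded_translation[OF that, of p] by (simp add: add.commute)
  show "local_measure \<sigma>"
    unfolding local_measure_def
  proof (intro allI impI conjI)
    fix K :: "real set" assume K: "compact K"
    show "\<sigma> ({} \<inter> K) = 0" by (simp add: \<sigma>_def shift_measure_def local_measure_empty[OF lm])
    fix A :: "nat \<Rightarrow> real set" assume A: "range A \<subseteq> sets borel" "disjoint_family A"
    have Kb: "bounded K" "K \<in> sets borel" using K by (auto simp: compact_imp_bounded compact_imp_closed borel_closed)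
    have 1: "(\<lambda>n. \<mu> (A n \<inter> K)) sums \<mu> (\<Union>n. A n \<inter> K)"
    proof (rule local_measure_sums[OF lm])
      show "A n \<inter> K \<in> sets borel" for n using A Kb by auto
      show "disjoint_family (\<lambda>n. A n \<inter> K)" using A(2) unfolding disjoint_family_on_def by blast
      show "bounded (\<Union>n. A n \<inter> K)" by (rule bounded_subset[OF Kb(1)]) auto
    qed
    have 2: "(\<lambda>n. \<mu> ((\<lambda>x. x + p) ` (A n \<inter> K))) sums \<mu> (\<Union>n. (\<lambda>x. x + p) ` (A n \<inter> K))"
    proof (rule local_measure_sums[OF lm])
      show "(\<lambda>x. x + p) ` (A n \<inter> K) \<in> sets borel" for n using A Kb by (intro img) auto
      show "disjoint_family (\<lambda>n. (\<lambda>x. x + p) ` (A n \<inter> K))"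
        unfolding disjoint_family_on_def
      proof (intro ballI impI)
        fix m n :: nat assume "m \<noteq> n"
        then have "A m \<inter> A n = {}" using disjoint_family_onD[OF A(2), of m n] by simp
        then show "(\<lambda>x. x + p) ` (A m \<inter> K) \<inter> (\<lambda>x. x + p) ` (A n \<inter> K) = {}" by auto
      qed
      show "bounded (\<Union>n. (\<lambda>x. x + p) ` (A n \<inter> K))" by (rule bounded_subset[OF bd[OF Kb(1)]]) auto
    qed
    have e: "(\<Union>n. A n \<inter> K) = (\<Union>n. A n) \<inter> K" "(\<Union>n. (\<lambda>x. x + p) ` (A n \<inter> K)) = (\<lambda>x. x + p) ` ((\<Union>n. A n) \<inter> K)" by auto
    show "(\<lambda>n. \<sigma> (A n \<inter> K)) sums \<sigma> ((\<Union>n. A n) \<inter> K)"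
      using sums_diff[OF 1 2] unfolding e \<sigma>_def shift_measure_def .
  qed
  fix s t
  have "variation \<sigma> {s<..t} \<le> variation \<mu> {s<..t} + variation \<mu> {s + p<..t + p}"
    unfolding variation_def[of \<sigma>]
  proof (rule SUP_least)
    fix P assume P: "P \<in> {P. finite P \<and> disjoint P \<and> P \<subseteq> {E \<in> bounded_borel. E \<subseteq> {s<..t}}}"
    let ?f = "\<lambda>E::real set. (\<lambda>x. x + p) ` E"
    have inj: "inj_on ?f P" by (auto intro!: inj_onI simp: inj_image_eq_iff)
    have "(\<Sum>E\<in>P. ennreal \<bar>\<sigma> E\<bar>) \<le> (\<Sum>E\<in>P. ennreal \<bar>\<mu> E\<bar> + ennreal \<bar>\<mu> (?f E)\<bar>)"
      by (intro sum_mono) (auto simp: \<sigma>_def shift_measure_def ennreal_plus[symmetric] simp del: ennreal_plus intro!: ennreal_leI)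
    also have "\<dots> = (\<Sum>E\<in>P. ennreal \<bar>\<mu> E\<bar>) + (\<Sum>E\<in>?f ` P. ennreal \<bar>\<mu> E\<bar>)"
      by (simp add: sum.distrib sum.reindex[OF inj])
    also have "\<dots> \<le> variation \<mu> {s<..t} + variation \<mu> {s + p<..t + p}"
    proof (rule add_mono)
      show "(\<Sum>E\<in>P. ennreal \<bar>\<mu> E\<bar>) \<le> variation \<mu> {s<..t}"
        unfolding variation_def using P by (intro SUP_upper) auto
      have "?f E \<in> bounded_borel" if "E \<in> P" for E using P that img[of E] bd[of E] by (auto simp: bounded_borel_def)
      moreover have "?f E \<subseteq> {s + p<..t + p}" if "E \<in> P" for E using P that by fastforce
      moreover have "disjoint (?f ` P)"
        unfolding disjoint_def
      proof (intro ballI impI)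
        fix a b assume "a \<in> ?f ` P" "b \<in> ?f ` P" "a \<noteq> b"
        then obtain E F where EF: "E \<in> P" "F \<in> P" "a = ?f E" "b = ?f F" "E \<noteq> F" by auto
        then have "E \<inter> F = {}" using P unfolding disjoint_def by blast
        then show "a \<inter> b = {}" unfolding EF by auto
      qed
      ultimately show "(\<Sum>E\<in>?f ` P. ennreal \<bar>\<mu> E\<bar>) \<le> variation \<mu> {s + p<..t + p}"
        unfolding variation_def using P by (intro SUP_upper) auto
    qed
    finally show "(\<Sum>E\<in>P. ennreal \<bar>\<sigma> E\<bar>) \<le> variation \<mu> {s<..t} + variation \<mu> {s + p<..t + p}" .
  qed
  also have "\<dots> < \<infinity>" using loc_finiteD(2)[OF assms(1)] by (simp add: less_top)
  finally show "variation \<sigma> {s<..t} < \<infinity>" .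
qed

lemma dist_fun_diff_shift:
  fixes p :: real
  assumes "loc_finite \<mu>" 
  defines "\<sigma> \<equiv> \<lambda>B. \<mu> B - shift_measure p \<mu> B"
  shows "dist_fun \<mu> t - dist_fun \<mu> (t + p) - (dist_fun \<mu> s - dist_fun \<mu> (s + p)) = dist_fun \<sigma> t - dist_fun \<sigma> s"
proof -
  have ls: "loc_finite \<sigma>" unfolding \<sigma>_def by (rule loc_finite_diff_shift[OF assms(1)])
  have im: "(\<lambda>x. x + p) ` {s<..t} = {s + p<..t + p}" for s t
  proof
    show "{s + p<..t + p} \<subseteq> (\<lambda>x. x + p) ` {s<..t}"
    proof
      fix x assume "x \<in> {s + p<..t + p}"
      then show "x \<in> (\<lambda>x. x + p) ` {s<..t}" by (intro image_eqI[of _ _ "x - p"]) auto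
    qed
  qed auto
  have main: "dist_fun \<mu> t - dist_fun \<mu> (t + p) - (dist_fun \<mu> s - dist_fun \<mu> (s + p)) = dist_fun \<sigma> t - dist_fun \<sigma> s" if "s \<le> t" for s t
  proof -
    have "dist_fun \<sigma> t - dist_fun \<sigma> s = \<mu> {s<..t} - \<mu> {s + p<..t + p}"
      unfolding dist_fun_diff[OF ls that] unfolding \<sigma>_def shift_measure_def im ..
    also have "\<dots> = (dist_fun \<mu> t - dist_fun \<mu> s) - (dist_fun \<mu> (t + p) - dist_fun \<mu> (s + p))"
      using dist_fun_diff[OF assms(1) that] dist_fun_diff[OF assms(1), of "s + p" "t + p"] that by simp
    finally show ?thesis by simp
  qed
  show ?thesis
  proof (cases "s \<le> t")
    case True then show ?thesis by (rule main)
  next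
    case False then show ?thesis using main[of t s] by simp
  qed
qed

text \<open>
  The indefinite integral \<open>G\<close> of \<open>g\<close> is an admissible test function since \<open>g\<close> has mean \<open>0\<close>, and
  integration by parts moves the derivative from the distribution function to \<open>G\<close>.
\<close>

lemma local_norm_test:
  fixes n :: real and g :: "real \<Rightarrow> real"
  assumes sig: "loc_finite \<sigma>" and n: "local_norm TYPE('k::{real_normed_field, banach, second_countable_topology}) I \<sigma> \<le> ennreal n" "0 \<le> n"
    and e: "{e..e + 2} \<subseteq> I" and g: "loc_bdd lebesgue g" "\<And>x. \<bar>g x\<bar> \<le> 1" "intI lebesgue e (e + 2) g = 0"
  shows "\<bar>intI lebesgue e (e + 2) (\<lambda>x. dist_fun \<sigma> x * g x)\<bar> \<le> n"
proof -
  define g' where "g' x = indicator {e<..e + 2} x * g x" for x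
  have g'1: "\<bar>g' x\<bar> \<le> 1" for x using g(2)[of x] by (simp add: g'_def indicator_def)
  have lg': "loc_bdd lebesgue g'"
    unfolding loc_bdd_def
  proof (intro conjI allI)
    show "g' \<in> borel_measurable lebesgue"
      unfolding g'_def by (intro borel_measurable_times borel_measurable_indicator loc_bddD[OF g(1)]) simp
  qed (use g'1 in auto)
  define G where "G t = indef_int g' t - indef_int g' e" for t
  have aG: "prim_of G g'" using prim_of_diff[OF prim_of_indef_int[OF lg'] prim_of_const[of "indef_int g' e"]] by (simp add: G_def[abs_def])
  define U :: "real \<Rightarrow> 'k" where "U x = of_real (G x)" for x
  have aU: "prim_of U (\<lambda>x. of_real (g' x))" unfolding U_def by (rule prim_of_bounded_linear[OF bounded_linear_of_real aG])
  have Ge: "G e = 0" by (simp add: G_def)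
  have z: "intI lebesgue s t g' = 0" if "t \<le> e \<or> e + 2 \<le> s" for s t
    using intI_cong[of s t g' "\<lambda>x. 0" lebesgue] that by (auto simp: g'_def)
  have gg: "intI lebesgue e (e + 2) g' = 0"
    using intI_cong[of e "e + 2" g' g lebesgue] g(3) by (simp add: g'_def)
  have Ge2: "G (e + 2) = 0" using prim_ofD(2)[OF aG, of e "e + 2"] Ge gg by simp
  have Gz: "G t = 0" if "t \<notin> {e<..<e + 2}" for t
  proof -
    have "t \<le> e \<or> e + 2 \<le> t" using that by auto
    then consider "t \<le> e" | "e + 2 \<le> t" by blast
    then show ?thesis
    proof cases
      case 1 then show ?thesis using prim_ofD(2)[OF aG, of t e] Ge z[of e t] by simp
    next
      case 2 then show ?thesis using prim_ofD(2)[OF aG, of "e + 2" t] Ge2 z[of t "e + 2"] by simp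
    qed
  qed
  have sp: "spt_fun U \<subseteq> {e..e + 2}"
    unfolding spt_fun_def
  proof (rule closure_minimal)
    show "{x. U x \<noteq> 0} \<subseteq> {e..e + 2}"
    proof
      fix x assume "x \<in> {x. U x \<noteq> 0}"
      then have "G x \<noteq> 0" by (simp add: U_def)
      then show "x \<in> {e..e + 2}" using Gz[of x] by force
    qed
  qed simp
  have "ennreal (norm (integral_lm \<sigma> UNIV U)) \<le> local_norm TYPE('k) I \<sigma>"
    unfolding local_norm_def
  proof (rule SUP_upper, intro CollectI conjI exI)
    show "spt_fun U \<subseteq> I" using sp e by blast
    show "bounded (spt_fun U)" by (rule bounded_subset[OF _ sp]) simp
    have "diameter (spt_fun U) \<le> diameter {e..e + 2}" by (rule diameter_subset[OF sp]) simp
    then show "diameter (spt_fun U) \<le> 2" by simp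
    show "W11loc U (\<lambda>x. of_real (g' x))" by (rule prim_of_W11loc[OF aU])
    show "AE x in lebesgue. norm (of_real (g' x) :: 'k) \<le> 1" using g'1 by simp
  qed
  then have "norm (integral_lm \<sigma> UNIV U) \<le> n" using n by (meson ennreal_le_iff order_trans)
  moreover have "integral_lm \<sigma> UNIV U = integral_lm \<sigma> {e<..e + 2} U"
  proof -
    have "(\<lambda>x. indicator UNIV x *\<^sub>R U x) = (\<lambda>x. indicator {e<..e + 2} x *\<^sub>R U x)"
      using Gz by (fastforce simp: fun_eq_iff indicator_def U_def)
    then show ?thesis unfolding integral_lm_def set_lebesgue_integral_def by (simp only:)
  qed
  moreover have "integral_lm \<sigma> {e<..e + 2} U = - of_real (intI lebesgue e (e + 2) (\<lambda>x. dist_fun \<sigma> x * g x))"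
  proof -
    have "integral_lm \<sigma> {e<..e + 2} U = - intI lebesgue e (e + 2) (\<lambda>x. dist_fun \<sigma> x *\<^sub>R of_real (g' x))"
      by (subst integral_lm_by_parts[OF sig aU]) (simp_all add: U_def Ge Ge2)
    also have "intI lebesgue e (e + 2) (\<lambda>x. dist_fun \<sigma> x *\<^sub>R of_real (g' x) :: 'k) = intI lebesgue e (e + 2) (\<lambda>x. (dist_fun \<sigma> x * g x) *\<^sub>R (1::'k))"
      by (rule intI_cong) (simp add: g'_def scaleR_conv_of_real)
    also have "\<dots> = intI lebesgue e (e + 2) (\<lambda>x. dist_fun \<sigma> x * g x) *\<^sub>R 1"
      by (rule intI_scaleR_left[OF locfin_lebesgue loc_bdd_mult[OF loc_bdd_dist_fun[OF sig locfin_lebesgue] g(1)]])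
    finally show ?thesis by (simp add: of_real_def)
  qed
  ultimately show ?thesis by simp
qed

text \<open>
  Test with the sign of \<open>\<psi> - m\<close>, where \<open>m\<close> is the mean of \<open>\<psi>\<close>.  Subtracting its own mean and halving
  makes it admissible; subtracting constants does not matter since \<open>\<psi> - m\<close> has mean \<open>0\<close>.
\<close>

lemma oscillation_by_duality:
  fixes \<psi> :: "real \<Rightarrow> real"
  assumes l: "loc_bdd lebesgue \<psi>"
    and test: "\<And>g. loc_bdd lebesgue g \<Longrightarrow> (\<And>x. \<bar>g x\<bar> \<le> 1) \<Longrightarrow> intI lebesgue e (e + 2) g = 0 \<Longrightarrow>
      \<bar>intI lebesgue e (e + 2) (\<lambda>x. \<psi> x * g x)\<bar> \<le> n"
  shows "\<exists>m. intI lebesgue e (e + 2) (\<lambda>x. \<bar>\<psi> x - m\<bar>) \<le> 2 * n"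
proof -
  let ?I = "intI lebesgue e (e + 2)"
  define m where "m = ?I \<psi> / 2"
  define g0 where "g0 x = sgn (\<psi> x - m)" for x
  have g01: "\<bar>g0 x\<bar> \<le> 1" for x by (simp add: g0_def sgn_if)
  have lg0: "loc_bdd lebesgue g0"
    unfolding loc_bdd_def
  proof (intro conjI allI)
    have "(\<lambda>x. \<psi> x - m) \<in> borel_measurable lebesgue" using loc_bddD[OF l] by simp
    then show "g0 \<in> borel_measurable lebesgue"
      unfolding g0_def by (rule measurable_compose[OF _ borel_measurable_sgn])
  qed (use g01 in auto)
  define c where "c = ?I g0 / 2"
  have ml: "measure lebesgue {e<..e + 2} = 2" using measure_lebesgue_Ioc[of e "e + 2"] by simp
  have c1: "\<bar>c\<bar> \<le> 1"
    using intI_bound[OF locfin_lebesgue lg0, of e "e + 2" 1] g01 unfolding c_def ml by simp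
  define g where "g x = (g0 x - c) / 2" for x
  have ci: "?I (\<lambda>x. k) = 2 * k" for k :: real unfolding intI_const[OF locfin_lebesgue] ml by simp
  have lg: "loc_bdd lebesgue g"
  proof -
    have "loc_bdd lebesgue (\<lambda>x. (1/2) *\<^sub>R (g0 x - c))" by (intro loc_bdd_intros lg0)
    then show ?thesis by (simp add: g_def[abs_def])
  qed
  have "\<bar>?I (\<lambda>x. \<psi> x * g x)\<bar> \<le> n"
  proof (rule test[OF lg])
    show "\<bar>g x\<bar> \<le> 1" for x using g01[of x] c1 by (simp add: g_def)
    have "?I g = ?I (\<lambda>x. g0 x - c) / 2" unfolding g_def by simp
    also have "?I (\<lambda>x. g0 x - c) = ?I g0 - 2 * c" by (simp add: intI_diff lg0 ci)
    finally show "?I g = 0" by (simp add: c_def)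
  qed
  moreover have "?I (\<lambda>x. \<bar>\<psi> x - m\<bar>) = 2 * ?I (\<lambda>x. \<psi> x * g x)"
  proof -
    have lp: "loc_bdd lebesgue (\<lambda>x. \<psi> x * g0 x)" by (intro loc_bdd_intros l lg0)
    have "?I (\<lambda>x. \<bar>\<psi> x - m\<bar>) = ?I (\<lambda>x. \<psi> x * g0 x - m * g0 x)"
      by (rule intI_cong) (simp add: g0_def sgn_if algebra_simps)
    also have "\<dots> = ?I (\<lambda>x. \<psi> x * g0 x) - ?I (\<lambda>x. m * g0 x)"
      by (rule intI_diff[OF locfin_lebesgue lp]) (intro loc_bdd_intros lg0)
    also have "\<dots> = ?I (\<lambda>x. \<psi> x * g0 x) - 2 * m * c" by (simp add: c_def)
    also have "\<dots> = ?I (\<lambda>x. \<psi> x * g0 x) - ?I (\<lambda>x. c * \<psi> x)" by (simp add: m_def)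
    also have "\<dots> = ?I (\<lambda>x. \<psi> x * g0 x - c * \<psi> x)"
      by (rule intI_diff[OF locfin_lebesgue lp, symmetric]) (intro loc_bdd_intros l)
    also have "\<dots> = ?I (\<lambda>x. 2 * (\<psi> x * g x))"
      by (rule intI_cong) (simp add: g_def algebra_simps)
    finally show ?thesis by simp
  qed
  ultimately show ?thesis by (intro exI[of _ m]) linarith
qed

text \<open>
  Windows of length \<open>2\<close> overlap in intervals of length \<open>1\<close>, so the optimal constants of neighbouring
  windows differ by at most \<open>4 * n\<close>.  Hence one constant serves all unit intervals with a bound that grows
  only linearly with the distance, and the whole interval with a quadratic bound.
\<close>

lemma oscillation_chain:
  fixes \<psi> :: "real \<Rightarrow> real"
  assumes l: "loc_bdd lebesgue \<psi>" and n: "0 < n" and L: "2 \<le> L"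
    and osc: "\<And>e. a \<le> e \<Longrightarrow> e + 2 \<le> a + L \<Longrightarrow> \<exists>m. intI lebesgue e (e + 2) (\<lambda>x. \<bar>\<psi> x - m\<bar>) \<le> 2 * n"
  shows "\<exists>c. (\<forall>x k. a \<le> x \<longrightarrow> x \<le> a + real k \<longrightarrow> x + 1 \<le> a + L \<longrightarrow>
      intI lebesgue x (x + 1) (\<lambda>x. \<bar>\<psi> x - c\<bar>) \<le> 2 * n + 4 * n * real k) \<and>
    (\<forall>k. L \<le> real k + 1 \<longrightarrow> intI lebesgue a (a + L) (\<lambda>x. \<bar>\<psi> x - c\<bar>) \<le> (real k + 1) * (2 * n + 4 * n * real k))"
proof -
  have la: "loc_bdd lebesgue (\<lambda>x. \<bar>\<psi> x - c\<bar>)" for c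
    using loc_bdd_norm[OF loc_bdd_diff[OF l loc_bdd_const[of _ c]]] by simp
  have sub: "intI lebesgue x' y' (\<lambda>x. \<bar>\<psi> x - c\<bar>) \<le> intI lebesgue x y (\<lambda>x. \<bar>\<psi> x - c\<bar>)"
    if "x \<le> x'" "x' \<le> y'" "y' \<le> y" for x x' y' y c
  proof -
    note cc = intI_combine[OF locfin_lebesgue la[of c]]
    have "0 \<le> intI lebesgue x x' (\<lambda>x. \<bar>\<psi> x - c\<bar>)" "0 \<le> intI lebesgue y' y (\<lambda>x. \<bar>\<psi> x - c\<bar>)"
      by (rule intI_nonneg, simp)+
    then show ?thesis using cc[of x x' y'] cc[of x y' y] that by simp
  qed
  obtain c where c: "intI lebesgue a (a + 2) (\<lambda>x. \<bar>\<psi> x - c\<bar>) \<le> 2 * n" using osc[of a] L by auto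
  have c1: "intI lebesgue x (x + 1) (\<lambda>x. \<bar>\<psi> x - c\<bar>) \<le> 2 * n + 4 * n * real k"
    if "a \<le> x" "x \<le> a + real k" "x + 1 \<le> a + L" for x k
    using that
  proof (induction k arbitrary: x)
    case 0
    then have "x = a" by simp
    then show ?case using sub[of a a "a + 1" "a + 2" c] c by simp
  next
    case (Suc k)
    define x' where "x' = max a (x - 1)"
    have x': "a \<le> x'" "x' \<le> a + real k" "x' + 2 \<le> a + L" "x' \<le> x" "x \<le> x' + 1"
      using Suc.prems L by (auto simp: x'_def)
    obtain m where m: "intI lebesgue x' (x' + 2) (\<lambda>x. \<bar>\<psi> x - m\<bar>) \<le> 2 * n" using osc[OF x'(1,3)] by blast
    have IH: "intI lebesgue x' (x' + 1) (\<lambda>x. \<bar>\<psi> x - c\<bar>) \<le> 2 * n + 4 * n * real k"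
      by (rule Suc.IH[OF x'(1,2)]) (use x' in simp)
    have tri: "intI lebesgue y (y + 1) (\<lambda>x. \<bar>\<psi> x - p\<bar>) \<le> intI lebesgue y (y + 1) (\<lambda>x. \<bar>\<psi> x - r\<bar>) + \<bar>p - r\<bar>" for y p r
    proof -
      have "intI lebesgue y (y + 1) (\<lambda>x. \<bar>\<psi> x - p\<bar>) \<le> intI lebesgue y (y + 1) (\<lambda>x. \<bar>\<psi> x - r\<bar> + \<bar>p - r\<bar>)"
        by (rule intI_mono[OF locfin_lebesgue la loc_bdd_add[OF la loc_bdd_const]]) simp
      then show ?thesis
        using measure_lebesgue_Ioc[of y "y + 1"] by (simp add: intI_add[OF locfin_lebesgue la loc_bdd_const] intI_const[OF locfin_lebesgue])
    qed
    have mc: "\<bar>c - m\<bar> \<le> intI lebesgue x' (x' + 1) (\<lambda>x. \<bar>\<psi> x - c\<bar>) + intI lebesgue x' (x' + 1) (\<lambda>x. \<bar>\<psi> x - m\<bar>)"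
    proof -
      have "intI lebesgue x' (x' + 1) (\<lambda>x. \<bar>c - m\<bar>) \<le> intI lebesgue x' (x' + 1) (\<lambda>x. \<bar>\<psi> x - c\<bar> + \<bar>\<psi> x - m\<bar>)"
        by (rule intI_mono[OF locfin_lebesgue loc_bdd_const loc_bdd_add[OF la la]]) simp
      then show ?thesis
        using measure_lebesgue_Ioc[of x' "x' + 1"] by (simp add: intI_add[OF locfin_lebesgue la la] intI_const[OF locfin_lebesgue])
    qed
    have "intI lebesgue x (x + 1) (\<lambda>x. \<bar>\<psi> x - c\<bar>) \<le> intI lebesgue x (x + 1) (\<lambda>x. \<bar>\<psi> x - m\<bar>) + \<bar>c - m\<bar>" by (rule tri)
    moreover have "intI lebesgue x (x + 1) (\<lambda>x. \<bar>\<psi> x - m\<bar>) \<le> 2 * n"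
      using sub[of x' x "x + 1" "x' + 2" m] x' m by simp
    moreover have "intI lebesgue x' (x' + 1) (\<lambda>x. \<bar>\<psi> x - m\<bar>) \<le> 2 * n"
      using sub[of x' x' "x' + 1" "x' + 2" m] m by simp
    ultimately show ?case using mc IH by (simp add: algebra_simps)
  qed
  have c2: "intI lebesgue a (a + x) (\<lambda>x. \<bar>\<psi> x - c\<bar>) \<le> (real k + 1) * (2 * n + 4 * n * real k)"
    if "0 \<le> x" "x \<le> real k + 1" "x \<le> L" for x k
    using that
  proof (induction k arbitrary: x)
    case 0
    then show ?case using sub[of a a "a + x" "a + 2" c] c by simp
  next
    case (Suc k)
    have le: "(real k + 1) * (2 * n + 4 * n * real k) + (2 * n + 4 * n * (real k + 1)) \<le> (real k + 2) * (2 * n + 4 * n * (real k + 1))"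
      using n by (simp add: algebra_simps)
    have pos: "0 \<le> 2 * n + 4 * n * (real k + 1)" using n by simp
    show ?case
    proof (cases "x \<le> real k + 1")
      case True
      then have "intI lebesgue a (a + x) (\<lambda>x. \<bar>\<psi> x - c\<bar>) \<le> (real k + 1) * (2 * n + 4 * n * real k)" using Suc by simp
      then show ?thesis using le pos by (simp add: add_ac)
    next
      case False
      then have 1: "intI lebesgue a (a + (x - 1)) (\<lambda>x. \<bar>\<psi> x - c\<bar>) \<le> (real k + 1) * (2 * n + 4 * n * real k)"
        using Suc by (intro Suc.IH) auto
      have 2: "intI lebesgue (a + (x - 1)) (a + (x - 1) + 1) (\<lambda>x. \<bar>\<psi> x - c\<bar>) \<le> 2 * n + 4 * n * real (Suc k)"
        using Suc.prems False by (intro c1) auto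
      have "intI lebesgue a (a + (x - 1)) (\<lambda>x. \<bar>\<psi> x - c\<bar>) + intI lebesgue (a + (x - 1)) (a + x) (\<lambda>x. \<bar>\<psi> x - c\<bar>)
        = intI lebesgue a (a + x) (\<lambda>x. \<bar>\<psi> x - c\<bar>)"
        by (rule intI_combine[OF locfin_lebesgue la]) (use False in auto)
      then show ?thesis using 1 2 le by (simp add: add_ac)
    qed
  qed
  show ?thesis
    by (rule exI[of _ c]) (use c1 c2 L in auto)
qed

text \<open>
  The constant can be taken to be a value \<open>\<psi> s\<close> with \<open>s\<close> in \<open>{0..1}\<close>, because some value of \<open>\<psi>\<close>
  there is at most twice as far from the constant of the previous lemma as \<open>\<psi>\<close> is in the mean.
\<close>

lemma local_norm_oscillation:
  fixes p n :: real
  assumes mu: "loc_finite \<mu>" and n: "local_norm TYPE('k::{real_normed_field, banach, second_countable_topology}) {-p..p} 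
      (\<lambda>B. \<mu> B - shift_measure p \<mu> B) \<le> ennreal n" "0 < n"
    and p: "1 \<le> p"
  defines "\<psi> \<equiv> \<lambda>x. dist_fun \<mu> x - dist_fun \<mu> (x + p)"
  shows "\<exists>s\<ge>0. s \<le> 1 \<and> intI lebesgue (-p) p (\<lambda>x. \<bar>\<psi> x - \<psi> s\<bar>) \<le> 200 * (p + 1)\<^sup>2 * n"
proof -
  define \<sigma> where "\<sigma> = (\<lambda>B. \<mu> B - shift_measure p \<mu> B)"
  have ls: "loc_finite \<sigma>" unfolding \<sigma>_def by (rule loc_finite_diff_shift[OF mu])
  have lc: "loc_bdd lebesgue (dist_fun \<sigma>)" by (rule loc_bdd_dist_fun[OF ls locfin_lebesgue])
  have osc: "\<exists>m. intI lebesgue e (e + 2) (\<lambda>x. \<bar>dist_fun \<sigma> x - m\<bar>) \<le> 2 * n" if "- p \<le> e" "e + 2 \<le> - p + 2 * p" for e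
  proof (rule oscillation_by_duality[OF lc])
    fix g :: "real \<Rightarrow> real" assume g: "loc_bdd lebesgue g" "\<And>x. \<bar>g x\<bar> \<le> 1" "intI lebesgue e (e + 2) g = 0"
    show "\<bar>intI lebesgue e (e + 2) (\<lambda>x. dist_fun \<sigma> x * g x)\<bar> \<le> n"
      by (rule local_norm_test[OF ls n(1)[folded \<sigma>_def] _ _ g]) (use that n in auto)
  qed
  obtain c where c: "\<And>x k. - p \<le> x \<Longrightarrow> x \<le> - p + real k \<Longrightarrow> x + 1 \<le> - p + 2 * p \<Longrightarrow>
      intI lebesgue x (x + 1) (\<lambda>x. \<bar>dist_fun \<sigma> x - c\<bar>) \<le> 2 * n + 4 * n * real k"
    "\<And>k. 2 * p \<le> real k + 1 \<Longrightarrow> intI lebesgue (- p) (- p + 2 * p) (\<lambda>x. \<bar>dist_fun \<sigma> x - c\<bar>) \<le> (real k + 1) * (2 * n + 4 * n * real k)"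
    using oscillation_chain[OF lc n(2), of "2 * p" "- p"] osc p by auto
  define k where "k = nat \<lceil>2 * p\<rceil>"
  have k: "2 * p \<le> real k" "real k \<le> 2 * p + 1"
  proof -
    show "2 * p \<le> real k" unfolding k_def by (rule real_nat_ceiling_ge)
    have "real k = of_int \<lceil>2 * p\<rceil>" using p by (simp add: k_def)
    then show "real k \<le> 2 * p + 1" using of_int_ceiling_le_add_one[of "2 * p"] by simp
  qed
  have la: "loc_bdd lebesgue (\<lambda>x. \<bar>dist_fun \<sigma> x - c\<bar>)" for c
    using loc_bdd_norm[OF loc_bdd_diff[OF lc loc_bdd_const[of _ c]]] by simp
  have e1: "4 * n * real k \<le> 4 * n * (2 * p + 1)" using k n by (intro mult_left_mono) auto
  have "intI lebesgue 0 (0 + 1) (\<lambda>x. \<bar>dist_fun \<sigma> x - c\<bar>) \<le> 2 * n + 4 * n * real k"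
    by (rule c(1)) (use p k in auto)
  then have I1: "intI lebesgue 0 1 (\<lambda>x. \<bar>dist_fun \<sigma> x - c\<bar>) \<le> 2 * n + 4 * n * (2 * p + 1)" using e1 by simp
  \<comment> \<open>The factor \<open>2\<close> gives a strict inequality of integrals in the opposite case.\<close>
  have "\<exists>s\<in>{0..1}. \<bar>dist_fun \<sigma> s - c\<bar> \<le> 2 * (2 * n + 4 * n * (2 * p + 1))"
  proof (rule ccontr)
    let ?A = "2 * n + 4 * n * (2 * p + 1)"
    assume nex: "\<not> (\<exists>s\<in>{0..1}. \<bar>dist_fun \<sigma> s - c\<bar> \<le> 2 * ?A)"
    have le: "intI lebesgue 0 1 (\<lambda>x. 2 * ?A) \<le> intI lebesgue 0 1 (\<lambda>x. \<bar>dist_fun \<sigma> x - c\<bar>)"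
    proof (rule intI_mono[OF locfin_lebesgue loc_bdd_const la])
      fix x :: real assume "0 < x" "x \<le> 1"
      then have "\<not> \<bar>dist_fun \<sigma> x - c\<bar> \<le> 2 * ?A" using nex by (meson atLeastAtMost_iff less_imp_le)
      then show "2 * ?A \<le> \<bar>dist_fun \<sigma> x - c\<bar>" by linarith
    qed
    have eq: "intI lebesgue 0 1 (\<lambda>x. 2 * ?A) = 2 * ?A"
      using measure_lebesgue_Ioc[of 0 1] by (simp add: intI_const[OF locfin_lebesgue])
    have "2 * ?A \<le> ?A" using order_trans[OF le[unfolded eq] I1] .
    moreover have "0 < ?A" using n p by (simp add: add_pos_pos)
    moreover have "\<not> (2 * A \<le> A \<and> 0 < A)" for A :: real by linarith
    ultimately show False by blast
  qed
  then obtain s where s: "0 \<le> s" "s \<le> 1" "\<bar>dist_fun \<sigma> s - c\<bar> \<le> 2 * (2 * n + 4 * n * (2 * p + 1))" by auto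
  have "intI lebesgue (- p) p (\<lambda>x. \<bar>\<psi> x - \<psi> s\<bar>) = intI lebesgue (- p) p (\<lambda>x. \<bar>dist_fun \<sigma> x - dist_fun \<sigma> s\<bar>)"
    by (rule intI_cong) (simp add: \<psi>_def \<sigma>_def dist_fun_diff_shift[OF mu])
  also have "\<dots> \<le> intI lebesgue (- p) p (\<lambda>x. \<bar>dist_fun \<sigma> x - c\<bar> + \<bar>dist_fun \<sigma> s - c\<bar>)"
    by (rule intI_mono[OF locfin_lebesgue la loc_bdd_add[OF la loc_bdd_const]]) simp
  also have "\<dots> = intI lebesgue (- p) p (\<lambda>x. \<bar>dist_fun \<sigma> x - c\<bar>) + 2 * p * \<bar>dist_fun \<sigma> s - c\<bar>"
    using measure_lebesgue_Ioc[of "- p" p] p by (simp add: intI_add[OF locfin_lebesgue la loc_bdd_const] intI_const[OF locfin_lebesgue])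
  also have "\<dots> \<le> (2 * p + 2) * (2 * n + 4 * n * (2 * p + 1)) + 2 * p * (2 * (2 * n + 4 * n * (2 * p + 1)))"
  proof (intro add_mono mult_left_mono s(3))
    have "intI lebesgue (- p) p (\<lambda>x. \<bar>dist_fun \<sigma> x - c\<bar>) \<le> (real k + 1) * (2 * n + 4 * n * real k)"
      using c(2)[of k] k by simp
    also have "\<dots> \<le> (2 * p + 2) * (2 * n + 4 * n * (2 * p + 1))"
      using k n p e1 by (intro mult_mono) auto
    finally show "intI lebesgue (- p) p (\<lambda>x. \<bar>dist_fun \<sigma> x - c\<bar>) \<le> (2 * p + 2) * (2 * n + 4 * n * (2 * p + 1))" .
  qed (use p in auto)
  also have "\<dots> = n * (12 + 64 * p + 48 * p\<^sup>2 - p * 12)" by (simp add: algebra_simps power2_eq_square)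
  also have "\<dots> \<le> n * (200 * (p + 1)\<^sup>2)"
    using n p by (intro mult_left_mono) (auto simp: power2_eq_square algebra_simps intro!: add_mono mult_mono)
  finally show ?thesis using s by (intro exI[of _ s]) (simp add: mult_ac)
qed

section \<open>From the operator to the integrated equation\<close>

lemma lebesgue_measurable_AE:
  fixes f g :: "real \<Rightarrow> 'b::topological_space"
  assumes f: "f \<in> borel_measurable lebesgue" and ae: "AE x in lebesgue. f x = g x"
  shows "g \<in> borel_measurable lebesgue"
proof (rule measurableI)
  fix S :: "'b set" assume S: "S \<in> sets borel"
  obtain N where N: "{x \<in> space lebesgue. f x \<noteq> g x} \<subseteq> N" "N \<in> null_sets lebesgue"
    using ae by (auto elim!: AE_E simp: null_sets_def)
  have "g -` S \<inter> N \<in> null_sets lebesgue" by (rule completion.complete2[OF _ N(2)]) auto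
  then have 1: "g -` S \<inter> N \<in> sets lebesgue" by blast
  have 2: "f -` S \<inter> space lebesgue - N \<in> sets lebesgue"
    using measurable_sets[OF f S] N(2) by blast
  have e: "g -` S \<inter> space lebesgue = (f -` S \<inter> space lebesgue - N) \<union> (g -` S \<inter> N)"
  proof -
    have "f x = g x" if "x \<notin> N" for x using N(1) that by auto
    then show ?thesis by auto
  qed
  show "g -` S \<inter> space lebesgue \<in> sets lebesgue" unfolding e by (rule sets.Un[OF 2 1])
qed simp

lemma oriented_additive:
  fixes I :: "real \<Rightarrow> real \<Rightarrow> 'a::ab_group_add"
  assumes "\<And>s r t. s \<le> r \<Longrightarrow> r \<le> t \<Longrightarrow> I s t = I s r + I r t" and "s \<le> t"
  shows "(if c \<le> t then I c t else - I t c) - (if c \<le> s then I c s else - I s c) = I s t"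
proof -
  consider "c \<le> s" | "s < c" "c \<le> t" | "t < c" by linarith
  then show ?thesis
  proof cases
    case 1 then show ?thesis using assms(1)[of c s t] assms(2) by simp
  next
    case 2 then show ?thesis using assms(1)[of s c t] by simp
  next
    case 3 then show ?thesis using assms(1)[of s t c] assms(2) by simp
  qed
qed

text \<open>
  A version of \<open>1 / a\<close> whose bounds hold everywhere, so that all later estimates are pointwise.
\<close>

lemma coefficient_bounds:
  fixes a :: "real \<Rightarrow> real"
  assumes a: "a \<in> borel_measurable lebesgue" "\<And>x. 0 \<le> a x"
    and fin: "Linf_norm_coeff a < \<infinity>" "Linf_norm_recip a < \<infinity>"
  shows "\<exists>b \<alpha>. 0 < \<alpha> \<and> b \<in> borel_measurable lebesgue \<and> 0 < enn2real (Linf_norm_recip a) \<and>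
    (\<forall>x. 1 / \<alpha> \<le> b x \<and> b x \<le> enn2real (Linf_norm_recip a)) \<and> (AE x in lebesgue. 0 < a x \<and> b x = 1 / a x)"
proof -
  define \<alpha> where "\<alpha> = enn2real (Linf_norm_coeff a)"
  define \<beta> where "\<beta> = enn2real (Linf_norm_recip a)"
  define P where "P x \<longleftrightarrow> 0 < a x \<and> a x \<le> \<alpha> \<and> 1 / a x \<le> \<beta>" for x
  have "AE x in lebesgue. ennreal (a x) \<le> Linf_norm_coeff a" unfolding Linf_norm_coeff_def by (rule esssup_AE)
  moreover have "AE x in lebesgue. inverse (ennreal (a x)) \<le> Linf_norm_recip a" unfolding Linf_norm_recip_def by (rule esssup_AE)
  ultimately have P: "AE x in lebesgue. P x"
  proof eventually_elim
    case (elim x)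
    have "ennreal (a x) \<le> ennreal \<alpha>" using elim(1) fin by (simp add: \<alpha>_def less_top)
    then have 1: "a x \<le> \<alpha>" by (simp add: \<alpha>_def)
    have i: "inverse (ennreal (a x)) \<le> ennreal \<beta>" using elim(2) fin by (simp add: \<beta>_def less_top)
    have 2: "0 < a x"
    proof (rule ccontr)
      assume "\<not> 0 < a x"
      then have "a x = 0" using a(2)[of x] by simp
      then show False using i by (simp add: top_unique)
    qed
    then have "ennreal (1 / a x) \<le> ennreal \<beta>" using i by (simp add: inverse_ennreal inverse_eq_divide)
    then have "1 / a x \<le> \<beta>" by (simp add: \<beta>_def)
    then show ?case using 1 2 by (simp add: P_def)
  qed
  have "\<exists>x. P x"
  proof (rule ccontr)
    assume "\<nexists>x. P x"
    have "AE x in lebesgue. x \<notin> {0<..1::real}"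
      using P by (rule eventually_mono) (use \<open>\<nexists>x. P x\<close> in blast)
    then have "{0<..1::real} \<in> null_sets lebesgue" using AE_iff_null_sets[of "{0<..1::real}" lebesgue] by simp
    then show False using measure_lebesgue_Ioc[of 0 1] by (simp add: measure_def null_setsD1)
  qed
  then obtain x where x: "0 < a x" "a x \<le> \<alpha>" "1 / a x \<le> \<beta>" by (auto simp: P_def)
  have pos: "0 < \<alpha>" "0 < \<beta>" "1 / \<alpha> \<le> \<beta>"
  proof -
    show "0 < \<alpha>" using x by linarith
    have "0 < 1 / a x" using x by simp
    then show "0 < \<beta>" using x by linarith
    have "1 / \<alpha> \<le> 1 / a x" using x by (intro divide_left_mono) auto
    then show "1 / \<alpha> \<le> \<beta>" using x by linarith
  qed
  define b where "b x = (if P x then 1 / a x else \<beta>)" for x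
  have ab: "AE x in lebesgue. 0 < a x \<and> b x = 1 / a x"
    using P by eventually_elim (simp add: b_def P_def)
  have "(\<lambda>x. 1 / a x) \<in> borel_measurable lebesgue" using a(1) by (intro borel_measurable_divide) simp_all
  then have "b \<in> borel_measurable lebesgue"
    by (rule lebesgue_measurable_AE) (use ab in \<open>auto elim: eventually_mono\<close>)
  moreover have "1 / \<alpha> \<le> b x \<and> b x \<le> \<beta>" for x
    using pos by (auto simp: b_def P_def intro!: divide_left_mono)
  ultimately show ?thesis using pos ab unfolding \<beta>_def by blast
qed

context sl_periodic
begin

text \<open>
  The quasi-derivative is \<open>y = \<integral> u d\<mu> - A u\<close>, where \<open>A u\<close> denotes the representative that is absolutely
  continuous with respect to \<open>\<rho>\<close>; by definition of \<open>A u\<close> it agrees with \<open>a u'\<close> almost everywhere,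
  and its increments are those of \<open>\<integral> u d\<nu>\<close>.
\<close>

lemma eigenfunction_quasi_sol:
  assumes W: "W11loc u v" and g: "AE t in lebesgue. g t = - (a t *\<^sub>R v t) + interval_integral_lm \<mu> 0 t u"
    and h: "has_lm_deriv \<rho> g h" and hz: "AE t in variation_measure \<rho>. h t = z * u t"
    and hm: "h \<in> borel_measurable (variation_measure \<rho>)"
    and a: "a \<in> borel_measurable lebesgue" and ab: "AE x in lebesgue. 0 < a x \<and> b x = 1 / a x"
  shows "\<exists>y. quasi_sol b \<Phi> u y"
proof -
  let ?R = "variation_measure \<rho>"
  have cu: "continuous_on UNIV u" and lv: "locally_integrable lebesgue v" and wd: "weak_deriv u v"
    using W by (auto simp: W11loc_def)
  define y where "y t = interval_integral_lm \<mu> 0 t u - g t" for t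
  have lu: "loc_bdd M u" if "locfin M" for M by (rule loc_bdd_continuous[OF that cu])
  have \<mu>d: "interval_integral_lm \<mu> 0 t u - interval_integral_lm \<mu> 0 s u = integral_lm \<mu> {s<..t} u" if "s \<le> t" for s t
    unfolding interval_integral_lm_def
  proof (rule oriented_additive[OF _ that])
    fix s r t :: real assume "s \<le> r" "r \<le> t"
    then show "integral_lm \<mu> {s<..t} u = integral_lm \<mu> {s<..r} u + integral_lm \<mu> {r<..t} u"
      using intI_combine[OF lf(1) lu[OF lf(1)], of s r t] intI_combine[OF lf(2) lu[OF lf(2)], of s r t]
      by (simp add: integral_lm_def algebra_simps)
  qed
  have hi: "set_integrable ?R {s<..t} h" for s t
  proof (rule set_integrable_subset)
    show "set_integrable ?R {s..t} h" using h by (auto simp: has_lm_deriv_def locally_integrable_def)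
  qed auto
  obtain c where c: "\<And>t. g t = g c + interval_integral_lm \<rho> c t h" using h by (auto simp: has_lm_deriv_def)
  have gd: "g t - g s = z * integral_lm \<rho> {s<..t} u" if "s \<le> t" for s t
  proof -
    have "g t - g s = interval_integral_lm \<rho> c t h - interval_integral_lm \<rho> c s h"
      using c[of t] c[of s] by simp
    also have "\<dots> = integral_lm \<rho> {s<..t} h"
      unfolding interval_integral_lm_def
    proof (rule oriented_additive[OF _ that])
      fix s r t :: real assume sr: "s \<le> r" "r \<le> t"
      then have "{s<..t} = {s<..r} \<union> {r<..t}" by auto
      then show "integral_lm \<rho> {s<..t} h = integral_lm \<rho> {s<..r} h + integral_lm \<rho> {r<..t} h"
        unfolding nonneg_integral_lm[OF rho rho_nonneg] by (simp add: set_integral_Un hi)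
    qed
    also have "\<dots> = set_lebesgue_integral ?R {s<..t} (\<lambda>x. z * u x)"
      unfolding nonneg_integral_lm[OF rho rho_nonneg]
    proof (rule set_lebesgue_integral_cong_AE)
      show "(\<lambda>x. z * u x) \<in> borel_measurable ?R"
        using loc_bddD[OF lu[OF locfin_variation[OF rho]]] by (intro borel_measurable_times) auto
    qed (use hm hz in \<open>auto elim: eventually_mono\<close>)
    also have "\<dots> = z * integral_lm \<rho> {s<..t} u"
      unfolding nonneg_integral_lm[OF rho rho_nonneg] by (rule set_integral_mult_right)
    finally show ?thesis .
  qed
  have yd: "y t - y s = nu_int s t u" if "s \<le> t" for s t
    using \<mu>d[OF that] gd[OF that] by (simp add: y_def nu_int_def algebra_simps)
  have mass: "v \<in> borel_measurable lebesgue"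
  proof (rule borel_measurable_LIMSEQ_metric)
    show "(\<lambda>x. indicator {- real n..real n} x *\<^sub>R v x) \<in> borel_measurable lebesgue" for n
    proof -
      have "set_integrable lebesgue {- real n..real n} v"
        using lv compact_Icc by (simp add: locally_integrable_def)
      then show ?thesis by (simp add: set_integrable_def borel_measurable_integrable)
    qed
    fix x :: real
    obtain N where N: "\<bar>x\<bar> \<le> real N" using real_arch_simple by blast
    have "\<forall>\<^sub>F n in sequentially. indicator {- real n..real n} x *\<^sub>R v x = v x"
      using eventually_ge_at_top[of N]
    proof eventually_elim
      case (elim n)
      then have "real N \<le> real n" by simp
      then have "x \<in> {- real n..real n}" using N by auto
      then show ?case by simp
    qed
    then show "(\<lambda>n. indicator {- real n..real n} x *\<^sub>R v x) \<longlonglongrightarrow> v x" by (rule tendsto_eventually)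
  qed
  have ya: "AE t in lebesgue. a t *\<^sub>R v t = y t"
    using g by eventually_elim (simp add: y_def)
  have ym: "y \<in> borel_measurable lebesgue"
    by (rule lebesgue_measurable_AE[OF _ ya]) (intro borel_measurable_scaleR a mass)
  have ly: "loc_bdd lebesgue y"
    unfolding loc_bdd_def
  proof (intro conjI allI ym)
    fix s t
    obtain S where S: "0 \<le> S" "\<And>x. s \<le> x \<Longrightarrow> x \<le> t \<Longrightarrow> norm (u x) \<le> S" using loc_bdd_bound[OF lu[OF locfin_lebesgue]] by metis
    have "norm (y x) \<le> norm (y s) + S * mass s t" if x: "x \<in> {s..t}" for x
    proof -
      have "norm (y x - y s) \<le> abs_int u s x" using yd[of s x] nu_int_le_abs_int[OF cu, of s x] x by simp
      also have "\<dots> \<le> S * mass s x" by (rule abs_int_le[OF cu]) (use S x in auto)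
      also have "\<dots> \<le> S * mass s t" using mass_add[of s x t] mass_nonneg[of x t] x S by (intro mult_left_mono) auto
      finally show ?thesis using norm_triangle_sub[of "y x" "y s"] by linarith
    qed
    then show "\<exists>B. \<forall>x\<in>{s..t}. norm (y x) \<le> B" by blast
  qed
  have lby: "loc_bdd lebesgue (\<lambda>x. b x *\<^sub>R y x)" by (intro loc_bdd_scaleR loc_bdd_b ly)
  have vb: "AE x in lebesgue. v x = b x *\<^sub>R y x"
    using ya ab
  proof eventually_elim
    case (elim x)
    have "v x = (1 / a x) *\<^sub>R (a x *\<^sub>R v x)" using elim(2) by simp
    then show ?case using elim by simp
  qed
  have "weak_deriv u (\<lambda>x. b x *\<^sub>R y x)"
    unfolding weak_deriv_def
  proof (intro allI impI)
    fix \<phi> \<phi>' :: "real \<Rightarrow> real"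
    assume d: "\<forall>x. (\<phi> has_real_derivative \<phi>' x) (at x)" and c: "continuous_on UNIV \<phi>'" and s: "compact (spt_fun \<phi>)"
    have "\<phi> \<in> borel_measurable lebesgue"
      by (rule loc_bddD[OF prim_of_loc_bdd[OF prim_of_C1 locfin_lebesgue]]) (use d c in auto)
    then have "(LINT x|lebesgue. \<phi> x *\<^sub>R v x) = (LINT x|lebesgue. \<phi> x *\<^sub>R (b x *\<^sub>R y x))"
      using vb
      by (intro integral_cong_AE borel_measurable_scaleR[OF _ mass] borel_measurable_scaleR[OF _ loc_bddD[OF lby]])
         (auto elim: eventually_mono)
    moreover have "(LINT x|lebesgue. \<phi>' x *\<^sub>R u x) = - (LINT x|lebesgue. \<phi> x *\<^sub>R v x)"
      using wd[unfolded weak_deriv_def, rule_format, OF d[rule_format] c s] .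
    ultimately show "(LINT x|lebesgue. \<phi>' x *\<^sub>R u x) = - (LINT x|lebesgue. \<phi> x *\<^sub>R (b x *\<^sub>R y x))" by simp
  qed
  then have "prim_of u (\<lambda>x. b x *\<^sub>R y x)" by (rule weak_deriv_prim_of[OF cu lby])
  then show ?thesis using qsolI[OF _ yd] by blast
qed

end

section \<open>The Gordon argument\<close>

text \<open>
  If \<open>norm D \<ge> 1\<close> for infinitely many \<open>m\<close>, use the relation at \<open>t\<close> in \<open>{1..2}\<close>, where \<open>t + P m\<close> and
  \<open>t - P m\<close> are far out.  Otherwise use it at \<open>t = P m + s\<close> with \<open>s\<close> in \<open>{-1..0}\<close>, where \<open>t\<close> and
  \<open>t + P m\<close> are far out.
\<close>

lemma gordon_dichotomy:
  fixes u :: "real \<Rightarrow> 'k::{real_normed_field, banach, second_countable_topology}" and P E :: "nat \<Rightarrow> real"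
  assumes decay: "\<And>e. 0 < e \<Longrightarrow> \<exists>X. \<forall>t. X \<le> \<bar>t\<bar> \<longrightarrow> norm (u t) \<le> e"
    and P: "filterlim P at_top sequentially" and E: "E \<longlonglongrightarrow> 0"
    and rel: "\<forall>\<^sub>F m in sequentially. \<exists>D. \<forall>t. 1 \<le> t \<longrightarrow> t \<le> P m \<longrightarrow> norm (u (t + P m) + u (t - P m) - D * u t) \<le> E m"
  shows "(\<forall>t. 1 \<le> t \<longrightarrow> t \<le> 2 \<longrightarrow> u t = 0) \<or> (\<forall>t. -1 \<le> t \<longrightarrow> t \<le> 0 \<longrightarrow> u t = 0)"
proof -
  let ?Q = "\<lambda>m D. \<forall>t. 1 \<le> t \<longrightarrow> t \<le> P m \<longrightarrow> norm (u (t + P m) + u (t - P m) - D * u t) \<le> E m"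
  define D where "D m = (SOME D. ?Q m D)" for m
  have Q: "\<forall>\<^sub>F m in sequentially. ?Q m (D m)"
    using rel unfolding D_def by eventually_elim (rule someI_ex)
  have main: "\<forall>\<^sub>F m in sequentially. ?Q m (D m) \<and> E m < e \<and> X + 2 \<le> P m \<and> 2 \<le> P m" if "0 < e" for e X
    using Q order_tendstoD(2)[OF E that] filterlim_at_top[THEN iffD1, OF P, rule_format, of "X + 2"]
      filterlim_at_top[THEN iffD1, OF P, rule_format, of 2]
    by eventually_elim auto
  have zero: "x = 0" if "\<And>e. 0 < e \<Longrightarrow> norm x \<le> 3 * e" for x :: 'k
  proof (rule ccontr)
    assume "x \<noteq> 0"
    then show False using that[of "norm x / 4"] by simp
  qed
  have tri: "norm c \<le> norm a + norm b' + norm (a + b' - c)" for a b' c :: 'k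
    using norm_triangle_ineq4[of "a + b'" "a + b' - c"] norm_triangle_ineq[of a b'] by simp
  have tri': "norm b' \<le> norm a + norm c + norm (a + b' - c)" for a b' c :: 'k
  proof -
    have "b' = (a + b' - c) + (c - a)" by simp
    then have "norm b' \<le> norm (a + b' - c) + norm (c - a)" by (metis norm_triangle_ineq)
    also have "norm (c - a) \<le> norm c + norm a" by (rule norm_triangle_ineq4)
    finally show ?thesis by simp
  qed
  show ?thesis
  proof (cases "\<exists>\<^sub>F m in sequentially. 1 \<le> norm (D m)")
    case True
    have "u t = 0" if t: "1 \<le> t" "t \<le> 2" for t
    proof (rule zero)
      fix e :: real assume e: "0 < e"
      obtain X where X: "\<And>t. X \<le> \<bar>t\<bar> \<Longrightarrow> norm (u t) \<le> e" using decay[OF e] by blast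
      obtain m where m: "1 \<le> norm (D m)" "?Q m (D m)" "E m < e" "X + 2 \<le> P m" "2 \<le> P m"
        using frequently_ex[OF frequently_eventually_conj[OF True main[OF e, of X]]] by blast
      have "norm (u t) \<le> norm (D m) * norm (u t)" using mult_right_mono[OF m(1), of "norm (u t)"] by simp
      also have "\<dots> = norm (D m * u t)" by (simp add: norm_mult)
      also have "\<dots> \<le> norm (u (t + P m)) + norm (u (t - P m)) + norm (u (t + P m) + u (t - P m) - D m * u t)" by (rule tri)
      also have "\<dots> \<le> e + e + e"
        using m t by (intro add_mono X order_trans[OF m(2)[rule_format]]) auto
      finally show "norm (u t) \<le> 3 * e" by simp
    qed
    then show ?thesis by blast
  next
    case False
    then have F: "\<forall>\<^sub>F m in sequentially. norm (D m) < 1" by (simp add: not_frequently not_le)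
    have "u s = 0" if s: "-1 \<le> s" "s \<le> 0" for s
    proof (rule zero)
      fix e :: real assume e: "0 < e"
      obtain X where X: "\<And>t. X \<le> \<bar>t\<bar> \<Longrightarrow> norm (u t) \<le> e" using decay[OF e] by blast
      obtain m where m: "norm (D m) < 1" "?Q m (D m)" "E m < e" "X + 2 \<le> P m" "2 \<le> P m"
        using eventually_happens[OF eventually_conj[OF F main[OF e, of X]]] by auto
      define t where "t = P m + s"
      have t: "1 \<le> t" "t \<le> P m" "t - P m = s" "X \<le> \<bar>t\<bar>" "X \<le> \<bar>t + P m\<bar>" using m s by (auto simp: t_def)
      have "norm (u s) \<le> norm (u (t + P m)) + norm (D m * u t) + norm (u (t + P m) + u (t - P m) - D m * u t)"
        using tri'[of "u s" "u (t + P m)" "D m * u t"] t(3) by simp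
      also have "norm (D m * u t) \<le> 1 * norm (u t)" unfolding norm_mult using m(1) by (intro mult_right_mono) auto
      also have "norm (u (t + P m)) + 1 * norm (u t) + norm (u (t + P m) + u (t - P m) - D m * u t) \<le> e + 1 * e + e"
        using m t by (intro add_mono mult_left_mono X order_trans[OF m(2)[rule_format]]) auto
      finally show "norm (u s) \<le> 3 * e" by simp
    qed
    then show ?thesis by blast
  qed
qed

lemma reciprocal_L1_bound:
  fixes a b :: "real \<Rightarrow> real"
  assumes b: "loc_bdd lebesgue b" "\<And>x. 0 \<le> b x" "\<And>x. b x \<le> \<beta>"
    and ab: "AE x in lebesgue. 0 < a x \<and> b x = 1 / a x" and am: "a \<in> borel_measurable lebesgue"
    and d: "(\<integral>\<^sup>+x\<in>{- p<..<p}. ennreal \<bar>a x - a (x + p)\<bar> \<partial>lebesgue) \<le> ennreal d" "0 \<le> d"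
  shows "intI lebesgue (- p) p (\<lambda>x. \<bar>b (x + p) - b x\<bar>) \<le> \<beta>\<^sup>2 * d"
proof -
  have lb: "loc_bdd lebesgue (\<lambda>x. \<bar>b (x + p) - b x\<bar>)"
    using loc_bdd_norm[OF loc_bdd_diff[OF loc_bdd_shift[OF b(1), of p] b(1)]] by simp
  have ab': "AE x in lebesgue. 0 < a (x + p) \<and> b (x + p) = 1 / a (x + p)"
  proof -
    have "AE x in distr lebesgue lebesgue (\<lambda>x. x + p). 0 < a x \<and> b x = 1 / a x"
      unfolding distr_lebesgue_shift by (rule ab)
    moreover have "{x \<in> space lebesgue. 0 < a x \<and> b x = 1 / a x} \<in> sets lebesgue"
      using am loc_bddD[OF b(1)] by measurable
    ultimately show ?thesis by (rule AE_distr_iff[OF measurable_lebesgue_shift, THEN iffD1, rotated])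
  qed
  have pt: "AE x in lebesgue. ennreal (indicator {- p<..p} x *\<^sub>R \<bar>b (x + p) - b x\<bar>) \<le> ennreal (\<beta>\<^sup>2) * (ennreal \<bar>a x - a (x + p)\<bar> * indicator {- p<..<p} x)"
    using ab ab' AE_completion[OF AE_lborel_singleton[of p]]
  proof eventually_elim
    case (elim x)
    have "b (x + p) - b x = (a x - a (x + p)) * (b x * b (x + p))" using elim by (simp add: field_simps)
    then have "\<bar>b (x + p) - b x\<bar> = \<bar>a x - a (x + p)\<bar> * (b x * b (x + p))"
      using b(2) by (simp add: abs_mult)
    also have "\<dots> \<le> \<bar>a x - a (x + p)\<bar> * (\<beta> * \<beta>)"
      using b(2,3) order_trans[OF b(2) b(3)] by (intro mult_left_mono mult_mono) auto
    finally have "\<bar>b (x + p) - b x\<bar> \<le> \<beta>\<^sup>2 * \<bar>a x - a (x + p)\<bar>" by (simp add: power2_eq_square mult_ac)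
    then have "ennreal \<bar>b (x + p) - b x\<bar> \<le> ennreal (\<beta>\<^sup>2) * ennreal \<bar>a x - a (x + p)\<bar>"
      by (simp add: ennreal_mult[symmetric] ennreal_leI)
    then show ?case using elim(3) by (auto simp: indicator_def)
  qed
  have m: "(\<lambda>x. ennreal \<bar>a x - a (x + p)\<bar> * indicator {- p<..<p} x) \<in> borel_measurable lebesgue"
    using am measurable_compose[OF measurable_lebesgue_shift am] by (intro borel_measurable_times_ennreal borel_measurable_indicator) auto
  have "ennreal (intI lebesgue (- p) p (\<lambda>x. \<bar>b (x + p) - b x\<bar>)) = (\<integral>\<^sup>+x. ennreal (indicator {- p<..p} x *\<^sub>R \<bar>b (x + p) - b x\<bar>) \<partial>lebesgue)"
    unfolding set_lebesgue_integral_def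
    by (rule nn_integral_eq_integral[symmetric])
       (use loc_bdd_set_integrable[OF locfin_lebesgue lb, of "-p" p] in \<open>auto simp: set_integrable_def\<close>)
  also have "\<dots> \<le> (\<integral>\<^sup>+x. ennreal (\<beta>\<^sup>2) * (ennreal \<bar>a x - a (x + p)\<bar> * indicator {- p<..<p} x) \<partial>lebesgue)"
    by (rule nn_integral_mono_AE[OF pt])
  also have "\<dots> = ennreal (\<beta>\<^sup>2) * (\<integral>\<^sup>+x\<in>{- p<..<p}. ennreal \<bar>a x - a (x + p)\<bar> \<partial>lebesgue)"
    by (rule nn_integral_cmult[OF m])
  also have "\<dots> \<le> ennreal (\<beta>\<^sup>2) * ennreal d" by (intro mult_left_mono d) simp
  also have "\<dots> = ennreal (\<beta>\<^sup>2 * d)" using d by (simp add: ennreal_mult)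
  finally show ?thesis using d by simp
qed

lemma gordon_error_tendsto_0:
  fixes P T :: "nat \<Rightarrow> real"
  assumes P: "filterlim P at_top sequentially" and om: "\<omega> < C" "0 < C"
    and T: "(\<lambda>m. exp (C * P m) * T m) \<longlonglongrightarrow> 0"
  shows "(\<lambda>m. K * exp (\<omega> * P m) * B * (c1 * T m + c2 * (P m + 1)\<^sup>2 * (T m + exp (- 2 * C * P m)))) \<longlonglongrightarrow> 0"
proof -
  define d where "d = C - \<omega>"
  have d: "0 < d" using om by (simp add: d_def)
  have l1: "(\<lambda>m. exp (- d * P m)) \<longlonglongrightarrow> 0"
  proof -
    have "((\<lambda>x::real. exp (- d * x)) \<longlongrightarrow> 0) at_top" using d by real_asymp
    from filterlim_compose[OF this P] show ?thesis .
  qed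
  have l2: "(\<lambda>m. (P m + 1)\<^sup>2 * exp (- d * P m)) \<longlonglongrightarrow> 0"
  proof -
    have "((\<lambda>x::real. (x + 1)\<^sup>2 * exp (- d * x)) \<longlongrightarrow> 0) at_top" using d by real_asymp
    from filterlim_compose[OF this P] show ?thesis .
  qed
  have l3: "(\<lambda>m. exp (- C * P m)) \<longlonglongrightarrow> 0"
  proof -
    have "((\<lambda>x::real. exp (- C * x)) \<longlongrightarrow> 0) at_top" using om by real_asymp
    from filterlim_compose[OF this P] show ?thesis .
  qed
  have lim: "(\<lambda>m. K * B * (c1 * (exp (C * P m) * T m) * exp (- d * P m) + c2 * ((P m + 1)\<^sup>2 * exp (- d * P m)) * (exp (C * P m) * T m + exp (- C * P m)))) \<longlonglongrightarrow> K * B * (c1 * 0 * 0 + c2 * 0 * (0 + 0))"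
    by (intro tendsto_intros T l1 l2 l3)
  have eq: "K * exp (\<omega> * P m) * B * (c1 * T m + c2 * (P m + 1)\<^sup>2 * (T m + exp (- 2 * C * P m))) =
    K * B * (c1 * (exp (C * P m) * T m) * exp (- d * P m) + c2 * ((P m + 1)\<^sup>2 * exp (- d * P m)) * (exp (C * P m) * T m + exp (- C * P m)))" for m
  proof -
    define X where "X = exp (C * P m)"
    have X: "X > 0" by (simp add: X_def)
    have e: "exp (\<omega> * P m) = X * exp (- d * P m)" "exp (- 2 * C * P m) = exp (- C * P m) / X" 
      by (simp_all add: X_def d_def algebra_simps flip: exp_add exp_diff)
    have "X * exp (- d * P m) * (exp (- C * P m) / X) = exp (- d * P m) * exp (- C * P m)" using X by simp
    then show ?thesis unfolding X_def[symmetric] e using X by (simp add: algebra_simps)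
  qed
  show ?thesis unfolding eq using lim by simp
qed

theorem theorem5p3:
  fixes p C :: real
    and \<rho> \<mu> :: "real set \<Rightarrow> real"
    and a :: "real \<Rightarrow> real"
    and P :: "nat \<Rightarrow> real"
    and z :: "'k::{real_normed_field, banach, second_countable_topology}"
  assumes "1 \<le> p"
    and "\<rho> \<in> M_loc_unif" and "\<forall>B\<in>bounded_borel. 0 \<le> \<rho> B" and "\<exists>B\<in>bounded_borel. \<rho> B \<noteq> 0"
    and "periodic_measure \<rho>"
    and "(a, \<mu>) \<in> AM \<rho>"
    and "0 < C"
    and "range P \<subseteq> Per \<rho>" and "weak_gordon TYPE('k) C a \<mu> P"
    and "norm z < 1 / enn2real (unif_norm \<rho>) *
           (1 / enn2real (Linf_norm_recip a) * C\<^sup>2 - enn2real (unif_norm \<mu>))"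
  shows "\<not> eigenvalue (variation_measure \<rho>) (H_graph p \<rho> a \<mu>) z"
proof
  assume "eigenvalue (variation_measure \<rho>) (H_graph p \<rho> a \<mu>) z"
  then obtain f h u where fh: "f \<in> Lp_fun p (variation_measure \<rho>)" "h \<in> Lp_fun p (variation_measure \<rho>)"
      "AE t in variation_measure \<rho>. f t = u t" "is_deriv_A \<rho> a \<mu> u h"
    and nz: "\<not> (AE t in variation_measure \<rho>. f t = 0)" and hf: "AE t in variation_measure \<rho>. h t = z * f t"
    unfolding eigenvalue_def H_graph_def by blast
  let ?R = "variation_measure \<rho>"
  obtain g v where W: "W11loc u v" and g: "AE t in lebesgue. g t = - (a t *\<^sub>R v t) + interval_integral_lm \<mu> 0 t u"
    and gh: "has_lm_deriv \<rho> g h"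
    using fh(4) unfolding is_deriv_A_def is_A_def by blast
  have AM: "a \<in> borel_measurable lebesgue" "\<And>x. 0 \<le> a x" "Linf_norm_coeff a < \<infinity>" "Linf_norm_recip a < \<infinity>"
    "\<mu> \<in> M_loc_unif" "spt_measure \<mu> \<subseteq> spt_measure \<rho>"
    using assms(6) by (auto simp: AM_def)
  define \<beta> where "\<beta> = enn2real (Linf_norm_recip a)"
  define k1 where "k1 = enn2real (unif_norm \<mu>)"
  define k2 where "k2 = enn2real (unif_norm \<rho>)"
  obtain b \<alpha> where al: "0 < \<alpha>" and bm: "b \<in> borel_measurable lebesgue" and be: "0 < \<beta>"
    and bb: "\<And>x. 1 / \<alpha> \<le> b x" "\<And>x. b x \<le> \<beta>" and ab: "AE x in lebesgue. 0 < a x \<and> b x = 1 / a x"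
    using coefficient_bounds[OF AM(1-4)] unfolding \<beta>_def by blast
  have b0: "0 \<le> b x" for x using bb(1)[of x] al by (meson order_trans zero_le_divide_1_iff less_imp_le)
  have unif: "variation \<nu> {t<..t + 1} \<le> ennreal (enn2real (unif_norm \<nu>))" if "\<nu> \<in> M_loc_unif" for \<nu> t
  proof -
    have "variation \<nu> {t<..t + 1} \<le> unif_norm \<nu>" unfolding unif_norm_def by (rule SUP_upper) simp
    moreover have "unif_norm \<nu> < top" using that by (simp add: M_loc_unif_def)
    ultimately show ?thesis by simp
  qed
  have P0: "0 < P m" for m using assms(9) by (simp add: weak_gordon_def)
  have per: "\<rho> ((\<lambda>x. x + P m) ` B) = \<rho> B" if "B \<in> bounded_borel" for m B
    using assms(8) that unfolding Per_def shift_measure_def by blast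
  interpret sl_periodic \<mu> \<rho> z b \<beta> k1 k2 \<alpha> "P 0"
  proof
    show "loc_finite \<mu>" "loc_finite \<rho>" using M_loc_unif_loc_finite AM(5) assms(2) by auto
    show "0 \<le> k1" "0 \<le> k2" by (simp_all add: k1_def k2_def)
    show "variation \<mu> {t<..t + 1} \<le> ennreal k1" for t unfolding k1_def by (rule unif[OF AM(5)])
    show "variation \<rho> {t<..t + 1} \<le> ennreal k2" for t unfolding k2_def by (rule unif[OF assms(2)])
    show "\<rho> ((\<lambda>x. x + P 0) ` B) = \<rho> B" if "B \<in> bounded_borel" for B by (rule per[OF that])
  qed (use bm b0 bb be al P0 assms(3,4) AM(6) in auto)
  \<comment> \<open>The bound on \<open>z\<close> says \<open>\<beta> * \<kappa> < C\<^sup>2\<close>, which leaves room for a growth rate \<open>\<omega>\<close> strictly below \<open>C\<close>;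
    the geometric mean of \<open>\<beta>\<close> and \<open>\<kappa>\<close> itself could be \<open>0\<close>.\<close>
  have z1: "norm z < 1 / k2 * (1 / \<beta> * C\<^sup>2 - k1)" using assms(10) by (simp only: \<beta>_def k1_def k2_def)
  have k2p: "0 < k2"
  proof (rule ccontr)
    assume "\<not> 0 < k2"
    then have "k2 = 0" using k2(1) by simp
    then show False using z1 by simp
  qed
  have "norm z * k2 < 1 / \<beta> * C\<^sup>2 - k1" using z1 k2p by (simp add: pos_less_divide_eq)
  then have "\<beta> * \<kappa> < \<beta> * (1 / \<beta> * C\<^sup>2)" unfolding \<kappa>_def using be by (intro mult_strict_left_mono) auto
  then have kC: "\<beta> * \<kappa> < C\<^sup>2" using be by simp
  define \<omega> where "\<omega> = sqrt ((\<beta> * \<kappa> + C\<^sup>2) / 2)"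
  have bk: "0 \<le> \<beta> * \<kappa>" using be kappa_nonneg by simp
  have C2: "0 < C\<^sup>2" using assms(7) by simp
  have om: "0 < \<omega>" "\<beta> * \<kappa> \<le> \<omega>\<^sup>2" "\<omega> < C"
  proof -
    show "0 < \<omega>" unfolding \<omega>_def using add_nonneg_pos[OF bk C2] by simp
    show "\<beta> * \<kappa> \<le> \<omega>\<^sup>2" unfolding \<omega>_def using bk C2 kC by simp
    have "\<omega> < sqrt (C\<^sup>2)" unfolding \<omega>_def using kC by (intro real_sqrt_less_mono) simp
    then show "\<omega> < C" using assms(7) by simp
  qed
  have cu: "continuous_on UNIV u" using W by (simp add: W11loc_def)
  have um: "u \<in> borel_measurable ?R" by (rule loc_bddD[OF loc_bdd_continuous[OF locfin_variation[OF rho] cu]])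
  have hz: "AE t in ?R. h t = z * u t" using hf fh(3) by eventually_elim simp
  have hm: "h \<in> borel_measurable ?R" using fh(2) by (simp add: Lp_fun_def)
  obtain y where qs: "quasi_sol b \<Phi> u y" using eigenfunction_quasi_sol[OF W g gh hz hm AM(1) ab] by blast
  have int: "integrable ?R (\<lambda>x. norm (u x) powr p)"
  proof -
    have "integrable ?R (\<lambda>x. norm (f x) powr p)" "f \<in> borel_measurable ?R" using fh(1) by (auto simp: Lp_fun_def)
    moreover have "AE x in ?R. norm (f x) powr p = norm (u x) powr p" using fh(3) by eventually_elim simp
    ultimately show ?thesis using um by (subst integrable_cong_AE[of _ _ "\<lambda>x. norm (f x) powr p"]) (auto elim: eventually_mono)
  qed
  have p0: "0 < p" using assms(1) by simp
  obtain B where B: "\<And>x. norm (u x) \<le> B" "\<And>x. norm (y x) \<le> B" using quasi_sol_bounded[OF qs om(1,2) int p0] by blast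
  have B0: "0 \<le> B" using B(1)[of 0] norm_ge_zero order_trans by blast
  define X where "X m = (\<integral>\<^sup>+x\<in>{- P m<..<P m}. ennreal \<bar>a x - a (x + P m)\<bar> \<partial>lebesgue) +
         local_norm TYPE('k) {- P m..P m} (\<lambda>B. \<mu> B - shift_measure (P m) \<mu> B)" for m
  have Pinf: "filterlim P at_top sequentially" and lim: "(\<lambda>m. ennreal (exp (C * P m)) * X m) \<longlonglongrightarrow> 0"
    using assms(9) by (simp_all add: weak_gordon_def X_def)
  define T where "T m = enn2real (X m)" for m
  have T0: "0 \<le> T m" for m by (simp add: T_def)
  have limT: "(\<lambda>m. exp (C * P m) * T m) \<longlonglongrightarrow> 0"
  proof -
    have "(\<lambda>m. enn2real (ennreal (exp (C * P m)) * X m)) \<longlonglongrightarrow> 0"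
      by (rule tendsto_enn2real) (use lim in auto)
    then show ?thesis by (simp add: enn2real_mult T_def)
  qed
  have fin: "\<forall>\<^sub>F m in sequentially. X m < top"
    using order_tendstoD(2)[OF lim, of 1, simplified]
  proof eventually_elim
    case (elim m)
    show ?case
    proof (rule ccontr)
      assume "\<not> X m < top"
      then have "X m = top" by (simp add: not_less top_unique)
      then show False using elim by (simp add: ennreal_mult_top)
    qed
  qed
  define E where "E m = growth_const \<omega> * exp (\<omega> * P m) * B * (\<beta>\<^sup>2 * T m + 400 * \<beta> * (P m + 1)\<^sup>2 * (T m + exp (- 2 * C * P m)))" for m
  have E: "E \<longlonglongrightarrow> 0"
    unfolding E_def by (rule gordon_error_tendsto_0[OF Pinf om(3) assms(7) limT])
  have "\<forall>\<^sub>F m in sequentially. \<exists>D. \<forall>t. 1 \<le> t \<longrightarrow> t \<le> P m \<longrightarrow> norm (u (t + P m) + u (t - P m) - D * u t) \<le> E m"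
    using fin filterlim_at_top[THEN iffD1, OF Pinf, rule_format, of 1]
  proof eventually_elim
    case (elim m)
    \<comment> \<open>The exponential keeps \<open>n\<close> positive and is negligible even after multiplication by \<open>exp (\<omega> * P m)\<close>.\<close>
    define n where "n = T m + exp (- 2 * C * P m)"
    have n: "0 < n" using T0[of m] by (simp add: n_def add_nonneg_pos)
    have XT: "X m = ennreal (T m)" using elim(1) by (simp add: T_def less_top)
    have "local_norm TYPE('k) {- P m..P m} (\<lambda>B. \<mu> B - shift_measure (P m) \<mu> B) \<le> X m" by (simp add: X_def)
    also have "X m \<le> ennreal n" unfolding XT n_def by (intro ennreal_leI) simp
    finally have ln: "local_norm TYPE('k) {- P m..P m} (\<lambda>B. \<mu> B - shift_measure (P m) \<mu> B) \<le> ennreal n" .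
    have da: "(\<integral>\<^sup>+x\<in>{- P m<..<P m}. ennreal \<bar>a x - a (x + P m)\<bar> \<partial>lebesgue) \<le> ennreal (T m)"
      unfolding XT[symmetric] by (simp add: X_def)
    define \<psi> where "\<psi> x = dist_fun \<mu> x - dist_fun \<mu> (x + P m)" for x
    obtain s where s: "0 \<le> s" "s \<le> 1" "intI lebesgue (- P m) (P m) (\<lambda>x. \<bar>\<psi> x - \<psi> s\<bar>) \<le> 200 * (P m + 1)\<^sup>2 * n"
      using local_norm_oscillation[OF mu ln n elim(2)] unfolding \<psi>_def by blast
    define c where "c = \<Phi> s - \<Phi> (s + P m)"
    define \<theta> where "\<theta> x = \<Phi> x - \<Phi> (x + P m) - c" for x
    have \<rho>c: "dist_fun \<rho> x - dist_fun \<rho> (x + P m) = dist_fun \<rho> s - dist_fun \<rho> (s + P m)" for x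
    proof -
      have "dist_fun (\<lambda>B. \<rho> B - shift_measure (P m) \<rho> B) x' = 0" for x'
        by (simp add: dist_fun_def shift_measure_def per)
      then show ?thesis using dist_fun_diff_shift[OF rho, of x "P m" s] by simp
    qed
    have th: "norm (\<theta> x) = \<bar>\<psi> x - \<psi> s\<bar>" for x
    proof -
      have "\<theta> x = of_real (\<psi> x - \<psi> s) - z * of_real ((dist_fun \<rho> x - dist_fun \<rho> (x + P m)) - (dist_fun \<rho> s - dist_fun \<rho> (s + P m)))"
        by (simp add: \<theta>_def c_def \<Phi>_def \<psi>_def algebra_simps)
      then have "\<theta> x = of_real (\<psi> x - \<psi> s)" by (simp only: \<rho>c[of x] diff_self of_real_0 mult_zero_right diff_zero)
      then show ?thesis by (simp only: norm_of_real)
    qed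
    have ths: "\<theta> s = 0" by (simp add: \<theta>_def c_def)
    let ?h = "\<lambda>x. \<bar>b (x + P m) - b x\<bar> + 2 * \<beta> * norm (\<theta> x)"
    obtain D where D: "\<And>t. s \<le> t \<Longrightarrow> t \<le> s + P m \<Longrightarrow> norm (u (t + P m) + u (t - P m) - D * u t) \<le>
      growth_const \<omega> * exp (\<omega> * P m) * B * intI lebesgue (t - P m) t ?h"
      using gordon_relation[OF qs om(1,2) s(1) P0 B \<theta>_def ths] by blast
    have lth: "loc_bdd lebesgue (\<lambda>x. \<bar>\<psi> x - \<psi> s\<bar>)"
    proof -
      have "loc_bdd lebesgue (\<lambda>x. norm (dist_fun \<mu> x - dist_fun \<mu> (x + P m) - \<psi> s))"
        by (intro loc_bdd_intros loc_bdd_shift loc_bdd_dist_fun mu locfin_lebesgue)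
      then show ?thesis by (simp add: \<psi>_def)
    qed
    have lb: "loc_bdd lebesgue (\<lambda>x. \<bar>b (x + P m) - b x\<bar>)"
      using loc_bdd_norm[OF loc_bdd_diff[OF loc_bdd_shift[OF loc_bdd_b] loc_bdd_b]] by simp
    have l2: "loc_bdd lebesgue (\<lambda>x. 2 * \<beta> * \<bar>\<psi> x - \<psi> s\<bar>)" using loc_bdd_scaleR[OF loc_bdd_const lth, of "2 * \<beta>"] by simp
    have lh: "loc_bdd lebesgue ?h" unfolding th by (intro loc_bdd_add lb l2)
    have hint: "intI lebesgue (- P m) (P m) ?h \<le> \<beta>\<^sup>2 * T m + 400 * \<beta> * (P m + 1)\<^sup>2 * n"
    proof -
      have "intI lebesgue (- P m) (P m) ?h = intI lebesgue (- P m) (P m) (\<lambda>x. \<bar>b (x + P m) - b x\<bar>) + 2 * \<beta> * intI lebesgue (- P m) (P m) (\<lambda>x. \<bar>\<psi> x - \<psi> s\<bar>)"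
        unfolding th by (subst intI_add[OF locfin_lebesgue lb l2]) simp
      also have "\<dots> \<le> \<beta>\<^sup>2 * T m + 2 * \<beta> * (200 * (P m + 1)\<^sup>2 * n)"
        using be by (intro add_mono mult_left_mono s(3) reciprocal_L1_bound[OF loc_bdd_b b0 bb(2) ab AM(1) da T0]) auto
      finally show ?thesis by simp
    qed
    show ?case
    proof (intro exI[of _ D] allI impI)
      fix t assume t: "1 \<le> t" "t \<le> P m"
      have "intI lebesgue (t - P m) t ?h \<le> intI lebesgue (- P m) (P m) ?h"
      proof -
        have "0 \<le> intI lebesgue (- P m) (t - P m) ?h" "0 \<le> intI lebesgue t (P m) ?h"
          using be by (auto intro!: intI_nonneg)
        then show ?thesis
          using intI_combine[OF locfin_lebesgue lh, of "- P m" "t - P m" t] intI_combine[OF locfin_lebesgue lh, of "- P m" t "P m"] t P0[of m]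
          by simp
      qed
      then have "intI lebesgue (t - P m) t ?h \<le> \<beta>\<^sup>2 * T m + 400 * \<beta> * (P m + 1)\<^sup>2 * n" using hint by linarith
      then have "growth_const \<omega> * exp (\<omega> * P m) * B * intI lebesgue (t - P m) t ?h \<le> E m"
        unfolding E_def n_def using growth_const_pos[of \<omega>] B0 by (intro mult_left_mono) auto
      moreover have "norm (u (t + P m) + u (t - P m) - D * u t) \<le> growth_const \<omega> * exp (\<omega> * P m) * B * intI lebesgue (t - P m) t ?h"
        by (rule D) (use t s in auto)
      ultimately show "norm (u (t + P m) + u (t - P m) - D * u t) \<le> E m" by linarith
    qed
  qed
  moreover have "\<exists>X. \<forall>t. X \<le> \<bar>t\<bar> \<longrightarrow> norm (u t) \<le> e" if "0 < e" for e
    using quasi_sol_decay[OF qs om(1,2) int p0 that] by blast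
  ultimately have "(\<forall>t. 1 \<le> t \<longrightarrow> t \<le> 2 \<longrightarrow> u t = 0) \<or> (\<forall>t. -1 \<le> t \<longrightarrow> t \<le> 0 \<longrightarrow> u t = 0)"
    by (intro gordon_dichotomy[OF _ Pinf E])
  then have "u x = 0" for x
  proof
    assume "\<forall>t. 1 \<le> t \<longrightarrow> t \<le> 2 \<longrightarrow> u t = 0"
    then show ?thesis using quasi_sol_unique_continuation[OF qs om(1,2), of 1 2 x] by simp
  next
    assume "\<forall>t. -1 \<le> t \<longrightarrow> t \<le> 0 \<longrightarrow> u t = 0"
    then show ?thesis using quasi_sol_unique_continuation[OF qs om(1,2), of "-1" 0 x] by simp
  qed
  then have "AE t in ?R. f t = 0" using fh(3) by simp
  then show False using nz by contradiction
qed

end
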